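(* Let $(X,d)$ be a hyperbolic metric space, $o\in X$, $b>1$ a parameter admitting a visual metric $D=D_{b,o}$ on $\partial X$, and let $G\le\mathrm{Isom}(X)$ be a strongly discrete group of general type. Let $\delta\in[0,\infty]$ be the Poincaré exponent of $G$ relative to $b$, and let $\Lambda_r$ and $\Lambda_{ur}$ be the radial and uniformly radial limit sets of $G$. Then $$\dim_H(\Lambda_r)=\dim_H(\Lambda_{ur})=\delta ;$$ moreover, for every $0<s<\delta$ there exists an Ahlfors $s$-regular set $\mathcal J_s\subset\Lambda_{ur}$.
   Context: For a metric space $(X,d)$ let $\langle x|y\rangle_z=\frac12[d(x,z)+d(y,z)-d(x,y)]$. $(X,d)$ is (Gromov) hyperbolic if there is $C\ge 0$ with $\langle x|z\rangle_w\ge\min(\langle x|y\rangle_w,\langle y|z\rangle_w)-C$ for all $x,y,z,w\in X$ ($X$ need not be proper or geodesic). Fix a basepoint $o\in X$. A sequence $(x_n)$ in $X$ is a Gromov sequence if $\langle x_n|x_m\rangle_o\to\infty$ as $n,m\to\infty$; two Gromov sequences are equivalent if $\langle x_n|y_n\rangle_o\to\infty$; the Gromov boundary $\partial X$ is the set of equivalence classes, and isometries of $X$ act on it. For $\xi,\eta\in\partial X$ and $y,z\in X$: $\langle\xi|\eta\rangle_z=\inf\{\liminf_{n,m\to\infty}\langle x_n|y_m\rangle_z:(x_n)\in\xi,(y_m)\in\eta\}$ and $\langle\xi|y\rangle_z=\langle y|\xi\rangle_z=\inf\{\liminf_{n\to\infty}\langle x_n|y\rangle_z:(x_n)\in\xi\}$.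 A sequence $(x_n)$ in $X\cup\partial X$ converges to $\xi\in\partial X$ iff $\langle x_n|\xi\rangle_o\to\infty$. The parameter $b>1$ is close enough to $1$ that there is a complete metric $D=D_{b,o}$ on $\partial X$ (a visual metric) with $C^{-1}b^{-\langle\xi|\eta\rangle_o}\le D(\xi,\eta)\le Cb^{-\langle\xi|\eta\rangle_o}$ for some constant $C\geq 1$; such a $D$ is fixed, and all metric notions on $\partial X$ (in particular Hausdorff dimension $\dim_H$) refer to $D$. $G\le\mathrm{Isom}(X)$ is strongly discrete if $\{g\in G:d(o,g(o))\le r\}$ is finite for every $r>0$. An isometry $g$ is loxodromic if it has two fixed points $g_+,g_-\in\partial X$ such that for every neighborhood $U$ of $g_-$ the iterates $g^n$ converge to $g_+$ uniformly on $\partial X\setminus U$, and $g^{-1}$ has the same property (with $g_+$ and $g_-$ exchanged). $G$ is of general type if it contains two loxodromic isometries with disjoint fixed-point sets in $\partial X$. The Poincaré exponent is $\delta=\inf\{s\ge0:\sum_{g\in G}b^{-s\,d(o,g(o))}<\infty\}$, $\inf\emptyset=\infty$. For $\sigma>0$, $\Lambda_{r,\sigma}$ is the set of $\eta\in\partial X$ for which there is a sequence $(g_n)_1^\infty$ in $G$ with $g_n(o)\to\eta$ and $\langle o|\eta\rangle_{g_n(o)}\le\sigma$ for all $n$; $\Lambda_r=\bigcup_{\sigma>0}\Lambda_{r,\sigma}$. $\Lambda_{ur,\sigma}$ is the set of $\eta$ for which such a sequence can be chosen with in addition $g_1(o)=o$ and $d(g_n(o),g_{n+1}(o))\le\sigma$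 for all $n$; $\Lambda_{ur}=\bigcup_{\sigma>0}\Lambda_{ur,\sigma}$. A finite Borel measure $\mu$ on a metric space is Ahlfors $s$-regular if there is $C\ge1$ with $C^{-1}r^s\le\mu(B(z,r))\le Cr^s$ for all $z\in\mathrm{Supp}(\mu)$ and $r\in(0,1)$ ($B(z,r)$ is the closed ball). A set is Ahlfors $s$-regular if it is the topological support of some Ahlfors $s$-regular measure. *)

theory Defs
  imports "HOL-Analysis.Analysis" "HOL-Algebra.Group"
begin

section \<open>Gromov hyperbolic metric spaces and their boundary\<close>

text \<open>The basepoint (the subscript in the usual notation) is always the first argument.\<close>

definition gromov_product :: "'a::metric_space \<Rightarrow> 'a \<Rightarrow> 'a \<Rightarrow> real" where
  "gromov_product z x y = (dist x z + dist y z - dist x y) / 2"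

definition gromov_hyperbolic :: "'a::metric_space itself \<Rightarrow> bool" where
  "gromov_hyperbolic _ \<longleftrightarrow>
    (\<exists>C\<ge>0. \<forall>x y z w :: 'a.
       gromov_product w x z \<ge> min (gromov_product w x y) (gromov_product w y z) - C)"

definition gromov_sequence :: "'a::metric_space \<Rightarrow> (nat \<Rightarrow> 'a) \<Rightarrow> bool" where
  "gromov_sequence p x \<longleftrightarrow>
    filterlim (\<lambda>(n, m). gromov_product p (x n) (x m)) at_top (sequentially \<times>\<^sub>F sequentially)"

definition gromov_equiv :: "'a::metric_space \<Rightarrow> ((nat \<Rightarrow> 'a) \<times> (nat \<Rightarrow> 'a)) set" where
  "gromov_equiv p = {(x, y). gromov_sequence p x \<and> gromov_sequence p y \<and>
     filterlim (\<lambda>n. gromov_product p (x n) (y n)) at_top sequentially}"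

definition gromov_boundary :: "'a::metric_space \<Rightarrow> (nat \<Rightarrow> 'a) set set" where
  "gromov_boundary p = {x. gromov_sequence p x} // gromov_equiv p"

text \<open>Gromov products involving boundary points take values in \<open>[0, \<infinity>]\<close>; for instance
  the product of a boundary point with itself is \<open>\<infinity>\<close>.\<close>

definition gromov_product_bd :: "'a::metric_space \<Rightarrow> (nat \<Rightarrow> 'a) set \<Rightarrow> (nat \<Rightarrow> 'a) set \<Rightarrow> ereal" where
  "gromov_product_bd z \<xi> \<eta> =
    (INF x\<in>\<xi>. INF y\<in>\<eta>. Liminf (sequentially \<times>\<^sub>F sequentially)
       (\<lambda>(n, m). ereal (gromov_product z (x n) (y m))))"

definition gromov_product_bd_pt :: "'a::metric_space \<Rightarrow> (nat \<Rightarrow> 'a) set \<Rightarrow> 'a \<Rightarrow> ereal" where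
  "gromov_product_bd_pt z \<xi> y = (INF x\<in>\<xi>. liminf (\<lambda>n. ereal (gromov_product z (x n) y)))"

definition converges_to_boundary :: "'a::metric_space \<Rightarrow> (nat \<Rightarrow> 'a) \<Rightarrow> (nat \<Rightarrow> 'a) set \<Rightarrow> bool" where
  "converges_to_boundary p x \<xi> \<longleftrightarrow> (\<lambda>n. gromov_product_bd_pt p \<xi> (x n)) \<longlonglongrightarrow> \<infinity>"

text \<open>\<open>b\<^bsup>-t\<^esup>\<close> for \<open>t \<in> [0, \<infinity>]\<close>.  The case distinction is needed because
  \<open>real_of_ereal \<infinity> = 0\<close>.\<close>

definition powr_minus :: "real \<Rightarrow> ereal \<Rightarrow> real" where
  "powr_minus b t = (if t = \<infinity> then 0 else b powr (- real_of_ereal t))"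

definition visual_metric :: "real \<Rightarrow> 'a::metric_space \<Rightarrow> (nat \<Rightarrow> 'a) set metric \<Rightarrow> bool" where
  "visual_metric b p D \<longleftrightarrow>
    mspace D = gromov_boundary p \<and> mcomplete_of D \<and>
    (\<exists>C\<ge>1. \<forall>\<xi>\<in>gromov_boundary p. \<forall>\<eta>\<in>gromov_boundary p.
       powr_minus b (gromov_product_bd p \<xi> \<eta>) / C \<le> mdist D \<xi> \<eta> \<and>
       mdist D \<xi> \<eta> \<le> C * powr_minus b (gromov_product_bd p \<xi> \<eta>))"


section \<open>Groups of isometries\<close>

definition isometry :: "('a::metric_space \<Rightarrow> 'a) \<Rightarrow> bool" where
  "isometry g \<longleftrightarrow> bij g \<and> (\<forall>x y. dist (g x) (g y) = dist x y)"

definition isom_group :: "('a::metric_space \<Rightarrow> 'a) monoid" where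
  "isom_group = \<lparr>carrier = {g. isometry g}, mult = (\<circ>), one = id\<rparr>"

lemma group_isom_group: "group isom_group"
proof (rule groupI)
  fix g :: "'a \<Rightarrow> 'a" assume "g \<in> carrier isom_group"
  then have g: "bij g" "\<And>x y. dist (g x) (g y) = dist x y"
    by (auto simp: isom_group_def isometry_def)
  have "dist (inv_into UNIV g x) (inv_into UNIV g y) = dist x y" for x y
    by (metis g bij_inv_eq_iff)
  then have "isometry (inv_into UNIV g)"
    using g(1) by (simp add: isometry_def bij_imp_bij_inv)
  moreover have "inv_into UNIV g \<circ> g = id"
    using g(1) by (simp add: bij_is_inj)
  ultimately show "\<exists>h\<in>carrier isom_group. h \<otimes>\<^bsub>isom_group\<^esub> g = \<one>\<^bsub>isom_group\<^esub>"
    by (auto simp: isom_group_def)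
qed (auto simp: isom_group_def isometry_def bij_comp comp_assoc)

definition strongly_discrete :: "'a::metric_space \<Rightarrow> ('a \<Rightarrow> 'a) set \<Rightarrow> bool" where
  "strongly_discrete p G \<longleftrightarrow> (\<forall>r>0. finite {g \<in> G. dist p (g p) \<le> r})"

text \<open>Boundary points are equivalence classes of sequences, so a bijective isometry acts on them
  by taking images.\<close>

definition boundary_action :: "('a \<Rightarrow> 'a) \<Rightarrow> (nat \<Rightarrow> 'a) set \<Rightarrow> (nat \<Rightarrow> 'a) set" where
  "boundary_action g \<xi> = (\<lambda>x. g \<circ> x) ` \<xi>"

definition boundary_fixed_points :: "'a::metric_space \<Rightarrow> ('a \<Rightarrow> 'a) \<Rightarrow> (nat \<Rightarrow> 'a) set set" where
  "boundary_fixed_points p g = {\<xi> \<in> gromov_boundary p. boundary_action g \<xi> = \<xi>}"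

text \<open>The iterates of \<open>g\<close> converge to \<open>\<alpha>\<close> uniformly outside each neighbourhood of \<open>\<rho>\<close>.\<close>

definition attracts_away_from ::
  "(nat \<Rightarrow> 'a) set metric \<Rightarrow> ('a \<Rightarrow> 'a) \<Rightarrow> (nat \<Rightarrow> 'a) set \<Rightarrow> (nat \<Rightarrow> 'a) set \<Rightarrow> bool" where
  "attracts_away_from D g \<rho> \<alpha> \<longleftrightarrow>
    (\<forall>U. (\<exists>V. openin (mtopology_of D) V \<and> \<rho> \<in> V \<and> V \<subseteq> U) \<longrightarrow>
       (\<forall>\<epsilon>>0. \<exists>N. \<forall>n\<ge>N. \<forall>\<xi>\<in>mspace D - U. mdist D (boundary_action (g ^^ n) \<xi>) \<alpha> < \<epsilon>))"

definition loxodromic ::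
  "'a::metric_space \<Rightarrow> (nat \<Rightarrow> 'a) set metric \<Rightarrow> ('a \<Rightarrow> 'a) \<Rightarrow> bool" where
  "loxodromic p D g \<longleftrightarrow> isometry g \<and>
    (\<exists>\<alpha>\<in>boundary_fixed_points p g. \<exists>\<rho>\<in>boundary_fixed_points p g. \<alpha> \<noteq> \<rho> \<and>
       attracts_away_from D g \<rho> \<alpha> \<and> attracts_away_from D (inv_into UNIV g) \<alpha> \<rho>)"

definition general_type ::
  "'a::metric_space \<Rightarrow> (nat \<Rightarrow> 'a) set metric \<Rightarrow> ('a \<Rightarrow> 'a) set \<Rightarrow> bool" where
  "general_type p D G \<longleftrightarrow>
    (\<exists>g\<in>G. \<exists>h\<in>G. loxodromic p D g \<and> loxodromic p D h \<and>
       boundary_fixed_points p g \<inter> boundary_fixed_points p h = {})"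

definition poincare_exponent :: "real \<Rightarrow> 'a::metric_space \<Rightarrow> ('a \<Rightarrow> 'a) set \<Rightarrow> ereal" where
  "poincare_exponent b p G =
    Inf {ereal s | s. 0 \<le> s \<and> (\<lambda>g. b powr (- s * dist p (g p))) summable_on G}"


section \<open>Radial and uniformly radial limit sets\<close>

definition radial_limit_set_at ::
  "'a::metric_space \<Rightarrow> ('a \<Rightarrow> 'a) set \<Rightarrow> real \<Rightarrow> (nat \<Rightarrow> 'a) set set" where
  "radial_limit_set_at p G \<sigma> = {\<eta> \<in> gromov_boundary p. \<exists>g :: nat \<Rightarrow> 'a \<Rightarrow> 'a.
     (\<forall>n. g n \<in> G) \<and> converges_to_boundary p (\<lambda>n. g n p) \<eta> \<and>
     (\<forall>n. gromov_product_bd_pt (g n p) \<eta> p \<le> ereal \<sigma>)}"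

definition radial_limit_set :: "'a::metric_space \<Rightarrow> ('a \<Rightarrow> 'a) set \<Rightarrow> (nat \<Rightarrow> 'a) set set" where
  "radial_limit_set p G = (\<Union>\<sigma>\<in>{0<..}. radial_limit_set_at p G \<sigma>)"

text \<open>Sequences are indexed from \<open>0\<close>, so \<open>g 0\<close> is the first term of the sequence.\<close>

definition unif_radial_limit_set_at ::
  "'a::metric_space \<Rightarrow> ('a \<Rightarrow> 'a) set \<Rightarrow> real \<Rightarrow> (nat \<Rightarrow> 'a) set set" where
  "unif_radial_limit_set_at p G \<sigma> = {\<eta> \<in> gromov_boundary p. \<exists>g :: nat \<Rightarrow> 'a \<Rightarrow> 'a.
     (\<forall>n. g n \<in> G) \<and> converges_to_boundary p (\<lambda>n. g n p) \<eta> \<and>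
     (\<forall>n. gromov_product_bd_pt (g n p) \<eta> p \<le> ereal \<sigma>) \<and>
     g 0 p = p \<and> (\<forall>n. dist (g n p) (g (Suc n) p) \<le> \<sigma>)}"

definition unif_radial_limit_set :: "'a::metric_space \<Rightarrow> ('a \<Rightarrow> 'a) set \<Rightarrow> (nat \<Rightarrow> 'a) set set" where
  "unif_radial_limit_set p G = (\<Union>\<sigma>\<in>{0<..}. unif_radial_limit_set_at p G \<sigma>)"


section \<open>Hausdorff dimension and Ahlfors regularity\<close>

definition mdiam :: "'b metric \<Rightarrow> 'b set \<Rightarrow> ennreal" where
  "mdiam m U = (SUP x\<in>U. SUP y\<in>U. ennreal (mdist m x y))"

text \<open>If no countable cover of mesh at most \<open>\<epsilon>\<close> exists, the infimum is taken over the empty set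
  and equals \<open>\<infinity>\<close>.\<close>

definition hausdorff_premeasure :: "'b metric \<Rightarrow> real \<Rightarrow> real \<Rightarrow> 'b set \<Rightarrow> ennreal" where
  "hausdorff_premeasure m s \<epsilon> A =
    Inf {\<Sum>i. ennreal (enn2real (mdiam m (U i)) powr s) | U :: nat \<Rightarrow> 'b set.
      (\<forall>i. U i \<subseteq> mspace m \<and> mdiam m (U i) \<le> ennreal \<epsilon>) \<and> A \<subseteq> (\<Union>i. U i)}"

definition hausdorff_measure :: "'b metric \<Rightarrow> real \<Rightarrow> 'b set \<Rightarrow> ennreal" where
  "hausdorff_measure m s A = (SUP \<epsilon>\<in>{0<..}. hausdorff_premeasure m s \<epsilon> A)"

text \<open>The exponent \<open>0\<close> is left out to avoid a convention for \<open>0\<^sup>0\<close>; this does not change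
  the infimum.\<close>

definition hausdorff_dim :: "'b metric \<Rightarrow> 'b set \<Rightarrow> ereal" where
  "hausdorff_dim m A = Inf {ereal s | s. 0 < s \<and> hausdorff_measure m s A = 0}"

definition finite_borel_measure_on :: "'b metric \<Rightarrow> 'b measure \<Rightarrow> bool" where
  "finite_borel_measure_on m \<mu> \<longleftrightarrow> finite_measure \<mu> \<and> space \<mu> = mspace m \<and>
     sets \<mu> = sigma_sets (mspace m) {U. openin (mtopology_of m) U}"

definition measure_support :: "'b metric \<Rightarrow> 'b measure \<Rightarrow> 'b set" where
  "measure_support m \<mu> =
    {z \<in> mspace m. \<forall>U. openin (mtopology_of m) U \<and> z \<in> U \<longrightarrow> measure \<mu> U > 0}"

definition ahlfors_regular_measure :: "'b metric \<Rightarrow> real \<Rightarrow> 'b measure \<Rightarrow> bool" where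
  "ahlfors_regular_measure m s \<mu> \<longleftrightarrow> finite_borel_measure_on m \<mu> \<and>
    (\<exists>C\<ge>1. \<forall>z\<in>measure_support m \<mu>. \<forall>r. 0 < r \<and> r < 1 \<longrightarrow>
       r powr s / C \<le> measure \<mu> (mcball_of m z r) \<and> measure \<mu> (mcball_of m z r) \<le> C * r powr s)"

definition ahlfors_regular_set :: "'b metric \<Rightarrow> real \<Rightarrow> 'b set \<Rightarrow> bool" where
  "ahlfors_regular_set m s J \<longleftrightarrow>
    (\<exists>\<mu>. ahlfors_regular_measure m s \<mu> \<and> J = measure_support m \<mu>)"

end

theory Submission
  imports Defs "HOL-Probability.Infinite_Product_Measure"
begin

text \<open>Write \<open>|g|\<close> for the distance from \<open>p\<close> to \<open>g p\<close>.  The upper bound for the dimension is the usual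
  covering argument: the shadow of \<open>g\<close> has diameter of order \<open>b\<^sup>-\<^sup>|\<^sup>g\<^sup>|\<close>, and a radial limit point
  lies in shadows of elements with arbitrarily large \<open>|g|\<close>.

  For the lower bound let \<open>s < \<delta>\<close>.  Divergence of the Poincare series beyond \<open>s\<close> gives annuli
  containing far more than \<open>b\<^sup>s\<^sup>n\<close> orbit points at distance about \<open>n\<close>.  Multiplying on both sides by
  large powers of two independent loxodromic elements, and thinning out, yields a finite set \<open>S\<close>
  of at least \<open>b\<^sup>s\<^sup>n\<close> elements with \<open>|g| \<le> n\<close> such that every word in \<open>S\<close> traces a quasi-geodesic with
  uniform constants.  Put \<open>L = log b (card S) / s\<close>, so that \<open>L \<ge> n\<close>.  Inserting copies of a fixed
  letter after each free choice from \<open>S\<close>, one arranges that after \<open>k\<close> free choices the displacement is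
  \<open>k L\<close> up to a bounded error.  Hence infinite sequences in \<open>S\<close> embed into the boundary
  in a bi-Lipschitz way for the ultrametric with ratio \<open>b\<^sup>-\<^sup>L\<close>, and the uniform
  product measure is carried to an Ahlfors \<open>s\<close>-regular measure supported on uniformly radial
  limit points.\<close>

section \<open>Gromov products and the boundary\<close>

text \<open>The space need be neither geodesic nor proper, so there are no geodesics to follow and
  no compactness to produce limits: every estimate is made with Gromov products of orbit points.
  Displacement is almost additive along a word when each juncture has product at most \<sigma> and
  each letter is long compared with \<sigma> and \<open>c\<close>. The loss is bounded independently
  of the length of the word, because at every juncture the two pieces are compared only with the two
  letters next to it. For this \<sigma> must be fixed before the lengths are chosen, hence the need
  for bounds uniform in the exponent of the loxodromic powers. The gap between \<open>s\<close> and
  \<delta> pays for the constant factors lost by pigeonhole and by thinning out.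

  The value of \<open>L\<close> is forced: \<open>card S * b powr (- L * s) = 1\<close> says that a
  cylinder of depth \<open>k\<close>, of diameter about \<open>b powr (- k * L)\<close>, has as its
  mass the \<open>s\<close>-th power of that scale. Padding can only lengthen a word, so a free
  letter must not overshoot on its own; it adds at most \<open>n\<close>, and
  \<open>n \<le> L\<close> prevents the excess from growing.\<close>

abbreviation gp :: "'a::metric_space \<Rightarrow> 'a \<Rightarrow> 'a \<Rightarrow> real" where
  "gp \<equiv> gromov_product"

abbreviation inv_map :: "('a \<Rightarrow> 'b) \<Rightarrow> 'b \<Rightarrow> 'a" where
  "inv_map \<equiv> inv_into UNIV"

lemma gp_commute: "gp z x y = gp z y x"
  by (simp add: gromov_product_def dist_commute)

lemma gp_nonneg: "0 \<le> gp z x y"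
  using dist_triangle2[of x y z] by (simp add: gromov_product_def)

lemma gp_self_right: "gp z x z = 0"
  by (simp add: gromov_product_def)

lemma gp_le_left: "gp z x y \<le> dist z x"
  using dist_triangle[of y z x] by (simp add: gromov_product_def dist_commute)

lemma gp_le_right: "gp z x y \<le> dist z y"
  using gp_le_left[of z y x] by (simp add: gp_commute)

text \<open>Turns a small product at one end into a large product at the other. This replaces the
  statement that a point lies near a geodesic.\<close>

lemma gp_flip: "gp z x y + gp x z y = dist z x"
  by (simp add: gromov_product_def dist_commute field_simps)

lemma gp_basepoint: "gp z x y \<le> gp w x y + dist z w"
  using dist_triangle[of x z w] dist_triangle[of y z w]
  by (simp add: gromov_product_def dist_commute field_simps)

lemma gp_isometry: "isometry g \<Longrightarrow> gp (g z) (g x) (g y) = gp z x y"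
  by (simp add: gromov_product_def isometry_def)

lemma isometry_dist: "isometry g \<Longrightarrow> dist (g x) (g y) = dist x y"
  by (simp add: isometry_def)

lemma isometry_inv_right: "isometry g \<Longrightarrow> g (inv_map g x) = x"
  by (simp add: isometry_def bij_is_surj surj_f_inv_f)

lemma isometry_inv_left: "isometry g \<Longrightarrow> inv_map g (g x) = x"
  by (simp add: isometry_def bij_is_inj inv_f_f)

lemma isometry_inv:
  assumes "isometry g" shows "isometry (inv_map g)"
proof -
  have "dist (inv_map g x) (inv_map g y) = dist x y" for x y
    by (metis assms isometry_dist isometry_inv_right)
  then show ?thesis
    using assms by (simp add: isometry_def bij_imp_bij_inv)
qed

lemma isometry_comp: "isometry g \<Longrightarrow> isometry h \<Longrightarrow> isometry (g \<circ> h)"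
  by (simp add: isometry_def bij_comp)

lemma isometry_id: "isometry id"
  by (simp add: isometry_def)

lemma isometry_funpow: "isometry g \<Longrightarrow> isometry (g ^^ n)"
  by (induction n) (auto simp: isometry_id isometry_comp simp del: o_apply)

lemma dist_inv_isometry: "isometry g \<Longrightarrow> dist x (inv_map g x) = dist x (g x)"
  by (metis dist_commute isometry_dist isometry_inv_right)

text \<open>Applying \<open>g\<close> carries the corner at \<open>x\<close> to the corner at
  \<open>g x\<close>, so junctures of words can be measured at the basepoint.\<close>

lemma gp_inv_isometry: "isometry g \<Longrightarrow> gp x (inv_map g x) y = gp (g x) x (g y)"
  by (metis gp_isometry isometry_inv_right)

section \<open>Gromov sequences under change of basepoint and under isometries\<close>

lemma gromov_sequence_iff:
  "gromov_sequence p x \<longleftrightarrow> (\<forall>t. \<exists>N. \<forall>n\<ge>N. \<forall>m\<ge>N. t \<le> gp p (x n) (x m))"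
  unfolding gromov_sequence_def filterlim_at_top eventually_prod_sequentially
  by (intro all_cong1 ex_cong1) (simp, metis gp_commute)

lemma gromov_equiv_iff:
  "(x, y) \<in> gromov_equiv p \<longleftrightarrow> gromov_sequence p x \<and> gromov_sequence p y \<and>
     (\<forall>t. \<exists>N. \<forall>n\<ge>N. t \<le> gp p (x n) (y n))"
  by (simp add: gromov_equiv_def filterlim_at_top eventually_sequentially)

lemma gromov_sequence_basepoint:
  fixes p q :: "'a::metric_space"
  shows "gromov_sequence p x \<longleftrightarrow> gromov_sequence q x"
proof -
  have "gromov_sequence q x" if x: "gromov_sequence p x" for p q :: 'a
    unfolding gromov_sequence_iff
  proof
    fix t
    obtain N where "\<forall>n\<ge>N. \<forall>m\<ge>N. t + dist p q \<le> gp p (x n) (x m)"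
      using x unfolding gromov_sequence_iff by blast
    then have "t \<le> gp q (x n) (x m)" if "n \<ge> N" "m \<ge> N" for n m
      using that gp_basepoint[of p "x n" "x m" q] by fastforce
    then show "\<exists>N. \<forall>n\<ge>N. \<forall>m\<ge>N. t \<le> gp q (x n) (x m)"
      by blast
  qed
  then show ?thesis by blast
qed

lemma gromov_equiv_basepoint:
  fixes p q :: "'a::metric_space"
  shows "gromov_equiv p = gromov_equiv q"
proof -
  have "gromov_equiv p \<subseteq> gromov_equiv q" for p q :: 'a
  proof (rule subrelI)
    fix x y assume xy: "(x, y) \<in> gromov_equiv p"
    have "\<exists>N. \<forall>n\<ge>N. t \<le> gp q (x n) (y n)" for t
    proof -
      obtain N where N: "\<forall>n\<ge>N. t + dist p q \<le> gp p (x n) (y n)"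
        using xy unfolding gromov_equiv_iff by blast
      have "t \<le> gp q (x n) (y n)" if "n \<ge> N" for n
        using N that gp_basepoint[of p "x n" "y n" q] by fastforce
      then show ?thesis by blast
    qed
    then show "(x, y) \<in> gromov_equiv q"
      using xy gromov_sequence_basepoint[of p _ q] by (auto simp: gromov_equiv_iff)
  qed
  then show ?thesis by blast
qed

text \<open>An isometry moves the basepoint too; independence of the basepoint moves it
  back.\<close>

lemma gromov_equiv_isometry:
  assumes "isometry g" "(x, y) \<in> gromov_equiv p"
  shows "(g \<circ> x, g \<circ> y) \<in> gromov_equiv p"
proof -
  have "(g \<circ> x, g \<circ> y) \<in> gromov_equiv (g p)"
    using assms by (simp add: gromov_equiv_iff gromov_sequence_iff gp_isometry)
  then show ?thesis
    using gromov_equiv_basepoint by blast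
qed

section \<open>Boundary points and their products through representatives\<close>

locale hyperbolic_space =
  fixes p :: "'a::metric_space" and c :: real
  assumes c_nonneg: "0 \<le> c"
    and hyp: "\<And>w x y z. min (gp w x y) (gp w y z) - c \<le> gp w x (z :: 'a)"
begin

lemma hyp2: "min (gp w x (y :: 'a)) (min (gp w y z) (gp w z u)) - 2 * c \<le> gp w x u"
  using hyp[of w x y u] hyp[of w y z u] c_nonneg by linarith

text \<open>Equivalence compares equal indices only. Passing through \<open>x m\<close> controls all
  pairs of late indices, at the cost of one \<open>c\<close>.\<close>

lemma gromov_equiv_products:
  assumes "(x, y) \<in> gromov_equiv p"
  obtains N where "\<And>n m. n \<ge> N \<Longrightarrow> m \<ge> N \<Longrightarrow> t \<le> gp z (x n) (y m)"
proof -
  have xy: "(x, y) \<in> gromov_equiv z"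
    using assms gromov_equiv_basepoint by blast
  obtain N1 where N1: "\<forall>n\<ge>N1. \<forall>m\<ge>N1. t + c \<le> gp z (x n) (x m)"
    using xy unfolding gromov_equiv_iff gromov_sequence_iff by blast
  obtain N2 where N2: "\<forall>n\<ge>N2. t + c \<le> gp z (x n) (y n)"
    using xy unfolding gromov_equiv_iff by blast
  show thesis
  proof (rule that[of "max N1 N2"])
    fix n m assume "n \<ge> max N1 N2" "m \<ge> max N1 N2"
    then show "t \<le> gp z (x n) (y m)"
      using N1 N2 hyp[of z "x n" "x m" "y m"] by (smt (verit) max.bounded_iff)
  qed
qed

lemma equiv_gromov_equiv: "equiv {x. gromov_sequence p x} (gromov_equiv p)"
proof (rule equivI)
  show "gromov_equiv p \<subseteq> {x. gromov_sequence p x} \<times> {x. gromov_sequence p x}"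
    by (auto simp: gromov_equiv_iff)
  show "refl_on {x. gromov_sequence p x} (gromov_equiv p)"
  proof (rule refl_onI)
    fix x assume "x \<in> {x. gromov_sequence p x}"
    then have x: "gromov_sequence p x" by simp
    then have "\<forall>t. \<exists>N. \<forall>n\<ge>N. t \<le> gp p (x n) (x n)"
      unfolding gromov_sequence_iff by blast
    with x show "(x, x) \<in> gromov_equiv p"
      by (simp add: gromov_equiv_iff)
  qed
  show "sym (gromov_equiv p)"
    by (rule symI) (simp add: gromov_equiv_iff gp_commute)
  show "trans (gromov_equiv p)"
  proof (rule transI)
    fix x y z assume xy: "(x, y) \<in> gromov_equiv p" and yz: "(y, z) \<in> gromov_equiv p"
    have "\<exists>N. \<forall>n\<ge>N. t \<le> gp p (x n) (z n)" for t
    proof -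
      obtain N1 where N1: "\<And>n m. n \<ge> N1 \<Longrightarrow> m \<ge> N1 \<Longrightarrow> t + c \<le> gp p (x n) (y m)"
        using gromov_equiv_products[OF xy] by metis
      obtain N2 where N2: "\<And>n m. n \<ge> N2 \<Longrightarrow> m \<ge> N2 \<Longrightarrow> t + c \<le> gp p (y n) (z m)"
        using gromov_equiv_products[OF yz] by metis
      have "t \<le> gp p (x n) (z n)" if "n \<ge> max N1 N2" for n
        using N1[of n n] N2[of n n] that hyp[of p "x n" "y n" "z n"] by simp
      then show ?thesis by blast
    qed
    then show "(x, z) \<in> gromov_equiv p"
      using xy yz by (simp add: gromov_equiv_iff)
  qed
qed

lemma boundary_ne:
  assumes "\<xi> \<in> gromov_boundary p" obtains x where "x \<in> \<xi>"
  using in_quotient_imp_non_empty[OF equiv_gromov_equiv] assms unfolding gromov_boundary_def by blast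

lemma boundary_equiv:
  "\<xi> \<in> gromov_boundary p \<Longrightarrow> x \<in> \<xi> \<Longrightarrow> y \<in> \<xi> \<Longrightarrow> (x, y) \<in> gromov_equiv p"
  using quotient_eq_iff[OF equiv_gromov_equiv] unfolding gromov_boundary_def by blast

definition boundary_class :: "(nat \<Rightarrow> 'a) \<Rightarrow> (nat \<Rightarrow> 'a) set" where
  "boundary_class x = gromov_equiv p `` {x}"

lemma boundary_class:
  assumes "gromov_sequence p x"
  shows "boundary_class x \<in> gromov_boundary p" "x \<in> boundary_class x"
  using assms equiv_class_self[OF equiv_gromov_equiv]
  by (auto simp: boundary_class_def gromov_boundary_def intro: quotientI)

text \<open>Hyperbolicity makes the choice of representatives matter only up to a constant: one
  small product of some \<open>x'\<close> and \<open>y'\<close> at late indices bounds all late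
  products along \<open>x\<close> and \<open>y\<close>, and each of the two changes of
  representative costs one \<open>c\<close>.\<close>

lemma gromov_product_bd_lessD:
  assumes \<xi>: "\<xi> \<in> gromov_boundary p" "x \<in> \<xi>" and \<eta>: "\<eta> \<in> gromov_boundary p" "y \<in> \<eta>"
    and less: "gromov_product_bd z \<xi> \<eta> < ereal t"
  obtains N where "\<And>n m. n \<ge> N \<Longrightarrow> m \<ge> N \<Longrightarrow> gp z (x n) (y m) < t + 2 * c"
proof -
  obtain x' y' where x': "x' \<in> \<xi>" and y': "y' \<in> \<eta>"
    and less': "Liminf (sequentially \<times>\<^sub>F sequentially) (\<lambda>(n, m). ereal (gp z (x' n) (y' m))) < ereal t"
    using less unfolding gromov_product_bd_def INF_less_iff by blast
  have freq: "\<exists>n\<ge>N. \<exists>m\<ge>N. gp z (x' n) (y' m) < t" for N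
  proof (rule ccontr)
    assume "\<not> ?thesis"
    then have "eventually (\<lambda>q. ereal t \<le> (\<lambda>(n, m). ereal (gp z (x' n) (y' m))) q) (sequentially \<times>\<^sub>F sequentially)"
      unfolding eventually_prod_sequentially by (force simp: not_less)
    then show False
      using Liminf_bounded less' by (metis not_less)
  qed
  obtain N1 where N1: "\<And>n m. n \<ge> N1 \<Longrightarrow> m \<ge> N1 \<Longrightarrow> t + 2 * c \<le> gp z (x' n) (x m)"
    using gromov_equiv_products[OF boundary_equiv[OF \<xi>(1) x' \<xi>(2)]] by metis
  obtain N2 where N2: "\<And>n m. n \<ge> N2 \<Longrightarrow> m \<ge> N2 \<Longrightarrow> t + 2 * c \<le> gp z (y n) (y' m)"
    using gromov_equiv_products[OF boundary_equiv[OF \<eta>(1) \<eta>(2) y']] by metis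
  obtain k l where kl: "k \<ge> max N1 N2" "l \<ge> max N1 N2" "gp z (x' k) (y' l) < t"
    using freq by blast
  show thesis
  proof (rule that)
    fix n m assume "n \<ge> max N1 N2" "m \<ge> max N1 N2"
    then show "gp z (x n) (y m) < t + 2 * c"
      using hyp2[of z "x' k" "x n" "y m" "y' l"] N1[of k n] N2[of m l] kl by auto
  qed
qed

lemma gromov_product_bd_pt_lessD:
  assumes \<xi>: "\<xi> \<in> gromov_boundary p" "x \<in> \<xi>"
    and less: "gromov_product_bd_pt z \<xi> y < ereal t"
  obtains N where "\<And>n. n \<ge> N \<Longrightarrow> gp z (x n) y < t + c"
proof -
  obtain x' where x': "x' \<in> \<xi>"
    and less': "liminf (\<lambda>n. ereal (gp z (x' n) y)) < ereal t"
    using less unfolding gromov_product_bd_pt_def INF_less_iff by blast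
  have freq: "\<exists>n\<ge>N. gp z (x' n) y < t" for N
  proof (rule ccontr)
    assume "\<not> ?thesis"
    then have "eventually (\<lambda>n. ereal t \<le> ereal (gp z (x' n) y)) sequentially"
      unfolding eventually_sequentially by (force simp: not_less)
    then show False
      using Liminf_bounded less' by (metis not_less)
  qed
  obtain N1 where N1: "\<And>n m. n \<ge> N1 \<Longrightarrow> m \<ge> N1 \<Longrightarrow> t + c \<le> gp z (x' n) (x m)"
    using gromov_equiv_products[OF boundary_equiv[OF \<xi>(1) x' \<xi>(2)]] by metis
  obtain k where k: "k \<ge> N1" "gp z (x' k) y < t"
    using freq by blast
  show thesis
  proof (rule that)
    fix n assume "n \<ge> N1"
    then show "gp z (x n) y < t + c"
      using hyp[of z "x' k" "x n" y] N1[of k n] k by auto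
  qed
qed

lemma gromov_product_bd_ge:
  assumes "\<xi> \<in> gromov_boundary p" "x \<in> \<xi>" "\<eta> \<in> gromov_boundary p" "y \<in> \<eta>"
    and ge: "\<And>n m. n \<ge> N \<Longrightarrow> m \<ge> N \<Longrightarrow> t \<le> gp z (x n) (y m)"
  shows "ereal (t - 2 * c) \<le> gromov_product_bd z \<xi> \<eta>"
proof (rule ccontr)
  assume "\<not> ?thesis"
  then have "gromov_product_bd z \<xi> \<eta> < ereal (t - 2 * c)" by simp
  then obtain M where "\<And>n m. n \<ge> M \<Longrightarrow> m \<ge> M \<Longrightarrow> gp z (x n) (y m) < t - 2 * c + 2 * c"
    using gromov_product_bd_lessD[OF assms(1-4)] by metis
  from this[of "max M N" "max M N"] ge[of "max M N" "max M N"] show False by simp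
qed

lemma gromov_product_bd_pt_ge:
  assumes "\<xi> \<in> gromov_boundary p" "x \<in> \<xi>"
    and ge: "\<And>n. n \<ge> N \<Longrightarrow> t \<le> gp z (x n) y"
  shows "ereal (t - c) \<le> gromov_product_bd_pt z \<xi> y"
proof (rule ccontr)
  assume "\<not> ?thesis"
  then have "gromov_product_bd_pt z \<xi> y < ereal (t - c)" by simp
  then obtain M where "\<And>n. n \<ge> M \<Longrightarrow> gp z (x n) y < t - c + c"
    using gromov_product_bd_pt_lessD[OF assms(1,2)] by metis
  from this[of "max M N"] ge[of "max M N"] show False by simp
qed

end

lemma gromov_product_bd_greaterD:
  assumes "x \<in> \<xi>" "y \<in> \<eta>" "ereal t < gromov_product_bd z \<xi> \<eta>"
  obtains N where "\<And>n m. n \<ge> N \<Longrightarrow> m \<ge> N \<Longrightarrow> t < gp z (x n) (y m)"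
proof -
  have "ereal t < Liminf (sequentially \<times>\<^sub>F sequentially) (\<lambda>(n, m). ereal (gp z (x n) (y m)))"
    using assms unfolding gromov_product_bd_def
    by (meson INF_lower order_less_le_trans)
  from less_LiminfD[OF this] show thesis
    using that unfolding eventually_prod_sequentially by (auto split: prod.splits)
qed

lemma gromov_product_bd_le:
  assumes "x \<in> \<xi>" "y \<in> \<eta>" "\<And>n m. n \<ge> N \<Longrightarrow> m \<ge> N \<Longrightarrow> gp z (x n) (y m) \<le> t"
  shows "gromov_product_bd z \<xi> \<eta> \<le> ereal t"
proof (rule ccontr)
  assume "\<not> ?thesis"
  then have "ereal t < gromov_product_bd z \<xi> \<eta>" by simp
  then obtain M where "\<And>n m. n \<ge> M \<Longrightarrow> m \<ge> M \<Longrightarrow> t < gp z (x n) (y m)"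
    using gromov_product_bd_greaterD[OF assms(1,2)] by metis
  from this[of "max M N" "max M N"] assms(3)[of "max M N" "max M N"] show False by simp
qed

lemma gromov_product_bd_pt_greaterD:
  assumes "x \<in> \<xi>" "ereal t < gromov_product_bd_pt z \<xi> y"
  obtains N where "\<And>n. n \<ge> N \<Longrightarrow> t < gp z (x n) y"
proof -
  have "ereal t < liminf (\<lambda>n. ereal (gp z (x n) y))"
    using assms unfolding gromov_product_bd_pt_def
    by (meson INF_lower order_less_le_trans)
  from less_LiminfD[OF this] show thesis
    using that unfolding eventually_sequentially by auto
qed

lemma gromov_product_bd_pt_le:
  assumes "x \<in> \<xi>" "\<And>n. n \<ge> N \<Longrightarrow> gp z (x n) y \<le> t"
  shows "gromov_product_bd_pt z \<xi> y \<le> ereal t"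
proof (rule ccontr)
  assume "\<not> ?thesis"
  then have "ereal t < gromov_product_bd_pt z \<xi> y" by simp
  then obtain M where "\<And>n. n \<ge> M \<Longrightarrow> t < gp z (x n) y"
    using gromov_product_bd_pt_greaterD[OF assms(1)] by metis
  from this[of "max M N"] assms(2)[of "max M N"] show False by simp
qed

section \<open>Group action and loxodromic isometries\<close>

lemma mdist_pos: "x \<in> mspace m \<Longrightarrow> y \<in> mspace m \<Longrightarrow> x \<noteq> y \<Longrightarrow> 0 < mdist m x y"
  by (metis less_le mdist_nonneg mdist_zero)

lemma powr_minus_le:
  assumes "1 < b" "ereal t \<le> u"
  shows "powr_minus b u \<le> b powr (- t)"
  using assms by (cases u) (auto simp: powr_minus_def)

lemma powr_minus_ge:
  assumes "1 < b" "u \<le> ereal t" "0 \<le> u"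
  shows "b powr (- t) \<le> powr_minus b u"
  using assms by (cases u) (auto simp: powr_minus_def)

lemma powr_minus_less_imp:
  assumes "1 < b" "0 \<le> u" "powr_minus b u < b powr (- t)"
  shows "ereal t < u"
proof (rule ccontr)
  assume "\<not> ?thesis"
  then have "b powr (- t) \<le> powr_minus b u"
    using assms by (intro powr_minus_ge) auto
  then show False using assms by simp
qed

context hyperbolic_space
begin

lemma gromov_product_bd_nonneg: "0 \<le> gromov_product_bd z \<xi> \<eta>"
  unfolding gromov_product_bd_def
  by (intro INF_greatest Liminf_bounded) (auto simp: gp_nonneg intro!: always_eventually)

lemma boundary_action_mem: "x \<in> \<xi> \<Longrightarrow> g \<circ> x \<in> boundary_action g \<xi>"
  by (simp add: boundary_action_def)

lemma boundary_action_boundary: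
  assumes g: "isometry g" and "\<xi> \<in> gromov_boundary p"
  shows "boundary_action g \<xi> \<in> gromov_boundary p"
proof -
  obtain x where x: "gromov_sequence p x" "\<xi> = gromov_equiv p `` {x}"
    using assms(2) unfolding gromov_boundary_def by (auto elim!: quotientE)
  have xx: "(x, x) \<in> gromov_equiv p"
    using boundary_class(2)[OF x(1)] by (simp add: boundary_class_def)
  have gx: "gromov_sequence p (g \<circ> x)"
    using gromov_equiv_isometry[OF g xx] by (simp add: gromov_equiv_iff)
  have "boundary_action g \<xi> = gromov_equiv p `` {g \<circ> x}"
  proof (rule antisym)
    show "boundary_action g \<xi> \<subseteq> gromov_equiv p `` {g \<circ> x}"
      using gromov_equiv_isometry[OF g] by (auto simp: boundary_action_def x(2))
    show "gromov_equiv p `` {g \<circ> x} \<subseteq> boundary_action g \<xi>"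
    proof
      fix y assume "y \<in> gromov_equiv p `` {g \<circ> x}"
      then have "(inv_map g \<circ> (g \<circ> x), inv_map g \<circ> y) \<in> gromov_equiv p"
        using gromov_equiv_isometry[OF isometry_inv[OF g]] by auto
      moreover have "inv_map g \<circ> (g \<circ> x) = x" "g \<circ> (inv_map g \<circ> y) = y"
        using g by (auto simp: isometry_inv_left isometry_inv_right)
      ultimately show "y \<in> boundary_action g \<xi>"
        unfolding boundary_action_def x(2) by (metis Image_singleton_iff image_eqI)
    qed
  qed
  then show ?thesis
    using gx by (simp add: gromov_boundary_def quotientI)
qed

lemma boundary_action_comp:
  "boundary_action (g \<circ> h) \<xi> = boundary_action g (boundary_action h \<xi>)"
  by (auto simp: boundary_action_def image_image comp_assoc)

lemma boundary_action_funpow_fixed: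
  "boundary_action g \<xi> = \<xi> \<Longrightarrow> boundary_action (g ^^ n) \<xi> = \<xi>"
  by (induction n) (simp_all add: boundary_action_comp, simp add: boundary_action_def)

text \<open>Convergence of \<open>y\<close> to \<xi> in terms of real products. The index
  \<open>N\<close> may depend on \<open>m\<close>: for fixed \<open>m\<close> only the tail of a
  representative matters.\<close>

definition tends_bd :: "(nat \<Rightarrow> 'a) \<Rightarrow> (nat \<Rightarrow> 'a) set \<Rightarrow> bool" where
  "tends_bd y \<xi> \<longleftrightarrow> (\<forall>x\<in>\<xi>. \<forall>t. \<exists>M. \<forall>m\<ge>M. \<exists>N. \<forall>n\<ge>N. t \<le> gp p (y m) (x n))"

text \<open>A large product of \<open>y m\<close> and \<open>z m\<close> would be inherited by late
  terms of representatives of \<xi> and \<eta>, but those products stay bounded.\<close>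

lemma tends_bd_bounded_product:
  assumes "\<xi> \<in> gromov_boundary p" "\<eta> \<in> gromov_boundary p"
    and ne: "gromov_product_bd p \<xi> \<eta> \<noteq> \<infinity>" and y: "tends_bd y \<xi>" and z: "tends_bd z \<eta>"
  obtains K M where "\<And>m. m \<ge> M \<Longrightarrow> gp p (y m) (z m) \<le> K"
proof -
  obtain x where x: "x \<in> \<xi>" using boundary_ne assms(1) by blast
  obtain e where e: "e \<in> \<eta>" using boundary_ne assms(2) by blast
  obtain T where T: "gromov_product_bd p \<xi> \<eta> < ereal T"
    using ne less_PInf_Ex_of_nat by blast
  obtain N where N: "\<And>n m. n \<ge> N \<Longrightarrow> m \<ge> N \<Longrightarrow> gp p (x n) (e m) < T + 2 * c"
    using gromov_product_bd_lessD[OF assms(1) x assms(2) e T] by metis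
  \<comment> \<open>\<open>2 * c\<close> comes from the choice of representatives, and
    \<open>2 * c\<close> from the chain \<open>x\<close>, \<open>y\<close>, \<open>z\<close>,
    \<open>e\<close>.\<close>
  define K where "K = T + 4 * c"
  obtain M1 where M1: "\<forall>m\<ge>M1. \<exists>N. \<forall>n\<ge>N. K \<le> gp p (y m) (x n)"
    using y x unfolding tends_bd_def by blast
  obtain M2 where M2: "\<forall>m\<ge>M2. \<exists>N. \<forall>n\<ge>N. K \<le> gp p (z m) (e n)"
    using z e unfolding tends_bd_def by blast
  show thesis
  proof (rule that)
    fix m assume m: "m \<ge> max M1 M2"
    obtain N1 where N1: "\<forall>n\<ge>N1. K \<le> gp p (y m) (x n)" using M1 m by auto
    obtain N2 where N2: "\<forall>n\<ge>N2. K \<le> gp p (z m) (e n)" using M2 m by auto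
    let ?n = "max N (max N1 N2)"
    have "gp p (x ?n) (e ?n) < T + 2 * c" "K \<le> gp p (x ?n) (y m)" "K \<le> gp p (z m) (e ?n)"
      using N[of ?n ?n] N1[rule_format, of ?n] N2[rule_format, of ?n] gp_commute[of p "x ?n" "y m"]
      by (simp_all add: le_max_iff_disj)
    then show "gp p (y m) (z m) \<le> K"
      using hyp2[of p "x ?n" "y m" "z m" "e ?n"] unfolding K_def by linarith
  qed
qed

text \<open>The product of \<open>\<alpha>\<close> and \<open>g\<^sup>m \<eta>\<close> seen from \<open>g\<^sup>m p\<close> is that of \<open>\<alpha>\<close> and \<open>\<eta>\<close> seen from \<open>p\<close>:
  so \<open>g\<^sup>m p\<close> stays close to a geodesic joining two points that both converge to \<open>\<alpha>\<close>.\<close>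

lemma orbit_tends_bd:
  assumes g: "isometry g" and \<alpha>: "\<alpha> \<in> gromov_boundary p" "boundary_action g \<alpha> = \<alpha>"
    and \<eta>: "\<eta> \<in> gromov_boundary p" and fin: "gromov_product_bd p \<alpha> \<eta> \<noteq> \<infinity>"
    and conv: "\<And>t. \<exists>M. \<forall>m\<ge>M. ereal t < gromov_product_bd p (boundary_action (g ^^ m) \<eta>) \<alpha>"
    and escape: "\<And>t. \<exists>M. \<forall>m\<ge>M. t \<le> dist p ((g ^^ m) p)"
  shows "tends_bd (\<lambda>m. (g ^^ m) p) \<alpha>"
  unfolding tends_bd_def
proof (intro ballI allI)
  fix a t assume a: "a \<in> \<alpha>"
  obtain e where e: "e \<in> \<eta>" using boundary_ne \<eta> by blast
  obtain K where K: "gromov_product_bd p \<alpha> \<eta> < ereal K"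
    using fin less_PInf_Ex_of_nat by blast
  obtain N0 where N0: "\<And>n m. n \<ge> N0 \<Longrightarrow> m \<ge> N0 \<Longrightarrow> gp p (a n) (e m) < K + 2 * c"
    using gromov_product_bd_lessD[OF \<alpha>(1) a \<eta> e K] by metis
  define K1 where "K1 = K + 2 * c"
  have "gp p (a N0) (e N0) < K1" using N0 by (simp add: K1_def)
  then have K1: "0 \<le> K1" using gp_nonneg[of p "a N0" "e N0"] by linarith
  \<comment> \<open>\<open>K1 + 2 * c\<close> is lost between \<open>f p\<close> and
    \<open>A\<close>, and one more \<open>c\<close> between \<open>A\<close> and
    \<open>a n\<close>.\<close>
  define T where "T = t + K1 + 3 * c"
  obtain M1 where M1: "\<forall>m\<ge>M1. ereal T < gromov_product_bd p (boundary_action (g ^^ m) \<eta>) \<alpha>"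
    using conv by blast
  obtain M2 where M2: "\<forall>m\<ge>M2. T \<le> dist p ((g ^^ m) p)"
    using escape by blast
  have "\<exists>N. \<forall>n\<ge>N. t \<le> gp p ((g ^^ m) p) (a n)" if m: "m \<ge> max M1 M2" for m
  proof -
    define f where "f = g ^^ m"
    have f: "isometry f" using g by (simp add: f_def isometry_funpow)
    have fa: "f \<circ> a \<in> \<alpha>"
      using boundary_action_mem[OF a, of f] boundary_action_funpow_fixed[OF \<alpha>(2)] by (simp add: f_def)
    have fe: "f \<circ> e \<in> boundary_action (g ^^ m) \<eta>"
      using boundary_action_mem[OF e, of f] by (simp add: f_def)
    obtain N1 where N1: "\<And>n m. n \<ge> N1 \<Longrightarrow> m \<ge> N1 \<Longrightarrow> T < gp p ((f \<circ> e) n) ((f \<circ> a) m)"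
      using gromov_product_bd_greaterD[OF fe fa] M1 m by (metis max.bounded_iff)
    obtain N2 where N2: "\<And>n m. n \<ge> N2 \<Longrightarrow> m \<ge> N2 \<Longrightarrow> T \<le> gp p ((f \<circ> a) n) (a m)"
      using gromov_equiv_products[OF boundary_equiv[OF \<alpha>(1) fa a]] by metis
    have "t \<le> gp p (f p) (a n)" if n: "n \<ge> max N0 (max N1 N2)" for n
    proof -
      define A E where "A = f (a n)" and "E = f (e n)"
      have 1: "gp (f p) A E < K1"
        using N0[of n n] n f by (simp add: A_def E_def gp_isometry K1_def)
      have 2: "T < gp p E A" "T \<le> gp p A (a n)"
        using N1[of n n] N2[of n n] n by (auto simp: A_def E_def)
      have 3: "T \<le> dist p (f p)" using M2 m by (simp add: f_def)
      have A: "T - K1 - 2 * c \<le> gp p (f p) A"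
      \<comment> \<open>Seen from \<open>f p\<close>, the point \<open>p\<close> cannot lie in the
        direction of both \<open>A\<close> and \<open>E\<close>, whose product there is below
        \<open>K1\<close>. When only \<open>E\<close> is known to be transverse to \<open>p\<close>,
        \<open>A\<close> is reached through \<open>E\<close>, which is close to \<open>A\<close> as
        seen from \<open>p\<close>.\<close>
      proof (cases "gp (f p) A p \<le> K1 + c")
        case True
        then show ?thesis
          using gp_flip[of p "f p" A] 3 c_nonneg by (simp add: gp_commute)
      next
        case False
        then have "gp (f p) p E \<le> K1 + c"
          using hyp[of "f p" A p E] 1 by auto
        then have "T - K1 - c \<le> gp p (f p) E"
          using gp_flip[of p "f p" E] 3 by (simp add: gp_commute)
        then show ?thesis
          using hyp[of p "f p" E A] 2 K1 c_nonneg by auto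
      qed
      then show ?thesis
        using hyp[of p "f p" A "a n"] 2 K1 c_nonneg by (auto simp: T_def)
    qed
    then show ?thesis unfolding f_def by blast
  qed
  then show "\<exists>M. \<forall>m\<ge>M. \<exists>N. \<forall>n\<ge>N. t \<le> gp p ((g ^^ m) p) (a n)"
    by blast
qed

end

section \<open>Strongly discrete groups\<close>

locale hyperbolic_group = hyperbolic_space p c for p :: "'a::metric_space" and c +
  fixes G :: "('a \<Rightarrow> 'a) set"
  assumes subgroup_G: "subgroup G isom_group"
    and discrete: "strongly_discrete p G"
begin

lemma G_isometry: "g \<in> G \<Longrightarrow> isometry g"
  using subgroup.subset[OF subgroup_G] by (auto simp: isom_group_def)

lemma G_comp: "g \<in> G \<Longrightarrow> h \<in> G \<Longrightarrow> g \<circ> h \<in> G"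
  using subgroup.m_closed[OF subgroup_G] by (simp add: isom_group_def)

lemma G_id: "id \<in> G"
  using subgroup.one_closed[OF subgroup_G] by (simp add: isom_group_def)

lemma G_inv:
  assumes "g \<in> G" shows "inv_map g \<in> G"
proof -
  have g: "isometry g" using G_isometry assms by blast
  then have "inv_map g \<otimes>\<^bsub>isom_group\<^esub> g = \<one>\<^bsub>isom_group\<^esub>"
    by (auto simp: isom_group_def isometry_inv_left)
  then have "m_inv isom_group g = inv_map g"
    using g isometry_inv[OF g] by (intro group.inv_equality[OF group_isom_group]) (auto simp: isom_group_def)
  then show ?thesis
    using subgroup.m_inv_closed[OF subgroup_G assms] by simp
qed

lemma G_funpow: "g \<in> G \<Longrightarrow> g ^^ n \<in> G"
  by (induction n) (auto simp: G_id G_comp simp del: o_apply)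

lemma finite_G_ball: "finite {g \<in> G. dist p (g p) \<le> r}"
proof (cases "0 < r")
  case True
  then show ?thesis using discrete by (simp add: strongly_discrete_def)
next
  case False
  have "finite {g \<in> G. dist p (g p) \<le> 1}"
    using discrete by (simp add: strongly_discrete_def)
  then show ?thesis
    by (rule rev_finite_subset) (use False in auto)
qed

lemma injective_sequence_escapes:
  assumes "inj f" "range f \<subseteq> G"
  shows "\<exists>M::nat. \<forall>m\<ge>M. t \<le> dist p (f m p)"
proof -
  have "finite (f -` {g \<in> G. dist p (g p) \<le> t})"
    by (rule finite_vimageI[OF finite_G_ball assms(1)])
  then obtain M where "\<forall>m\<in>f -` {g \<in> G. dist p (g p) \<le> t}. m < M"
    using finite_nat_set_iff_bounded by blast
  then have "\<not> dist p (f m p) \<le> t" if "M \<le> m" for m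
    using assms(2) that by fastforce
  then show ?thesis
    by (meson linear)
qed

end

section \<open>Visual metrics and the dynamics of loxodromic elements\<close>

locale hyperbolic_group_visual = hyperbolic_group p c G for p :: "'a::metric_space" and c G +
  fixes b :: real and D :: "(nat \<Rightarrow> 'a) set metric"
  assumes b: "1 < b" and visual: "visual_metric b p D"
begin

lemma mspace_D: "mspace D = gromov_boundary p"
  using visual by (simp add: visual_metric_def)

lemma visual_bounds:
  obtains V where "1 \<le> V"
    "\<And>\<xi> \<eta>. \<xi> \<in> gromov_boundary p \<Longrightarrow> \<eta> \<in> gromov_boundary p \<Longrightarrow>
      powr_minus b (gromov_product_bd p \<xi> \<eta>) / V \<le> mdist D \<xi> \<eta>"
    "\<And>\<xi> \<eta>. \<xi> \<in> gromov_boundary p \<Longrightarrow> \<eta> \<in> gromov_boundary p \<Longrightarrow>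
      mdist D \<xi> \<eta> \<le> V * powr_minus b (gromov_product_bd p \<xi> \<eta>)"
  using visual unfolding visual_metric_def by blast

lemma distinct_product_finite:
  assumes "\<xi> \<in> gromov_boundary p" "\<eta> \<in> gromov_boundary p" "\<xi> \<noteq> \<eta>"
  shows "gromov_product_bd p \<xi> \<eta> \<noteq> \<infinity>"
proof
  assume "gromov_product_bd p \<xi> \<eta> = \<infinity>"
  then have "mdist D \<xi> \<eta> \<le> 0"
    using visual_bounds assms(1,2) by (metis powr_minus_def mult_zero_right)
  then show False
    using assms mdist_pos[of \<xi> D \<eta>] by (simp add: mspace_D)
qed

lemma attracted:
  assumes "attracts_away_from D g \<rho> \<alpha>" "\<rho> \<in> gromov_boundary p" "\<eta> \<in> gromov_boundary p" "\<eta> \<noteq> \<rho>" "0 < \<epsilon>"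
  shows "\<exists>M. \<forall>m\<ge>M. mdist D (boundary_action (g ^^ m) \<eta>) \<alpha> < \<epsilon>"
proof -
  interpret Metric_space "mspace D" "mdist D" by (rule Metric_space_mspace_mdist)
  \<comment> \<open>The open ball of this radius leaves \<eta> outside.\<close>
  define U where "U = mball \<rho> (mdist D \<rho> \<eta>)"
  have "0 < mdist D \<rho> \<eta>" using assms mdist_pos[of \<rho> D \<eta>] by (simp add: mspace_D)
  moreover have "\<rho> \<in> mspace D" using assms(2) mspace_D by simp
  ultimately have "\<rho> \<in> U"
    by (simp add: U_def)
  have "\<eta> \<notin> U"
    by (simp add: U_def)
  have U: "\<rho> \<in> U" "openin (mtopology_of D) U" and \<eta>: "\<eta> \<in> mspace D - U"
    using assms(3) \<open>\<rho> \<in> U\<close> \<open>\<eta> \<notin> U\<close> by (simp_all add: mspace_D) (simp add: U_def mtopology_of_def)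
  have "\<exists>N. \<forall>n\<ge>N. \<forall>\<xi>\<in>mspace D - U. mdist D (boundary_action (g ^^ n) \<xi>) \<alpha> < \<epsilon>"
    using assms(1) U \<open>0 < \<epsilon>\<close> unfolding attracts_away_from_def by (metis order_refl)
  then show ?thesis
    using \<eta> by (meson bspec)
qed

text \<open>Two equal powers would give \<open>g\<close> finite order. Then arbitrarily high powers
  fix \<eta>, although attraction brings its images closer to \<alpha> than \<eta> itself
  is.\<close>

lemma funpow_inj_if_attracts:
  assumes g: "isometry g" and at: "attracts_away_from D g \<rho> \<alpha>"
    and bd: "\<rho> \<in> gromov_boundary p" "\<alpha> \<in> gromov_boundary p" "\<eta> \<in> gromov_boundary p"
    and "\<eta> \<noteq> \<rho>" "\<eta> \<noteq> \<alpha>"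
  shows "inj (\<lambda>m. g ^^ m)"
proof (rule linorder_injI, rule notI)
  fix i j :: nat assume ij: "i < j" "g ^^ i = g ^^ j"
  define d where "d = j - i"
  have "0 < d" "g ^^ j = g ^^ i \<circ> g ^^ d"
    using ij(1) by (auto simp: d_def simp flip: funpow_add)
  then have "(g ^^ i) x = (g ^^ i) ((g ^^ d) x)" for x
    using ij by (metis comp_apply)
  then have gd: "g ^^ d = id"
    using isometry_funpow[OF g, of i] by (metis eq_id_iff isometry_inv_left)
  obtain M where M: "\<forall>m\<ge>M. mdist D (boundary_action (g ^^ m) \<eta>) \<alpha> < mdist D \<eta> \<alpha>"
    using attracted[OF at bd(1,3) \<open>\<eta> \<noteq> \<rho>\<close>, of "mdist D \<eta> \<alpha>"] bd \<open>\<eta> \<noteq> \<alpha>\<close> mdist_pos[of \<eta> D \<alpha>]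
    by (auto simp: mspace_D)
  have "g ^^ (d * M) = id"
    by (metis funpow_mult gd id_funpow)
  moreover have "M \<le> d * M" using \<open>0 < d\<close> by simp
  ultimately have "mdist D (boundary_action id \<eta>) \<alpha> < mdist D \<eta> \<alpha>"
    using M by metis
  then show False by (simp add: boundary_action_def)
qed

text \<open>The auxiliary point \<eta> transfers the dynamics from the boundary to the space: its
  images converge to \<alpha>, and \<open>orbit_tends_bd\<close> concludes the same for the orbit of
  \<open>p\<close>. For two loxodromics without common fixed points, a fixed point of one serves as
  \<eta> for the other.\<close>

lemma attracts_tends_bd:
  assumes gG: "g \<in> G" and at: "attracts_away_from D g \<rho> \<alpha>"
    and \<rho>: "\<rho> \<in> gromov_boundary p" and \<alpha>: "\<alpha> \<in> boundary_fixed_points p g"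
    and \<eta>: "\<eta> \<in> gromov_boundary p" "\<eta> \<noteq> \<rho>" "\<eta> \<noteq> \<alpha>"
  shows "tends_bd (\<lambda>m. (g ^^ m) p) \<alpha>"
proof (rule orbit_tends_bd)
  show g: "isometry g" using gG by (rule G_isometry)
  show \<alpha>': "\<alpha> \<in> gromov_boundary p" "boundary_action g \<alpha> = \<alpha>"
    using \<alpha> by (auto simp: boundary_fixed_points_def)
  show "\<eta> \<in> gromov_boundary p" by fact
  show "gromov_product_bd p \<alpha> \<eta> \<noteq> \<infinity>"
    using distinct_product_finite \<alpha>'(1) \<eta> by metis
  show "\<exists>M. \<forall>m\<ge>M. t \<le> dist p ((g ^^ m) p)" for t
    using funpow_inj_if_attracts[OF g at \<rho> \<alpha>'(1) \<eta>] G_funpow[OF gG]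
    by (intro injective_sequence_escapes) auto
  show "\<exists>M. \<forall>m\<ge>M. ereal t < gromov_product_bd p (boundary_action (g ^^ m) \<eta>) \<alpha>" for t
  proof -
    obtain V where V: "1 \<le> V" "\<And>\<xi> \<eta>. \<xi> \<in> gromov_boundary p \<Longrightarrow> \<eta> \<in> gromov_boundary p \<Longrightarrow>
      powr_minus b (gromov_product_bd p \<xi> \<eta>) / V \<le> mdist D \<xi> \<eta>"
      using visual_bounds by metis
    have "0 < b powr (- t) / V" using b V(1) by simp
    then obtain M where M: "\<forall>m\<ge>M. mdist D (boundary_action (g ^^ m) \<eta>) \<alpha> < b powr (- t) / V"
      using attracted[OF at \<rho> \<eta>(1,2)] by blast
    have "ereal t < gromov_product_bd p (boundary_action (g ^^ m) \<eta>) \<alpha>" if "m \<ge> M" for m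
    proof (rule powr_minus_less_imp[OF b gromov_product_bd_nonneg])
      have "boundary_action (g ^^ m) \<eta> \<in> gromov_boundary p"
        using boundary_action_boundary[OF isometry_funpow[OF g]] \<eta>(1) by blast
      then have "powr_minus b (gromov_product_bd p (boundary_action (g ^^ m) \<eta>) \<alpha>) / V < b powr (- t) / V"
        using V(2) \<alpha>'(1) M that by (meson order_le_less_trans)
      then show "powr_minus b (gromov_product_bd p (boundary_action (g ^^ m) \<eta>) \<alpha>) < b powr (- t)"
        using V(1) by (simp add: divide_less_cancel)
    qed
    then show ?thesis by blast
  qed
qed

lemma loxodromic_tends_bd:
  assumes gG: "g \<in> G" and lox: "loxodromic p D g"
    and \<eta>: "\<eta> \<in> gromov_boundary p" "\<eta> \<notin> boundary_fixed_points p g"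
  obtains \<alpha> \<rho> where "\<alpha> \<in> boundary_fixed_points p g" "\<rho> \<in> boundary_fixed_points p g" "\<alpha> \<noteq> \<rho>"
    "tends_bd (\<lambda>m. (g ^^ m) p) \<alpha>" "tends_bd (\<lambda>m. inv_map (g ^^ m) p) \<rho>"
    "\<And>t. \<exists>M. \<forall>m\<ge>M. t \<le> dist p ((g ^^ m) p)"
proof -
  obtain \<alpha> \<rho> where ar: "\<alpha> \<in> boundary_fixed_points p g" "\<rho> \<in> boundary_fixed_points p g" "\<alpha> \<noteq> \<rho>"
    and at: "attracts_away_from D g \<rho> \<alpha>" "attracts_away_from D (inv_map g) \<alpha> \<rho>"
    using lox unfolding loxodromic_def by blast
  have bd: "\<alpha> \<in> gromov_boundary p" "\<rho> \<in> gromov_boundary p" "\<eta> \<noteq> \<alpha>" "\<eta> \<noteq> \<rho>"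
    using ar \<eta> by (auto simp: boundary_fixed_points_def)
  have g: "isometry g" using gG by (rule G_isometry)
  have inv_pow: "inv_map g ^^ m = inv_map (g ^^ m)" for m
    using g by (simp add: isometry_def inv_fn)
  have "boundary_action (inv_map g) \<rho> = boundary_action (inv_map g \<circ> g) \<rho>"
    using ar(2) by (simp add: boundary_action_comp boundary_fixed_points_def)
  also have "\<dots> = \<rho>"
    using g by (auto simp: boundary_action_def comp_def isometry_inv_left)
  finally have \<rho>: "\<rho> \<in> boundary_fixed_points p (inv_map g)"
    using bd by (simp add: boundary_fixed_points_def)
  show thesis
  proof (rule that[OF ar])
    show "tends_bd (\<lambda>m. (g ^^ m) p) \<alpha>"
      using attracts_tends_bd[OF gG at(1) bd(2) ar(1) \<eta>(1)] bd by blast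
    show "tends_bd (\<lambda>m. inv_map (g ^^ m) p) \<rho>"
      using attracts_tends_bd[OF G_inv[OF gG] at(2) bd(1) \<rho> \<eta>(1)] bd by (simp add: inv_pow)
    show "\<exists>M. \<forall>m\<ge>M. t \<le> dist p ((g ^^ m) p)" for t
      using funpow_inj_if_attracts[OF g at(1) bd(2,1) \<eta>(1)] G_funpow[OF gG] bd
      by (intro injective_sequence_escapes) auto
  qed
qed

text \<open>The order of the quantifiers is the point: \<sigma> is fixed before \<open>t\<close>.
  Forward and backward orbits of the two loxodromics tend to four distinct boundary points, so all
  six products are eventually bounded while the displacements tend to infinity.\<close>

lemma general_type_schottky:
  assumes gt: "general_type p D G"
  obtains \<sigma> where "0 \<le> \<sigma>"
    "\<And>t. \<exists>g\<in>G. \<exists>h\<in>G. t \<le> dist p (g p) \<and> t \<le> dist p (h p) \<and>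
       gp p (g p) (h p) \<le> \<sigma> \<and> gp p (inv_map g p) (inv_map h p) \<le> \<sigma> \<and>
       (\<forall>x\<in>{g, h}. \<forall>y\<in>{g, h}. gp p (x p) (inv_map y p) \<le> \<sigma>)"
proof -
  obtain g h where gh: "g \<in> G" "h \<in> G" and lox: "loxodromic p D g" "loxodromic p D h"
    and disj: "boundary_fixed_points p g \<inter> boundary_fixed_points p h = {}"
    using gt unfolding general_type_def by blast
  obtain \<eta> where \<eta>: "\<eta> \<in> boundary_fixed_points p h"
    using lox(2) unfolding loxodromic_def by blast
  obtain \<eta>' where \<eta>': "\<eta>' \<in> boundary_fixed_points p g"
    using lox(1) unfolding loxodromic_def by blast
  have n: "\<eta> \<in> gromov_boundary p" "\<eta> \<notin> boundary_fixed_points p g"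
      "\<eta>' \<in> gromov_boundary p" "\<eta>' \<notin> boundary_fixed_points p h"
    using \<eta> \<eta>' disj by (auto simp: boundary_fixed_points_def)
  obtain \<alpha> \<rho> where 1: "\<alpha> \<in> boundary_fixed_points p g" "\<rho> \<in> boundary_fixed_points p g" "\<alpha> \<noteq> \<rho>"
    "tends_bd (\<lambda>m. (g ^^ m) p) \<alpha>" "tends_bd (\<lambda>m. inv_map (g ^^ m) p) \<rho>"
    "\<And>t. \<exists>M. \<forall>m\<ge>M. t \<le> dist p ((g ^^ m) p)"
    using loxodromic_tends_bd[OF gh(1) lox(1) n(1,2)] by metis
  obtain \<alpha>' \<rho>' where 2: "\<alpha>' \<in> boundary_fixed_points p h" "\<rho>' \<in> boundary_fixed_points p h" "\<alpha>' \<noteq> \<rho>'"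
    "tends_bd (\<lambda>m. (h ^^ m) p) \<alpha>'" "tends_bd (\<lambda>m. inv_map (h ^^ m) p) \<rho>'"
    "\<And>t. \<exists>M. \<forall>m\<ge>M. t \<le> dist p ((h ^^ m) p)"
    using loxodromic_tends_bd[OF gh(2) lox(2) n(3,4)] by metis
  have bd: "\<alpha> \<in> gromov_boundary p" "\<rho> \<in> gromov_boundary p" "\<alpha>' \<in> gromov_boundary p" "\<rho>' \<in> gromov_boundary p"
    using 1 2 by (auto simp: boundary_fixed_points_def)
  have ne: "\<alpha> \<noteq> \<alpha>'" "\<alpha> \<noteq> \<rho>'" "\<rho> \<noteq> \<alpha>'" "\<rho> \<noteq> \<rho>'"
    using 1 2 disj by auto
  have bounded: "\<exists>K M. \<forall>m\<ge>M. gp p (y m) (z m) \<le> K"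
    if "\<xi> \<in> gromov_boundary p" "\<zeta> \<in> gromov_boundary p" "\<xi> \<noteq> \<zeta>" "tends_bd y \<xi>" "tends_bd z \<zeta>" for \<xi> \<zeta> y z
    using tends_bd_bounded_product[OF that(1,2) distinct_product_finite[OF that(1-3)] that(4,5)] by metis
  obtain K1 M1 where K1: "\<forall>m\<ge>M1. gp p ((g ^^ m) p) ((h ^^ m) p) \<le> K1"
    using bounded[OF bd(1,3) ne(1) 1(4) 2(4)] by blast
  obtain K2 M2 where K2: "\<forall>m\<ge>M2. gp p (inv_map (g ^^ m) p) (inv_map (h ^^ m) p) \<le> K2"
    using bounded[OF bd(2,4) ne(4) 1(5) 2(5)] by blast
  obtain K3 M3 where K3: "\<forall>m\<ge>M3. gp p ((g ^^ m) p) (inv_map (g ^^ m) p) \<le> K3"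
    using bounded[OF bd(1,2) 1(3) 1(4) 1(5)] by blast
  obtain K4 M4 where K4: "\<forall>m\<ge>M4. gp p ((h ^^ m) p) (inv_map (h ^^ m) p) \<le> K4"
    using bounded[OF bd(3,4) 2(3) 2(4) 2(5)] by blast
  obtain K5 M5 where K5: "\<forall>m\<ge>M5. gp p ((g ^^ m) p) (inv_map (h ^^ m) p) \<le> K5"
    using bounded[OF bd(1,4) ne(2) 1(4) 2(5)] by blast
  obtain K6 M6 where K6: "\<forall>m\<ge>M6. gp p ((h ^^ m) p) (inv_map (g ^^ m) p) \<le> K6"
    using bounded[OF bd(3,2) ne(3)[symmetric] 2(4) 1(5)] by blast
  define \<sigma> where "\<sigma> = Max {0, K1, K2, K3, K4, K5, K6}"
  have \<sigma>: "0 \<le> \<sigma>" "K1 \<le> \<sigma>" "K2 \<le> \<sigma>" "K3 \<le> \<sigma>" "K4 \<le> \<sigma>" "K5 \<le> \<sigma>" "K6 \<le> \<sigma>"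
    using Max_ge[of "{0, K1, K2, K3, K4, K5, K6}"] by (simp_all add: \<sigma>_def del: Max_insert)
  show thesis
  proof (rule that[OF \<sigma>(1)])
    fix t
    obtain M7 where M7: "\<forall>m\<ge>M7. t \<le> dist p ((g ^^ m) p)" using 1(6) by blast
    obtain M8 where M8: "\<forall>m\<ge>M8. t \<le> dist p ((h ^^ m) p)" using 2(6) by blast
    define m where "m = Max {M1, M2, M3, M4, M5, M6, M7, M8}"
    have m: "M1 \<le> m" "M2 \<le> m" "M3 \<le> m" "M4 \<le> m" "M5 \<le> m" "M6 \<le> m" "M7 \<le> m" "M8 \<le> m"
      using Max_ge[of "{M1, M2, M3, M4, M5, M6, M7, M8}"] by (simp_all add: m_def del: Max_insert)
    show "\<exists>g\<in>G. \<exists>h\<in>G. t \<le> dist p (g p) \<and> t \<le> dist p (h p) \<and>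
       gp p (g p) (h p) \<le> \<sigma> \<and> gp p (inv_map g p) (inv_map h p) \<le> \<sigma> \<and>
       (\<forall>x\<in>{g, h}. \<forall>y\<in>{g, h}. gp p (x p) (inv_map y p) \<le> \<sigma>)"
    proof -
      have t: "t \<le> dist p ((g ^^ m) p)" "t \<le> dist p ((h ^^ m) p)"
        using M7 M8 m by auto
      have K: "gp p ((g ^^ m) p) ((h ^^ m) p) \<le> K1" "gp p (inv_map (g ^^ m) p) (inv_map (h ^^ m) p) \<le> K2"
        "gp p ((g ^^ m) p) (inv_map (g ^^ m) p) \<le> K3" "gp p ((h ^^ m) p) (inv_map (h ^^ m) p) \<le> K4"
        "gp p ((g ^^ m) p) (inv_map (h ^^ m) p) \<le> K5" "gp p ((h ^^ m) p) (inv_map (g ^^ m) p) \<le> K6"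
        using K1 K2 K3 K4 K5 K6 m by blast+
      then have "gp p ((g ^^ m) p) ((h ^^ m) p) \<le> \<sigma>" "gp p (inv_map (g ^^ m) p) (inv_map (h ^^ m) p) \<le> \<sigma>"
        "gp p ((g ^^ m) p) (inv_map (g ^^ m) p) \<le> \<sigma>" "gp p ((h ^^ m) p) (inv_map (h ^^ m) p) \<le> \<sigma>"
        "gp p ((g ^^ m) p) (inv_map (h ^^ m) p) \<le> \<sigma>" "gp p ((h ^^ m) p) (inv_map (g ^^ m) p) \<le> \<sigma>"
        using \<sigma> by linarith+
      then show ?thesis
        using t G_funpow[OF gh(1), of m] G_funpow[OF gh(2), of m]
        by (intro bexI[of _ "g ^^ m"] bexI[of _ "h ^^ m"]) simp_all
    qed
  qed
qed

end

section \<open>Transverse separated letters in large annuli\<close>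

text \<open>Take a maximal subset without distinct related elements. By maximality the
  neighbourhoods of its members, each of size at most \<open>M\<close>, cover
  \<open>A\<close>.\<close>

lemma separated_subset:
  assumes fin: "finite A" and sym: "\<And>x y. R x y \<Longrightarrow> R y x" and refl: "\<And>x. R x x"
    and card: "\<And>x. x \<in> A \<Longrightarrow> card {y \<in> A. R x y} \<le> M"
  obtains B where "B \<subseteq> A" "\<And>x y. x \<in> B \<Longrightarrow> y \<in> B \<Longrightarrow> x \<noteq> y \<Longrightarrow> \<not> R x y"
    "card A \<le> card B * M"
proof -
  define F where "F = {B. B \<subseteq> A \<and> (\<forall>x\<in>B. \<forall>y\<in>B. x \<noteq> y \<longrightarrow> \<not> R x y)}"
  have "finite F" using fin by (simp add: F_def)
  moreover have "F \<noteq> {}" by (auto simp: F_def)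
  ultimately obtain B where BF: "B \<in> F" and max: "\<And>B'. B' \<in> F \<Longrightarrow> B \<subseteq> B' \<Longrightarrow> B = B'"
    using finite_has_maximal[of F] by blast
  have B: "B \<subseteq> A" "\<And>x y. x \<in> B \<Longrightarrow> y \<in> B \<Longrightarrow> x \<noteq> y \<Longrightarrow> \<not> R x y"
    using BF by (auto simp: F_def)
  have cover: "A \<subseteq> (\<Union>x\<in>B. {y \<in> A. R x y})"
  proof
    fix y assume y: "y \<in> A"
    have "\<exists>x\<in>B. R x y"
    proof (rule ccontr)
      assume no: "\<not> ?thesis"
      then have "insert y B \<in> F"
        using B y sym unfolding F_def by blast
      then have "y \<in> B"
        using max by blast
      then show False using no refl by blast
    qed
    then show "y \<in> (\<Union>x\<in>B. {y \<in> A. R x y})" using y by blast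
  qed
  have fB: "finite B" using B fin by (auto intro: finite_subset)
  have "card A \<le> card (\<Union>x\<in>B. {y \<in> A. R x y})"
    using cover fB fin by (intro card_mono) auto
  also have "\<dots> \<le> (\<Sum>x\<in>B. card {y \<in> A. R x y})"
    using fB by (rule card_UN_le)
  also have "\<dots> \<le> card B * M"
    using card B by (intro sum_bounded_above[where K = M, simplified]) auto
  finally show thesis
    using that B by blast
qed

section \<open>Displacement along broken paths\<close>

context hyperbolic_space
begin

text \<open>As \<open>w\<close> points in the direction of \<open>q\<close>, its product with
  \<open>inv_map a p\<close> is also small, up to one \<open>c\<close>. Translating the corner by
  \<open>a\<close> and applying \<open>gp_flip\<close> gives the bound.\<close>

lemma broken_path_step:
  assumes a: "isometry a" and "gp p (inv_map a p) q \<le> k" "k + c < gp p q w"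
  shows "dist p (a p) - k - c \<le> gp p (a p) (a w)"
proof -
  have "gp p (inv_map a p) w \<le> k + c"
    using hyp[of p "inv_map a p" w q] assms gp_commute[of p w q] by linarith
  moreover have "gp p (a p) (a w) + gp (a p) p (a w) = dist p (a p)"
    by (rule gp_flip)
  ultimately show ?thesis
    using gp_inv_isometry[OF a, of p w] by simp
qed

text \<open>\<open>f\<close> is long compared with both corners, so \<open>f z\<close>, seen from
  \<open>p\<close>, still points in the direction of \<open>f p\<close>.\<close>

lemma broken_path_start:
  assumes a: "isometry a" and f: "isometry f"
    and "gp p (inv_map a p) (f p) \<le> k" "gp p (inv_map f p) z \<le> k" "2 * k + c < dist p (f p)"
  shows "dist p (a p) - k - c \<le> gp p (a p) (a (f z))"
proof (rule broken_path_step[OF a assms(3)])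
  have "gp p (f p) (f z) + gp (f p) p (f z) = dist p (f p)"
    by (rule gp_flip)
  then show "k + c < gp p (f p) (f z)"
    using assms gp_inv_isometry[OF f, of p z] by simp
qed

end

section \<open>Counting in annuli and the choice of letters\<close>

context hyperbolic_group_visual
begin

definition annulus :: "nat \<Rightarrow> ('a \<Rightarrow> 'a) set" where
  "annulus n = {g \<in> G. real n - 1 < dist p (g p) \<and> dist p (g p) \<le> real n}"

lemma finite_annulus: "finite (annulus n)"
  by (rule finite_subset[OF _ finite_G_ball[of "real n"]]) (auto simp: annulus_def)

text \<open>If all late annuli were small, the Poincare series would converge at some
  \<open>t\<close> strictly between \<open>s\<close> and \<delta>, dominated by a geometric series
  of ratio \<open>b powr (s - t)\<close>. The gap between \<open>s\<close> and \<open>t\<close> is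
  what leaves room for an arbitrary factor \<open>K\<close>.\<close>

lemma large_annuli:
  assumes "0 \<le> s" "ereal s < poincare_exponent b p G"
  obtains n where "n \<ge> n0" "K * b powr (s * real n) \<le> real (card (annulus n))"
proof (rule ccontr)
  assume no: "\<not> thesis"
  then have small: "real (card (annulus n)) < K * b powr (s * real n)" if "n \<ge> n0" for n
    using that \<open>\<And>n. n0 \<le> n \<Longrightarrow> K * b powr (s * real n) \<le> real (card (annulus n)) \<Longrightarrow> thesis\<close>
    by (meson not_le)
  obtain t where t: "s < t" "ereal t < poincare_exponent b p G"
    using ereal_dense2[OF assms(2)] by auto
  \<comment> \<open>Displacement on \<open>annulus n\<close> exceeds \<open>n - 1\<close>, so
    \<open>u n\<close> dominates the contribution of that annulus to the series.\<close>
  define u where "u n = real (card (annulus n)) * b powr (- t * (real n - 1))" for n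
  have u_nonneg: "0 \<le> u n" for n by (simp add: u_def)
  have "summable u"
  proof (rule summable_comparison_test)
    have "u n \<le> K * b powr t * (b powr (s - t)) ^ n" if "n \<ge> n0" for n
    proof -
      have "u n \<le> K * b powr (s * real n) * b powr (- t * (real n - 1))"
        unfolding u_def using small[OF that] by (intro mult_right_mono) auto
      also have "\<dots> = K * (b powr t * b powr ((s - t) * real n))"
        by (simp add: algebra_simps flip: powr_add)
      also have "b powr ((s - t) * real n) = (b powr (s - t)) ^ n"
        using b by (simp add: powr_powr[symmetric] powr_realpow)
      finally show ?thesis by (simp add: mult.assoc)
    qed
    then show "\<exists>N. \<forall>n\<ge>N. norm (u n) \<le> K * b powr t * (b powr (s - t)) ^ n"
      using u_nonneg by auto
    have "b powr (s - t) < 1"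
      using b t powr_less_mono[of "s - t" 0 b] by simp
    then show "summable (\<lambda>n. K * b powr t * (b powr (s - t)) ^ n)"
      by (intro summable_mult summable_geometric) simp
  qed
  define f where "f g = b powr (- t * dist p (g p))" for g :: "'a \<Rightarrow> 'a"
  have "f summable_on G"
  proof (rule nonneg_bdd_above_summable_on)
    show "0 \<le> f g" for g by (simp add: f_def)
    show "bdd_above (sum f ` {F. F \<subseteq> G \<and> finite F})"
    proof (rule bdd_aboveI2)
      fix F assume F: "F \<in> {F. F \<subseteq> G \<and> finite F}"
      \<comment> \<open>Rounding up sends elements fixing \<open>p\<close> to
        \<open>annulus 0\<close>, whose lower bound is -1.\<close>
      define idx where "idx g = nat \<lceil>dist p (g p)\<rceil>" for g :: "'a \<Rightarrow> 'a"
      have idx: "real (idx g) - 1 < dist p (g p)" "dist p (g p) \<le> real (idx g)" for g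
        unfolding idx_def using zero_le_dist[of p "g p"] by linarith+
      have inner: "sum f {g \<in> F. idx g = n} \<le> u n" for n
      proof -
        have sub: "{g \<in> F. idx g = n} \<subseteq> annulus n"
          using F idx by (auto simp: annulus_def)
        have "f g \<le> b powr (- t * (real n - 1))" if "g \<in> {g \<in> F. idx g = n}" for g
        proof -
          have "real n - 1 \<le> dist p (g p)" using that idx(1)[of g] by auto
          then show ?thesis
            unfolding f_def using b t(1) assms(1) by (intro powr_mono) (auto intro!: mult_left_mono)
        qed
        then have "sum f {g \<in> F. idx g = n} \<le> real (card {g \<in> F. idx g = n}) * b powr (- t * (real n - 1))"
          by (rule sum_bounded_above)
        also have "\<dots> \<le> u n"
          unfolding u_def using card_mono[OF finite_annulus sub] by (intro mult_right_mono) auto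
        finally show ?thesis .
      qed
      have "sum f F = (\<Sum>n\<in>idx ` F. sum f {g \<in> F. idx g = n})"
        using F by (intro sum.image_gen) auto
      also have "\<dots> \<le> (\<Sum>n\<in>idx ` F. u n)"
        by (intro sum_mono inner)
      also have "\<dots> \<le> suminf u"
        using F u_nonneg \<open>summable u\<close> by (intro sum_le_suminf) auto
      finally show "sum f F \<le> suminf u" .
    qed
  qed
  then have "poincare_exponent b p G \<le> ereal t"
    unfolding poincare_exponent_def f_def using t assms(1) by (intro Inf_lower) auto
  then show False using t(2) by simp
qed

text \<open>Left translation by the inverse of \<open>x\<close> moves the centre to
  \<open>p\<close>, which makes the bound the same for all centres.\<close>

lemma card_G_translates:
  assumes "x \<in> G" "A \<subseteq> G"
  shows "card {y \<in> A. dist (x p) (y p) \<le> r} \<le> card {f \<in> G. dist p (f p) \<le> r}"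
proof (rule card_inj_on_le[OF _ _ finite_G_ball])
  have x: "isometry x" using G_isometry assms(1) .
  show "inj_on (\<lambda>y. inv_map x \<circ> y) {y \<in> A. dist (x p) (y p) \<le> r}"
  proof (rule inj_onI)
    fix y z assume "inv_map x \<circ> y = inv_map x \<circ> z"
    then show "y = z"
      by (metis ext comp_apply isometry_inv_right x)
  qed
  have "dist p (inv_map x (y p)) = dist (x p) (y p)" for y
    using isometry_dist[OF x, of p "inv_map x (y p)"] by (simp add: isometry_inv_right x)
  then show "(\<lambda>y. inv_map x \<circ> y) ` {y \<in> A. dist (x p) (y p) \<le> r} \<subseteq> {f \<in> G. dist p (f p) \<le> r}"
    using assms G_comp G_inv by auto
qed

text \<open>The letters are products \<open>x f y\<close> with \<open>f\<close> in an annulus and \<open>x, y\<close> among powers \<open>g, h\<close> of two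
  independent loxodromics.  Any direction is transverse to that of \<open>g\<close> or of \<open>h\<close>, so by pigeonhole
  one pair \<open>(x, y)\<close> serves a quarter of the annulus.\<close>

lemma free_letters:
  assumes gt: "general_type p D G" and s: "0 \<le> s" "ereal s < poincare_exponent b p G"
  obtains \<sigma> n S where "0 \<le> \<sigma>" "finite S" "S \<subseteq> G"
    "\<And>x. x \<in> S \<Longrightarrow> dist p (x p) \<le> n"
    "\<And>x. x \<in> S \<Longrightarrow> 2 * \<sigma> + 4 * c + 1 \<le> dist p (x p)"
    "\<And>x y. x \<in> S \<Longrightarrow> y \<in> S \<Longrightarrow> gp p (inv_map x p) (y p) \<le> \<sigma>"
    "\<And>x y. x \<in> S \<Longrightarrow> y \<in> S \<Longrightarrow> x \<noteq> y \<Longrightarrow>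
       gp p (x p) (y p) < min (dist p (x p)) (dist p (y p)) - \<sigma> - 3 * c"
    "b powr (s * n) \<le> real (card S)"
proof -
  obtain \<sigma>0 where \<sigma>0: "0 \<le> \<sigma>0" and sch: "\<And>t. \<exists>g\<in>G. \<exists>h\<in>G. t \<le> dist p (g p) \<and> t \<le> dist p (h p) \<and>
       gp p (g p) (h p) \<le> \<sigma>0 \<and> gp p (inv_map g p) (inv_map h p) \<le> \<sigma>0 \<and>
       (\<forall>x\<in>{g, h}. \<forall>y\<in>{g, h}. gp p (x p) (inv_map y p) \<le> \<sigma>0)"
    using general_type_schottky[OF gt] by metis
  \<comment> \<open>\<open>\<sigma>1\<close> pays one \<open>c\<close> for the alternative between
    \<open>g\<close> and \<open>h\<close>; \<sigma> pays \<open>2 * c\<close> for the chain from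
    \<open>inv_map y p\<close> to \<open>x p\<close> through the ends of two letters.\<close>
  define \<sigma>1 where "\<sigma>1 = \<sigma>0 + c"
  define \<sigma> where "\<sigma> = \<sigma>0 + 2 * c"
  have \<sigma>: "0 \<le> \<sigma>" using \<sigma>0 c_nonneg by (simp add: \<sigma>_def)
  obtain g h where gh: "g \<in> G" "h \<in> G"
    and long: "2 * \<sigma>0 + 5 * c + 1 \<le> dist p (g p)" "2 * \<sigma>0 + 5 * c + 1 \<le> dist p (h p)"
    and gp_gh: "gp p (g p) (h p) \<le> \<sigma>0" "gp p (inv_map g p) (inv_map h p) \<le> \<sigma>0"
      "\<And>x y. x \<in> {g, h} \<Longrightarrow> y \<in> {g, h} \<Longrightarrow> gp p (x p) (inv_map y p) \<le> \<sigma>0"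
    using sch[of "2 * \<sigma>0 + 5 * c + 1"] by blast
  define m0 where "m0 = max (dist p (g p)) (dist p (h p))"
  \<comment> \<open>Letters will differ in length by less than \<open>1 + 4 * m0\<close>; the rest
    is twice the margin \<open>\<sigma> + 3 * c\<close> of the separation, plus 1.\<close>
  define R where "R = 2 + 4 * m0 + 2 * \<sigma> + 6 * c"
  define M where "M = card {f \<in> G. dist p (f p) \<le> R}"
  have m0: "0 \<le> m0" by (simp add: m0_def le_max_iff_disj)
  have "0 \<le> R" using m0 \<sigma> c_nonneg by (simp add: R_def)
  then have "id \<in> {f \<in> G. dist p (f p) \<le> R}"
    using G_id by simp
  then have M: "0 < M"
    unfolding M_def using finite_G_ball card_gt_0_iff by blast
  \<comment> \<open>\<open>R\<close> and \<open>M\<close> do not depend on \<open>n\<close>, so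
    \<open>n\<close> can be chosen last. The factor 4 pays for the pigeonhole over the pairs,
    \<open>M\<close> for the separation, and \<open>b powr (s * (2 * m0))\<close> for letters longer
    than \<open>n\<close> by up to \<open>2 * m0\<close>.\<close>
  obtain n where n: "n \<ge> nat \<lceil>2 * \<sigma> + 4 * c + 2 + 2 * m0\<rceil> + nat \<lceil>2 * \<sigma>1 + 2 * c + 2\<rceil>"
    and cardA: "4 * real M * b powr (s * (2 * m0)) * b powr (s * real n) \<le> real (card (annulus n))"
    using large_annuli[OF s] by metis
  have n1: "2 * \<sigma> + 4 * c + 2 + 2 * m0 \<le> real n" "2 * \<sigma>1 + 2 * c + 2 \<le> real n"
    using n by linarith+
  define B where "B x y = {f \<in> annulus n. gp p (inv_map x p) (f p) \<le> \<sigma>1 \<and> gp p (inv_map f p) (y p) \<le> \<sigma>1}" for x y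
  have "annulus n \<subseteq> B g g \<union> B g h \<union> B h g \<union> B h h"
  proof
    fix f assume f: "f \<in> annulus n"
    have "gp p (inv_map g p) (f p) \<le> \<sigma>1 \<or> gp p (inv_map h p) (f p) \<le> \<sigma>1"
      using hyp[of p "inv_map g p" "f p" "inv_map h p"] gp_gh(2)
      unfolding \<sigma>1_def gp_commute[of p "inv_map h p" "f p"] by linarith
    moreover have "gp p (inv_map f p) (g p) \<le> \<sigma>1 \<or> gp p (inv_map f p) (h p) \<le> \<sigma>1"
      using hyp[of p "g p" "inv_map f p" "h p"] gp_gh(1)
      unfolding \<sigma>1_def gp_commute[of p "inv_map f p" "g p"] by linarith
    ultimately show "f \<in> B g g \<union> B g h \<union> B h g \<union> B h h"
      using f unfolding B_def by blast
  qed
  moreover have finB: "finite (B x y)" for x y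
    using finite_annulus by (simp add: B_def)
  ultimately have "card (annulus n) \<le> card (B g g \<union> B g h \<union> B h g \<union> B h h)"
    by (intro card_mono) auto
  also have "\<dots> \<le> card (B g g) + card (B g h) + card (B h g) + card (B h h)"
    using card_Un_le[of "B g g \<union> B g h \<union> B h g" "B h h"] card_Un_le[of "B g g \<union> B g h" "B h g"]
      card_Un_le[of "B g g" "B g h"] by linarith
  finally have "\<exists>x\<in>{g, h}. \<exists>y\<in>{g, h}. card (annulus n) \<le> 4 * card (B x y)"
    by fastforce
  then obtain x y where xy: "x \<in> {g, h}" "y \<in> {g, h}" and cardB: "card (annulus n) \<le> 4 * card (B x y)"
    by blast
  have xyG: "x \<in> G" "y \<in> G" using xy gh by auto
  then have ix: "isometry x" and iy: "isometry y" using G_isometry by auto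
  have long': "2 * \<sigma>0 + 5 * c + 1 \<le> dist p (x p)" "2 * \<sigma>0 + 5 * c + 1 \<le> dist p (y p)"
      "dist p (x p) \<le> m0" "dist p (y p) \<le> m0"
    using xy long by (auto simp: m0_def)
  define \<phi> where "\<phi> f = x \<circ> f \<circ> y" for f
  have B_G: "f \<in> G" "isometry f" "real n - 1 < dist p (f p)" "dist p (f p) \<le> real n"
      "gp p (inv_map x p) (f p) \<le> \<sigma>1" "gp p (inv_map f p) (y p) \<le> \<sigma>1" if "f \<in> B x y" for f
    using that G_isometry by (auto simp: B_def annulus_def)
  have \<phi>G: "\<phi> f \<in> G" if "f \<in> B x y" for f
    using B_G(1)[OF that] xyG G_comp by (simp add: \<phi>_def)
  have "inj_on \<phi> (B x y)"
  proof (rule inj_onI)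
    fix f f' assume "\<phi> f = \<phi> f'"
    then have "x (f (y (inv_map y z))) = x (f' (y (inv_map y z)))" for z
      unfolding \<phi>_def by (metis comp_apply)
    then show "f = f'"
      using ix iy by (metis ext isometry_inv_right isometry_inv_left)
  qed
  then have card\<phi>: "card (\<phi> ` B x y) = card (B x y)"
    by (rule card_image)
  have len: "real n - 1 - 2 * m0 < dist p (\<phi> f p)" "dist p (\<phi> f p) \<le> real n + 2 * m0" if "f \<in> B x y" for f
  proof -
    have "dist p (\<phi> f p) \<le> dist p (x p) + dist (x p) (x (f (y p)))"
      using dist_triangle by (simp add: \<phi>_def)
    also have "dist (x p) (x (f (y p))) = dist p (f (y p))"
      by (rule isometry_dist[OF ix])
    finally have 1: "dist p (\<phi> f p) \<le> dist p (x p) + dist p (f (y p))" .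
    have 2: "dist p (f (y p)) \<le> dist p (x p) + dist p (\<phi> f p)"
      using dist_triangle[of "x p" "x (f (y p))" p] isometry_dist[OF ix, of p "f (y p)"]
      by (simp add: \<phi>_def dist_commute)
    have 3: "dist (f p) (f (y p)) = dist p (y p)"
      using B_G(2)[OF that] by (rule isometry_dist)
    have 4: "dist p (f (y p)) \<le> dist p (f p) + dist p (y p)"
      using dist_triangle[of p "f (y p)" "f p"] 3 by simp
    have 5: "dist p (f p) \<le> dist p (f (y p)) + dist p (y p)"
      using dist_triangle[of p "f p" "f (y p)"] 3 by (simp add: dist_commute)
    show "real n - 1 - 2 * m0 < dist p (\<phi> f p)" "dist p (\<phi> f p) \<le> real n + 2 * m0"
      using 1 2 4 5 B_G(3,4)[OF that] long'(3,4) by linarith+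
  qed
  have start: "dist p (x p) - \<sigma>1 - c \<le> gp p (x p) (\<phi> f p)" if "f \<in> B x y" for f
    using broken_path_start[OF ix B_G(2)[OF that], of \<sigma>1 "y p"] B_G(3,5,6)[OF that] n1 c_nonneg
    by (simp add: \<phi>_def)
  have inv_\<phi>: "inv_map (\<phi> f) p = inv_map y (inv_map f (inv_map x p))" if "f \<in> B x y" for f
    using ix iy B_G(2)[OF that] unfolding \<phi>_def isometry_def
    by (simp add: o_inv_distrib bij_comp)
  have inv_inv: "inv_map (inv_map f) = f" if "isometry f" for f :: "'a \<Rightarrow> 'a"
    using that by (simp add: isometry_def inv_inv_eq)
  \<comment> \<open>The inverse of \<open>\<phi> f\<close> is a product of the same shape, so the
    end of a letter is handled as a beginning.\<close>
  have finish: "dist p (y p) - \<sigma>1 - c \<le> gp p (inv_map y p) (inv_map (\<phi> f) p)" if "f \<in> B x y" for f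
    using broken_path_start[OF isometry_inv[OF iy] isometry_inv[OF B_G(2)[OF that]], of \<sigma>1 "inv_map x p"]
      B_G(3,5,6)[OF that] n1 c_nonneg
    by (simp add: inv_\<phi>[OF that] inv_inv iy B_G(2)[OF that] dist_inv_isometry gp_commute)
  \<comment> \<open>Inverse letters set out along \<open>inv_map y p\<close> and letters along
    \<open>x p\<close>, two directions whose product is at most \<open>\<sigma>0\<close>.\<close>
  have transverse: "gp p (inv_map (\<phi> f) p) (\<phi> f' p) \<le> \<sigma>" if "f \<in> B x y" "f' \<in> B x y" for f f'
    using hyp2[of p "inv_map y p" "inv_map (\<phi> f) p" "\<phi> f' p" "x p"] start[OF that(2)] finish[OF that(1)]
      gp_gh(3)[OF xy] long' c_nonneg
    unfolding \<sigma>_def \<sigma>1_def gp_commute[of p "x p"] by linarith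
  obtain S where S: "S \<subseteq> \<phi> ` B x y" and sep: "\<And>u v. u \<in> S \<Longrightarrow> v \<in> S \<Longrightarrow> u \<noteq> v \<Longrightarrow> \<not> dist (u p) (v p) \<le> R"
    and cardS: "card (\<phi> ` B x y) \<le> card S * M"
  proof (rule separated_subset[of "\<phi> ` B x y" "\<lambda>u v. dist (u p) (v p) \<le> R" M])
    show "finite (\<phi> ` B x y)" using finB by simp
    show "card {v \<in> \<phi> ` B x y. dist (u p) (v p) \<le> R} \<le> M" if "u \<in> \<phi> ` B x y" for u
      unfolding M_def using that \<phi>G by (intro card_G_translates) auto
  qed (use \<open>0 \<le> R\<close> in \<open>auto simp: dist_commute\<close>)
  have S_len: "real n - 1 - 2 * m0 < dist p (u p)" "dist p (u p) \<le> real n + 2 * m0" if "u \<in> S" for u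
    using S that len by auto
  show thesis
  proof (rule that[OF \<sigma>, of S "real n + 2 * m0"])
    show "finite S" using S finB finite_surj by blast
    show "S \<subseteq> G" using S \<phi>G by blast
    show "dist p (u p) \<le> real n + 2 * m0" if "u \<in> S" for u
      using S_len that by blast
    show "2 * \<sigma> + 4 * c + 1 \<le> dist p (u p)" if "u \<in> S" for u
      using S_len(1)[OF that] n1 by linarith
    show "gp p (inv_map u p) (v p) \<le> \<sigma>" if uv: "u \<in> S" "v \<in> S" for u v
    proof -
      obtain f f' where "f \<in> B x y" "f' \<in> B x y" "u = \<phi> f" "v = \<phi> f'"
        using S uv by blast
      then show ?thesis using transverse by simp
    qed
    show "gp p (u p) (v p) < min (dist p (u p)) (dist p (v p)) - \<sigma> - 3 * c" if "u \<in> S" "v \<in> S" "u \<noteq> v" for u v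
    proof -
      have "R < dist (u p) (v p)" using sep[OF that] by simp
      then have "2 * gp p (u p) (v p) < dist p (u p) + dist p (v p) - R"
        by (simp add: gromov_product_def dist_commute)
      then show ?thesis
        using S_len[OF that(1)] S_len[OF that(2)] unfolding R_def by linarith
    qed
    have "4 * real M * b powr (s * (real n + 2 * m0)) \<le> real (card (annulus n))"
      using cardA by (simp add: powr_add ring_distribs mult_ac)
    also have "\<dots> \<le> 4 * real (card S * M)"
      using cardB cardS unfolding card\<phi> by linarith
    finally show "b powr (s * (real n + 2 * m0)) \<le> real (card S)"
      using M by simp
  qed
qed

end

section \<open>Coding by words with controlled displacement\<close>

text \<open>The bound in \<open>letter_ge\<close> is \<open>2 * \<tau> + 1\<close> for the \<tau>
  defined below: a juncture costs at most \<open>2 * \<tau>\<close>, so each further letter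
  lengthens a word by at least 1. The margin in \<open>separated\<close> is the loss
  \<open>\<sigma> + c\<close> of \<open>first_letter\<close> plus \<open>2 * c\<close> for a chain
  of three products. \<open>s0\<close> is the padding letter.\<close>

locale free_words = hyperbolic_group_visual p c G b D
  for p :: "'a::metric_space" and c G b D +
  fixes \<sigma> n L :: real and S :: "('a \<Rightarrow> 'a) set" and s0 :: "'a \<Rightarrow> 'a"
  assumes \<sigma>_nonneg: "0 \<le> \<sigma>" and S_G: "S \<subseteq> G" and s0: "s0 \<in> S"
    and letter_le: "\<And>x. x \<in> S \<Longrightarrow> dist p (x p) \<le> n"
    and letter_ge: "\<And>x. x \<in> S \<Longrightarrow> 2 * \<sigma> + 4 * c + 1 \<le> dist p (x p)"
    and transverse: "\<And>x y. x \<in> S \<Longrightarrow> y \<in> S \<Longrightarrow> gp p (inv_map x p) (y p) \<le> \<sigma>"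
    and separated: "\<And>x y. x \<in> S \<Longrightarrow> y \<in> S \<Longrightarrow> x \<noteq> y \<Longrightarrow>
       gp p (x p) (y p) < min (dist p (x p)) (dist p (y p)) - \<sigma> - 3 * c"
    and n_le_L: "n \<le> L"
begin

definition \<tau> :: real where "\<tau> = \<sigma> + 2 * c"

definition word :: "('a \<Rightarrow> 'a) list \<Rightarrow> 'a \<Rightarrow> 'a" where
  "word u = foldr (\<circ>) u id"

definition len :: "('a \<Rightarrow> 'a) list \<Rightarrow> real" where
  "len u = dist p (word u p)"

lemma word_Nil [simp]: "word [] = id"
  and word_Cons [simp]: "word (a # u) = a \<circ> word u"
  by (simp_all add: word_def)

lemma word_append: "word (u @ v) = word u \<circ> word v"
  by (induction u) (simp_all add: comp_assoc)

lemma S_isometry: "a \<in> S \<Longrightarrow> isometry a"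
  using S_G G_isometry by blast

lemma word_G: "set u \<subseteq> S \<Longrightarrow> word u \<in> G"
  using S_G by (induction u) (auto simp: G_id G_comp simp del: o_apply)

lemma word_isometry: "set u \<subseteq> S \<Longrightarrow> isometry (word u)"
  using word_G G_isometry by blast

text \<open>A word sets out along its first letter. The loss does not grow with the length, because
  the induction hypothesis serves only to place the end of the tail in the direction of the letter
  \<open>f\<close> that starts it.\<close>

lemma first_letter:
  "a \<in> S \<Longrightarrow> set v \<subseteq> S \<Longrightarrow> dist p (a p) - \<sigma> - c \<le> gp p (a p) (word (a # v) p)"
proof (induction v arbitrary: a)
  case Nil
  then show ?case
    using c_nonneg \<sigma>_nonneg by (simp add: gromov_product_def dist_commute)
next
  case (Cons f v)
  have "dist p (f p) - \<sigma> - c \<le> gp p (f p) (word (f # v) p)"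
    using Cons by simp
  then have "\<sigma> + c < gp p (f p) (word (f # v) p)"
    using letter_ge[of f] Cons.prems c_nonneg by simp
  then show ?case
    using broken_path_step[OF S_isometry[OF Cons.prems(1)], of "f p" \<sigma> "word (f # v) p"]
      transverse[of a f] Cons.prems by simp
qed

lemma inv_word_snoc:
  assumes "set u \<subseteq> S" "a \<in> S"
  shows "inv_map (word (u @ [a])) x = inv_map a (inv_map (word u) x)"
  using word_isometry[OF assms(1)] S_isometry[OF assms(2)]
  by (simp add: word_append isometry_def o_inv_distrib)

text \<open>The mirror image of \<open>first_letter\<close> for inverse words, hence the induction
  from the right.\<close>

lemma last_letter:
  "a \<in> S \<Longrightarrow> set u \<subseteq> S \<Longrightarrow>
    dist p (a p) - \<sigma> - c \<le> gp p (inv_map a p) (inv_map (word (u @ [a])) p)"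
proof (induction u arbitrary: a rule: rev_induct)
  case Nil
  then show ?case
    using c_nonneg \<sigma>_nonneg
    by (simp add: gromov_product_def dist_commute dist_inv_isometry[OF S_isometry, symmetric])
next
  case (snoc f u)
  have a: "isometry a" and f: "isometry f"
    using snoc.prems S_isometry by auto
  have inv_inv: "inv_map (inv_map a) = a"
    using a by (simp add: isometry_def inv_inv_eq)
  have "dist p (f p) - \<sigma> - c \<le> gp p (inv_map f p) (inv_map (word (u @ [f])) p)"
    using snoc by simp
  then have "\<sigma> + c < gp p (inv_map f p) (inv_map (word (u @ [f])) p)"
    using letter_ge[of f] snoc.prems c_nonneg by simp
  moreover have "gp p (inv_map (inv_map a) p) (inv_map f p) \<le> \<sigma>"
    using transverse[of f a] snoc.prems by (simp add: inv_inv gp_commute)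
  ultimately have "dist p (inv_map a p) - \<sigma> - c
      \<le> gp p (inv_map a p) (inv_map a (inv_map (word (u @ [f])) p))"
    using broken_path_step[OF isometry_inv[OF a]] by blast
  then show ?case
    using inv_word_snoc[of "u @ [f]" a p] snoc.prems by (simp add: dist_inv_isometry a)
qed

text \<open>Words backtrack by at most \<tau> at any cut: seen from the cut, the two pieces leave
  along the last letter of \<open>u\<close>, inverted, and the first letter of \<open>v\<close>,
  which are transverse.\<close>

lemma gp_word_append:
  assumes u: "set u \<subseteq> S" and v: "set v \<subseteq> S"
  shows "gp (word u p) p (word (u @ v) p) \<le> \<tau>"
proof -
  have "gp p (inv_map (word u) p) (word v p) \<le> \<tau>"
  proof (cases "u = [] \<or> v = []")
    case True
    moreover have "inv_map id p = p" by simp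
    ultimately show ?thesis
      using gp_self_right[of p] gp_commute[of p p] c_nonneg \<sigma>_nonneg by (auto simp: \<tau>_def)
  next
    case False
    then obtain u' a f v' where uv: "u = u' @ [a]" "v = f # v'"
      by (metis neq_Nil_conv rev_exhaust)
    then have af: "a \<in> S" "f \<in> S" "set u' \<subseteq> S" "set v' \<subseteq> S" using u v by auto
    show ?thesis
      using hyp2[of p "inv_map a p" "inv_map (word u) p" "word v p" "f p"] last_letter[OF af(1,3)]
        first_letter[OF af(2,4)] letter_ge[OF af(1)] letter_ge[OF af(2)] transverse[OF af(1,2)] c_nonneg
      unfolding uv \<tau>_def gp_commute[of p "f p"] by linarith
  qed
  then show ?thesis
    using gp_inv_isometry[OF word_isometry[OF u]] by (simp add: word_append)
qed

lemma dist_word_append: "set u \<subseteq> S \<Longrightarrow> dist (word u p) (word (u @ v) p) = len v"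
  using isometry_dist[OF word_isometry] by (simp add: word_append len_def)

lemma len_append_le: "set u \<subseteq> S \<Longrightarrow> len (u @ v) \<le> len u + len v"
  using dist_triangle[of p "word (u @ v) p" "word u p"] by (simp add: dist_word_append len_def[of u] len_def[of "u @ v"])

lemma len_append_ge: "set u \<subseteq> S \<Longrightarrow> set v \<subseteq> S \<Longrightarrow> len u + len v - 2 * \<tau> \<le> len (u @ v)"
  using gp_word_append[of u v] dist_word_append[of u v]
  by (simp add: gromov_product_def len_def[of u] len_def[of "u @ v"] dist_commute)

lemma len_snoc_ge: "set u \<subseteq> S \<Longrightarrow> a \<in> S \<Longrightarrow> len u + 1 \<le> len (u @ [a])"
  using len_append_ge[of u "[a]"] letter_ge[of a] by (simp add: len_def[of "[a]"] \<tau>_def)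

lemma len_snoc_le: "set u \<subseteq> S \<Longrightarrow> a \<in> S \<Longrightarrow> len (u @ [a]) \<le> len u + n"
  using len_append_le[of u "[a]"] letter_le[of a] by (simp add: len_def[of "[a]"])

text \<open>The two words follow \<open>a p\<close> and \<open>a' p\<close> beyond the place where
  these separate, so their product is that of the two letters up to \<open>2 * c\<close>.\<close>

lemma gp_branch:
  assumes "a \<in> S" "a' \<in> S" "a \<noteq> a'" "set v \<subseteq> S" "set v' \<subseteq> S"
  shows "gp p (word (a # v) p) (word (a' # v') p) \<le> n + 2 * c"
proof -
  have "gp p (a p) (a' p) \<le> n"
    using gp_le_left[of p "a p" "a' p"] letter_le[OF assms(1)] by linarith
  then show ?thesis
    using hyp2[of p "a p" "word (a # v) p" "word (a' # v') p" "a' p"] separated[OF assms(1-3)]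
      first_letter[OF assms(1,4)] first_letter[OF assms(2,5)] c_nonneg
    unfolding gp_commute[of p "word (a' # v') p" "a' p"] by linarith
qed

text \<open>Guarantees that the \<open>LEAST\<close> in \<open>pad_count\<close> is
  attained.\<close>

lemma len_replicate_ge: "set u \<subseteq> S \<Longrightarrow> real m \<le> len (u @ replicate m s0)"
proof (induction m)
  case 0
  then show ?case by (simp add: len_def)
next
  case (Suc m)
  have "set (u @ replicate m s0) \<subseteq> S" using Suc s0 by auto
  from len_snoc_ge[OF this s0] show ?case
    using Suc by (simp add: replicate_append_same[symmetric] del: replicate_Suc)
       (simp add: replicate_append_same)
qed

section \<open>Padded words\<close>

definition pad_count :: "nat \<Rightarrow> ('a \<Rightarrow> 'a) list \<Rightarrow> nat" where
  "pad_count j u = (LEAST m. real j * L \<le> len (u @ replicate m s0))"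

text \<open>Words are lengthened by copies of \<open>s0\<close> until their displacement reaches the next multiple of
  \<open>L\<close>; this keeps the displacement of the \<open>k\<close>-th word within a bounded distance of \<open>k * L\<close>, so errors
  do not accumulate.\<close>

primrec path :: "(nat \<Rightarrow> 'a \<Rightarrow> 'a) \<Rightarrow> nat \<Rightarrow> ('a \<Rightarrow> 'a) list" where
  "path \<omega> 0 = []"
| "path \<omega> (Suc k) = path \<omega> k @ \<omega> k # replicate (pad_count (Suc k) (path \<omega> k @ [\<omega> k])) s0"

lemma path_S: "range \<omega> \<subseteq> S \<Longrightarrow> set (path \<omega> k) \<subseteq> S"
  using s0 by (induction k) (auto simp: set_replicate_conv_if)

lemma n_pos: "1 \<le> n"
  using letter_le[OF s0] letter_ge[OF s0] \<sigma>_nonneg c_nonneg by linarith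

lemma path_len:
  assumes \<omega>: "range \<omega> \<subseteq> S"
  shows "real k * L \<le> len (path \<omega> k) \<and> len (path \<omega> k) \<le> real k * L + n"
proof (induction k)
  case 0
  then show ?case using n_pos by (simp add: len_def)
next
  case (Suc k)
  define u where "u = path \<omega> k @ [\<omega> k]"
  have \<omega>k: "\<omega> k \<in> S" using \<omega> by blast
  have u: "set u \<subseteq> S" using path_S[OF \<omega>, of k] \<omega>k by (auto simp: u_def)
  define m where "m = pad_count (Suc k) u"
  have eq: "path \<omega> (Suc k) = u @ replicate m s0"
    by (simp add: u_def m_def)
  obtain m' :: nat where "real (Suc k) * L \<le> real m'"
    using real_arch_simple by blast
  then have ex: "real (Suc k) * L \<le> len (u @ replicate m' s0)"
    using len_replicate_ge[OF u, of m'] by linarith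
  have 1: "real (Suc k) * L \<le> len (u @ replicate m s0)"
    unfolding m_def pad_count_def by (rule LeastI[of _ m']) (rule ex)
  \<comment> \<open>Without padding, the free letter adds at most \<open>n\<close>, which the step
    from \<open>k * L\<close> to \<open>(k + 1) * L\<close> absorbs because
    \<open>n \<le> L\<close>. With padding, the last copy of \<open>s0\<close> was added to a word
    still below the target.\<close>
  have 2: "len (u @ replicate m s0) \<le> real (Suc k) * L + n"
  proof (cases m)
    case 0
    have "len u \<le> real k * L + n + n"
      using len_snoc_le[OF path_S[OF \<omega>, of k] \<omega>k] Suc by (simp add: u_def)
    also have "\<dots> \<le> real (Suc k) * L + n"
      using n_le_L by (simp add: algebra_simps)
    finally show ?thesis using 0 by simp
  next
    case (Suc m'')
    then have "m'' < (LEAST m. real (Suc k) * L \<le> len (u @ replicate m s0))"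
      by (simp add: m_def pad_count_def)
    from not_less_Least[OF this] have "len (u @ replicate m'' s0) < real (Suc k) * L"
      by simp
    moreover have "set (u @ replicate m'' s0) \<subseteq> S" using u s0 by auto
    from len_snoc_le[OF this s0] have "len (u @ replicate m s0) \<le> len (u @ replicate m'' s0) + n"
      by (simp add: Suc replicate_append_same)
    ultimately show ?thesis by linarith
  qed
  show ?case using 1 2 unfolding eq by blast
qed

lemma path_prefix:
  assumes \<omega>: "range \<omega> \<subseteq> S" and "k \<le> l"
  obtains r where "path \<omega> l = path \<omega> k @ r" "set r \<subseteq> S"
proof -
  have "\<exists>r. path \<omega> l = path \<omega> k @ r"
    using \<open>k \<le> l\<close> by (induction l rule: dec_induct) auto
  then show thesis
    using that path_S[OF \<omega>, of l] by auto
qed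

lemma path_branch:
  assumes \<omega>: "range \<omega> \<subseteq> S" and "k < l"
  obtains r where "path \<omega> l = path \<omega> k @ \<omega> k # r" "set r \<subseteq> S"
proof -
  obtain r where "path \<omega> l = path \<omega> (Suc k) @ r"
    using path_prefix[OF \<omega>, of "Suc k" l] \<open>k < l\<close> by auto
  then have "path \<omega> l = path \<omega> k @ \<omega> k # (replicate (pad_count (Suc k) (path \<omega> k @ [\<omega> k])) s0 @ r)"
    by simp
  moreover from this have "set (replicate (pad_count (Suc k) (path \<omega> k @ [\<omega> k])) s0 @ r) \<subseteq> S"
    using path_S[OF \<omega>, of l] by simp
  ultimately show thesis
    by (rule that)
qed

text \<open>The amount of padding is determined by the letters already chosen.\<close>

lemma path_cong: "(\<And>i. i < k \<Longrightarrow> \<omega> i = \<omega>' i) \<Longrightarrow> path \<omega> k = path \<omega>' k"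
  by (induction k) auto

section \<open>Orbits of codes and their limit points\<close>

definition orbit :: "(nat \<Rightarrow> 'a \<Rightarrow> 'a) \<Rightarrow> nat \<Rightarrow> 'a" where
  "orbit \<omega> k = word (path \<omega> k) p"

lemma gp_orbit_le:
  assumes "range \<omega> \<subseteq> S" "k \<le> l"
  shows "gp (orbit \<omega> k) p (orbit \<omega> l) \<le> \<tau>"
proof -
  obtain r where "path \<omega> l = path \<omega> k @ r" "set r \<subseteq> S"
    using path_prefix assms by blast
  then show ?thesis
    using gp_word_append[OF path_S[OF assms(1)]] by (simp add: orbit_def)
qed

lemma gp_orbit_ge:
  assumes "range \<omega> \<subseteq> S" "k \<le> l"
  shows "real k * L - \<tau> \<le> gp p (orbit \<omega> k) (orbit \<omega> l)"
proof -
  have "gp p (orbit \<omega> k) (orbit \<omega> l) + gp (orbit \<omega> k) p (orbit \<omega> l) = len (path \<omega> k)"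
    unfolding len_def orbit_def by (rule gp_flip)
  then show ?thesis
    using gp_orbit_le[OF assms] path_len[OF assms(1), of k] by linarith
qed

lemma L_pos: "1 \<le> L"
  using n_pos n_le_L by linarith

lemma multiple_L_unbounded: obtains N where "\<And>k. k \<ge> N \<Longrightarrow> t \<le> real k * L"
proof -
  obtain N :: nat where N: "max t 0 \<le> real N" using real_arch_simple by blast
  have "t \<le> real k * L" if "k \<ge> N" for k
    using N that L_pos mult_mono[of "real N" "real k" 1 L] by simp
  then show thesis using that by blast
qed

lemma gromov_sequence_orbit:
  assumes "range \<omega> \<subseteq> S" shows "gromov_sequence p (orbit \<omega>)"
  unfolding gromov_sequence_iff
proof
  fix t
  obtain N where N: "\<And>k. k \<ge> N \<Longrightarrow> t + \<tau> \<le> real k * L"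
    using multiple_L_unbounded by blast
  have "t \<le> gp p (orbit \<omega> n) (orbit \<omega> m)" if nm: "n \<ge> N" "m \<ge> N" for n m
  proof (cases "n \<le> m")
    case True
    then show ?thesis using gp_orbit_ge[OF assms True] N[OF nm(1)] by linarith
  next
    case False
    then have "m \<le> n" by simp
    then show ?thesis
      using gp_orbit_ge[OF assms \<open>m \<le> n\<close>] N[OF nm(2)] gp_commute[of p "orbit \<omega> n" "orbit \<omega> m"] by linarith
  qed
  then show "\<exists>N. \<forall>n\<ge>N. \<forall>m\<ge>N. t \<le> gp p (orbit \<omega> n) (orbit \<omega> m)" by blast
qed

definition limit :: "(nat \<Rightarrow> 'a \<Rightarrow> 'a) \<Rightarrow> (nat \<Rightarrow> 'a) set" where
  "limit \<omega> = boundary_class (orbit \<omega>)"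

lemma limit:
  assumes "range \<omega> \<subseteq> S"
  shows "limit \<omega> \<in> gromov_boundary p" "orbit \<omega> \<in> limit \<omega>"
  using boundary_class[OF gromov_sequence_orbit[OF assms]] by (simp_all add: limit_def)

lemma limit_unif_radial:
  assumes \<omega>: "range \<omega> \<subseteq> S" shows "limit \<omega> \<in> unif_radial_limit_set p G"
proof -
  \<comment> \<open>Consecutive words differ in displacement by at most \<open>L + n\<close>, and
    the juncture between them adds at most \<open>2 * \<tau>\<close>.\<close>
  define \<rho> where "\<rho> = L + n + 2 * \<tau>"
  have \<tau>: "0 \<le> \<tau>" using \<sigma>_nonneg c_nonneg by (simp add: \<tau>_def)
  have \<rho>: "0 < \<rho>" "\<tau> \<le> \<rho>" using \<tau> L_pos n_pos by (auto simp: \<rho>_def)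
  have "limit \<omega> \<in> unif_radial_limit_set_at p G \<rho>"
    unfolding unif_radial_limit_set_at_def
  proof (intro CollectI conjI exI[of _ "\<lambda>k. word (path \<omega> k)"] allI)
    show "limit \<omega> \<in> gromov_boundary p" using limit \<omega> by blast
    show "word (path \<omega> k) \<in> G" for k using word_G path_S \<omega> by blast
    show "word (path \<omega> 0) p = p" by simp
    have "eventually (\<lambda>k. ereal t < gromov_product_bd_pt p (limit \<omega>) (word (path \<omega> k) p)) sequentially" for t
    proof -
      obtain N where N: "\<And>k. k \<ge> N \<Longrightarrow> t + \<tau> + c + 1 \<le> real k * L"
        using multiple_L_unbounded by blast
      have "ereal t < gromov_product_bd_pt p (limit \<omega>) (word (path \<omega> k) p)" if "k \<ge> N" for k
      proof -
        have "ereal (real k * L - \<tau> - c) \<le> gromov_product_bd_pt p (limit \<omega>) (orbit \<omega> k)"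
          by (rule gromov_product_bd_pt_ge[OF limit[OF \<omega>], of k]) (use gp_orbit_ge[OF \<omega>, of k] in \<open>simp add: gp_commute\<close>)
        moreover have "ereal t < ereal (real k * L - \<tau> - c)" using N[OF that] by simp
        ultimately show ?thesis unfolding orbit_def by (rule less_le_trans[rotated])
      qed
      then show ?thesis unfolding eventually_sequentially by blast
    qed
    then show "converges_to_boundary p (\<lambda>k. word (path \<omega> k) p) (limit \<omega>)"
      unfolding converges_to_boundary_def tendsto_PInfty by blast
    show "gromov_product_bd_pt (word (path \<omega> k) p) (limit \<omega>) p \<le> ereal \<rho>" for k
    proof (rule gromov_product_bd_pt_le[OF limit(2)[OF \<omega>], of k])
      fix l assume "k \<le> l"
      then show "gp (word (path \<omega> k) p) (orbit \<omega> l) p \<le> \<rho>"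
        using gp_orbit_le[OF \<omega>, of k l] \<rho>(2) by (simp add: gp_commute orbit_def[of _ k])
    qed
    show "dist (word (path \<omega> k) p) (word (path \<omega> (Suc k)) p) \<le> \<rho>" for k
    proof -
      have "2 * gp (orbit \<omega> k) p (orbit \<omega> (Suc k)) =
          len (path \<omega> k) + dist (orbit \<omega> k) (orbit \<omega> (Suc k)) - len (path \<omega> (Suc k))"
        by (simp add: gromov_product_def len_def orbit_def dist_commute)
      then have "dist (orbit \<omega> k) (orbit \<omega> (Suc k)) \<le> \<rho>"
        using gp_orbit_le[OF \<omega>, of k "Suc k"] path_len[OF \<omega>, of k] path_len[OF \<omega>, of "Suc k"]
        by (simp add: \<rho>_def algebra_simps)
      then show ?thesis by (simp add: orbit_def)
    qed
  qed
  then show ?thesis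
    using \<rho>(1) by (auto simp: unif_radial_limit_set_def)
qed

text \<open>Both orbits pass through the same point at time \<open>k\<close>. One \<open>c\<close>
  pays for the triangle through that point and \<open>2 * c\<close> for the passage to the
  boundary.\<close>

lemma limit_product_ge:
  assumes \<omega>: "range \<omega> \<subseteq> S" and \<omega>': "range \<omega>' \<subseteq> S" and eq: "\<And>i. i < k \<Longrightarrow> \<omega> i = \<omega>' i"
  shows "ereal (real k * L - \<tau> - 3 * c) \<le> gromov_product_bd p (limit \<omega>) (limit \<omega>')"
proof -
  have "real k * L - \<tau> - c \<le> gp p (orbit \<omega> i) (orbit \<omega>' j)" if "k \<le> i" "k \<le> j" for i j
  proof -
    have "orbit \<omega> k = orbit \<omega>' k" using path_cong[OF eq] by (simp add: orbit_def)
    then show ?thesis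
      using hyp[of p "orbit \<omega> i" "orbit \<omega> k" "orbit \<omega>' j"] gp_orbit_ge[OF \<omega> that(1)]
        gp_orbit_ge[OF \<omega>' that(2)] gp_commute[of p "orbit \<omega> i" "orbit \<omega> k"] by auto
  qed
  from gromov_product_bd_ge[OF limit[OF \<omega>] limit[OF \<omega>'] this] show ?thesis by (simp add: algebra_simps)
qed

text \<open>After removal of the common word the two orbits branch at \<open>p\<close>. Moving the
  basepoint back costs the displacement of that word, at most \<open>real k * L + n\<close>.\<close>

lemma limit_product_le:
  assumes \<omega>: "range \<omega> \<subseteq> S" and \<omega>': "range \<omega>' \<subseteq> S" and eq: "\<And>i. i < k \<Longrightarrow> \<omega> i = \<omega>' i"
    and ne: "\<omega> k \<noteq> \<omega>' k"
  shows "gromov_product_bd p (limit \<omega>) (limit \<omega>') \<le> ereal (real k * L + 2 * n + 2 * c)"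
proof (rule gromov_product_bd_le[OF limit(2)[OF \<omega>] limit(2)[OF \<omega>'], of "Suc k"])
  fix i j assume ij: "Suc k \<le> i" "Suc k \<le> j"
  define u where "u = path \<omega> k"
  have u: "set u \<subseteq> S" "path \<omega>' k = u"
    using path_S[OF \<omega>, of k] path_cong[of k \<omega> \<omega>', OF eq] by (simp_all add: u_def)
  obtain r where r: "path \<omega> i = u @ \<omega> k # r" "set r \<subseteq> S"
    using path_branch[OF \<omega>, of k i] ij unfolding u_def by auto
  obtain r' where r': "path \<omega>' j = u @ \<omega>' k # r'" "set r' \<subseteq> S"
    using path_branch[OF \<omega>', of k j] ij u(2) by auto
  have "gp (word u p) (orbit \<omega> i) (orbit \<omega>' j) = gp p (word (\<omega> k # r) p) (word (\<omega>' k # r') p)"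
    using gp_isometry[OF word_isometry[OF u(1)]] by (simp add: orbit_def r r' word_append)
  also have "\<dots> \<le> n + 2 * c"
    using \<omega> \<omega>' ne r r' by (intro gp_branch) auto
  finally show "gp p (orbit \<omega> i) (orbit \<omega>' j) \<le> real k * L + 2 * n + 2 * c"
    using gp_basepoint[of p "orbit \<omega> i" "orbit \<omega>' j" "word u p"] path_len[OF \<omega>, of k]
    by (simp add: u_def len_def)
qed

end

context hyperbolic_group_visual
begin

lemma cantor_coding:
  assumes gt: "general_type p D G" and s: "0 < s" "ereal s < poincare_exponent b p G"
  obtains S :: "('a \<Rightarrow> 'a) set" and \<phi> :: "(nat \<Rightarrow> 'a \<Rightarrow> 'a) \<Rightarrow> (nat \<Rightarrow> 'a) set" and \<theta> c1 c2 :: real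
  where "finite S" "S \<noteq> {}" "0 < \<theta>" "\<theta> < 1" "real (card S) * \<theta> powr s = 1" "0 < c1" "0 < c2"
    "\<And>\<omega>. range \<omega> \<subseteq> S \<Longrightarrow> \<phi> \<omega> \<in> unif_radial_limit_set p G"
    "\<And>\<omega>. range \<omega> \<subseteq> S \<Longrightarrow> \<phi> \<omega> \<in> mspace D"
    "\<And>\<omega> \<omega>' k. range \<omega> \<subseteq> S \<Longrightarrow> range \<omega>' \<subseteq> S \<Longrightarrow> (\<And>i. i < k \<Longrightarrow> \<omega> i = \<omega>' i) \<Longrightarrow>
       mdist D (\<phi> \<omega>) (\<phi> \<omega>') \<le> c2 * \<theta> ^ k"
    "\<And>\<omega> \<omega>' k. range \<omega> \<subseteq> S \<Longrightarrow> range \<omega>' \<subseteq> S \<Longrightarrow> (\<And>i. i < k \<Longrightarrow> \<omega> i = \<omega>' i) \<Longrightarrow> \<omega> k \<noteq> \<omega>' k \<Longrightarrow>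
       c1 * \<theta> ^ k \<le> mdist D (\<phi> \<omega>) (\<phi> \<omega>')"
proof -
  obtain \<sigma> n S where \<sigma>: "0 \<le> \<sigma>" and S: "finite S" "S \<subseteq> G"
    and le: "\<And>x. x \<in> S \<Longrightarrow> dist p (x p) \<le> n"
    and ge: "\<And>x. x \<in> S \<Longrightarrow> 2 * \<sigma> + 4 * c + 1 \<le> dist p (x p)"
    and tr: "\<And>x y. x \<in> S \<Longrightarrow> y \<in> S \<Longrightarrow> gp p (inv_map x p) (y p) \<le> \<sigma>"
    and sep: "\<And>x y. x \<in> S \<Longrightarrow> y \<in> S \<Longrightarrow> x \<noteq> y \<Longrightarrow>
       gp p (x p) (y p) < min (dist p (x p)) (dist p (y p)) - \<sigma> - 3 * c"
    and card: "b powr (s * n) \<le> real (card S)"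
    using free_letters[OF gt _ s(2)] s(1) by (metis less_imp_le)
  have "0 < b powr (s * n)" using b by simp
  then have card_pos: "0 < real (card S)" using card by linarith
  then obtain s0 where s0: "s0 \<in> S" by fastforce
  define L where "L = log b (real (card S)) / s"
  \<comment> \<open>The lower bound on the number of letters enters here, as
    \<open>n \<le> L\<close>.\<close>
  have "s * n \<le> log b (real (card S))"
    using card card_pos b by (simp add: le_log_iff)
  then have nL: "n \<le> L" using s(1) by (simp add: L_def field_simps)
  interpret free_words p c G b D \<sigma> n L S s0
    using \<sigma> S s0 le ge tr sep nL by unfold_locales auto
  define \<theta> where "\<theta> = b powr (- L)"
  obtain V where V: "1 \<le> V"
    "\<And>\<xi> \<eta>. \<xi> \<in> gromov_boundary p \<Longrightarrow> \<eta> \<in> gromov_boundary p \<Longrightarrow>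
      powr_minus b (gromov_product_bd p \<xi> \<eta>) / V \<le> mdist D \<xi> \<eta>"
    "\<And>\<xi> \<eta>. \<xi> \<in> gromov_boundary p \<Longrightarrow> \<eta> \<in> gromov_boundary p \<Longrightarrow>
      mdist D \<xi> \<eta> \<le> V * powr_minus b (gromov_product_bd p \<xi> \<eta>)"
    using visual_bounds by metis
  have pow: "\<theta> ^ k = b powr (- (real k * L))" for k
    using b by (simp add: \<theta>_def powr_powr mult.commute flip: powr_realpow)
  show thesis
  proof (rule that[of S \<theta> "b powr (- (2 * n + 2 * c)) / V" "V * b powr (\<tau> + 3 * c)" limit])
    show "finite S" "S \<noteq> {}" using S s0 by auto
    show "0 < \<theta>" using b by (simp add: \<theta>_def)
    show "\<theta> < 1" using b L_pos powr_less_mono[of "- L" 0 b] by (simp add: \<theta>_def)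
    have "\<theta> powr s = b powr (- log b (real (card S)))"
      using s(1) by (simp add: \<theta>_def powr_powr L_def)
    then show "real (card S) * \<theta> powr s = 1"
      using b card_pos by (simp add: powr_minus_divide)
    show "0 < b powr (- (2 * n + 2 * c)) / V" "0 < V * b powr (\<tau> + 3 * c)"
      using b V(1) by simp_all
    show "limit \<omega> \<in> unif_radial_limit_set p G" "limit \<omega> \<in> mspace D" if "range \<omega> \<subseteq> S" for \<omega>
      using limit_unif_radial[OF that] limit[OF that] by (simp_all add: mspace_D)
    show "mdist D (limit \<omega>) (limit \<omega>') \<le> V * b powr (\<tau> + 3 * c) * \<theta> ^ k"
      if "range \<omega> \<subseteq> S" "range \<omega>' \<subseteq> S" "\<And>i. i < k \<Longrightarrow> \<omega> i = \<omega>' i" for \<omega> \<omega>' k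
    proof -
      have "mdist D (limit \<omega>) (limit \<omega>') \<le> V * powr_minus b (gromov_product_bd p (limit \<omega>) (limit \<omega>'))"
        by (intro V(3) limit that(1,2))
      also have "\<dots> \<le> V * b powr (- (real k * L - \<tau> - 3 * c))"
        using V(1) powr_minus_le[OF b limit_product_ge[OF that]] by (intro mult_left_mono) auto
      also have "b powr (- (real k * L - \<tau> - 3 * c)) = b powr (\<tau> + 3 * c) * \<theta> ^ k"
        unfolding pow powr_add[symmetric] by (simp add: algebra_simps)
      finally show ?thesis by (simp add: mult.assoc)
    qed
    show "b powr (- (2 * n + 2 * c)) / V * \<theta> ^ k \<le> mdist D (limit \<omega>) (limit \<omega>')"
      if "range \<omega> \<subseteq> S" "range \<omega>' \<subseteq> S" "\<And>i. i < k \<Longrightarrow> \<omega> i = \<omega>' i" "\<omega> k \<noteq> \<omega>' k" for \<omega> \<omega>' k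
    proof -
      have "b powr (- (2 * n + 2 * c)) * \<theta> ^ k = b powr (- (real k * L + 2 * n + 2 * c))"
        unfolding pow powr_add[symmetric] by (simp add: algebra_simps)
      also have "\<dots> \<le> powr_minus b (gromov_product_bd p (limit \<omega>) (limit \<omega>'))"
        by (intro powr_minus_ge[OF b limit_product_le[OF that]] gromov_product_bd_nonneg)
      finally have "b powr (- (2 * n + 2 * c)) * \<theta> ^ k / V \<le> powr_minus b (gromov_product_bd p (limit \<omega>) (limit \<omega>')) / V"
        using V(1) by (intro divide_right_mono) auto
      also have "\<dots> \<le> mdist D (limit \<omega>) (limit \<omega>')"
        by (intro V(2) limit that(1,2))
      finally show ?thesis by simp
    qed
  qed
qed

end

section \<open>The natural measure on a coded Cantor set\<close>

lemma closedin_sigma_sets: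
  assumes "closedin (mtopology_of m) U"
  shows "U \<in> sigma_sets (mspace m) {U. openin (mtopology_of m) U}"
proof -
  have "U \<subseteq> mspace m" "openin (mtopology_of m) (mspace m - U)"
    using assms by (auto simp: closedin_def)
  then have "mspace m - (mspace m - U) \<in> sigma_sets (mspace m) {U. openin (mtopology_of m) U}"
    by (intro sigma_sets.Compl sigma_sets.Basic) simp
  then show ?thesis
    using \<open>U \<subseteq> mspace m\<close> by (simp add: double_diff)
qed

lemma mcball_of_sigma_sets:
  "mcball_of m z r \<in> sigma_sets (mspace m) {U. openin (mtopology_of m) U}"
  by (rule closedin_sigma_sets)
    (simp add: mtopology_of_def mcball_of_def Metric_space.closedin_mcball[OF Metric_space_mspace_mdist])

text \<open>The group is gone: what remains is a finite alphabet and the comparison of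
  \<open>mdist m\<close> with the ultrametric on codes. \<open>dim\<close> says that splitting into
  \<open>card S\<close> pieces, each scaled by \<theta>, preserves \<open>s\<close>-dimensional
  mass.\<close>

locale coded_cantor_set =
  fixes m :: "'b metric" and S :: "'i set" and \<phi> :: "(nat \<Rightarrow> 'i) \<Rightarrow> 'b" and \<theta> s c1 c2 :: real
  assumes S: "finite S" "S \<noteq> {}" and \<theta>: "0 < \<theta>" "\<theta> < 1" and s_pos: "0 < s"
    and dim: "real (card S) * \<theta> powr s = 1" and c1: "0 < c1" and c2: "0 < c2"
    and \<phi>: "\<And>\<omega>. range \<omega> \<subseteq> S \<Longrightarrow> \<phi> \<omega> \<in> mspace m"
    and upper: "\<And>\<omega> \<omega>' k. range \<omega> \<subseteq> S \<Longrightarrow> range \<omega>' \<subseteq> S \<Longrightarrow> (\<And>i. i < k \<Longrightarrow> \<omega> i = \<omega>' i) \<Longrightarrow>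
       mdist m (\<phi> \<omega>) (\<phi> \<omega>') \<le> c2 * \<theta> ^ k"
    and lower: "\<And>\<omega> \<omega>' k. range \<omega> \<subseteq> S \<Longrightarrow> range \<omega>' \<subseteq> S \<Longrightarrow> (\<And>i. i < k \<Longrightarrow> \<omega> i = \<omega>' i) \<Longrightarrow> \<omega> k \<noteq> \<omega>' k \<Longrightarrow>
       c1 * \<theta> ^ k \<le> mdist m (\<phi> \<omega>) (\<phi> \<omega>')"
begin

definition codes :: "(nat \<Rightarrow> 'i) set" where
  "codes = {\<omega>. range \<omega> \<subseteq> S}"

definition cyl :: "nat \<Rightarrow> (nat \<Rightarrow> 'i) \<Rightarrow> (nat \<Rightarrow> 'i) set" where
  "cyl k \<omega> = {\<omega>' \<in> codes. \<forall>i<k. \<omega> i = \<omega>' i}"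

definition M :: "(nat \<Rightarrow> 'i) measure" where
  "M = PiM UNIV (\<lambda>_. uniform_count_measure S)"

lemma upper': "\<omega> \<in> codes \<Longrightarrow> \<omega>' \<in> cyl k \<omega> \<Longrightarrow> mdist m (\<phi> \<omega>) (\<phi> \<omega>') \<le> c2 * \<theta> ^ k"
  by (rule upper) (auto simp: codes_def cyl_def)

text \<open>A first disagreement at an index up to \<open>k\<close> would already force distance
  \<open>c1 * \<theta> ^ k\<close>; hence \<open>k + 1\<close> coordinates agree, not just
  \<open>k\<close>.\<close>

lemma lower':
  assumes "\<omega> \<in> codes" "\<omega>' \<in> codes" "mdist m (\<phi> \<omega>) (\<phi> \<omega>') < c1 * \<theta> ^ k"
  shows "\<omega>' \<in> cyl (Suc k) \<omega>"
proof (rule ccontr)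
  assume "\<not> ?thesis"
  then obtain i where i: "i \<le> k" "\<omega> i \<noteq> \<omega>' i"
    using assms(2) by (auto simp: cyl_def less_Suc_eq_le)
  define j where "j = (LEAST i. \<omega> i \<noteq> \<omega>' i)"
  have j1: "\<omega> j \<noteq> \<omega>' j"
    unfolding j_def by (rule LeastI[of "\<lambda>i. \<omega> i \<noteq> \<omega>' i", OF i(2)])
  have j2: "j \<le> k"
    using Least_le[of "\<lambda>i. \<omega> i \<noteq> \<omega>' i", OF i(2)] i(1) by (simp add: j_def)
  have j3: "\<omega> l = \<omega>' l" if "l < j" for l
    using not_less_Least[of l "\<lambda>i. \<omega> i \<noteq> \<omega>' i"] that by (simp add: j_def)
  have "c1 * \<theta> ^ k \<le> c1 * \<theta> ^ j"
    using j2 \<theta> c1 by (simp add: power_decreasing)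
  also have "\<dots> \<le> mdist m (\<phi> \<omega>) (\<phi> \<omega>')"
    using assms j1 j3 by (intro lower) (auto simp: codes_def)
  finally show False using assms(3) by simp
qed

interpretation product_prob_space "\<lambda>_. uniform_count_measure S" "UNIV :: nat set"
  by (rule product_prob_spaceI) (rule prob_space_uniform_count_measure[OF S])

lemma prob_space_M: "prob_space M"
  unfolding M_def by (rule P.prob_space_axioms)

lemma space_M: "space M = codes"
  by (auto simp: M_def space_PiM codes_def space_uniform_count_measure PiE_def Pi_def)

lemma cyl_emb:
  assumes "\<omega> \<in> codes"
  shows "cyl k \<omega> = prod_emb UNIV (\<lambda>_. uniform_count_measure S) {..<k} (PiE {..<k} (\<lambda>i. {\<omega> i}))"
proof -
  have "\<omega>' \<in> cyl k \<omega> \<longleftrightarrow> (\<forall>i. \<omega>' i \<in> S) \<and> (\<forall>i<k. \<omega>' i = \<omega> i)" for \<omega>'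
    by (auto simp: cyl_def codes_def)
  then show ?thesis
    by (auto simp: prod_emb_iff space_uniform_count_measure PiE_iff)
qed

lemma cyl_sets: "\<omega> \<in> codes \<Longrightarrow> cyl k \<omega> \<in> sets M"
  unfolding M_def by (subst cyl_emb, assumption, rule sets_PiM_I)
    (auto simp: codes_def sets_uniform_count_measure)

lemma power_dim: "(1 / real (card S)) ^ k = (\<theta> ^ k) powr s"
proof -
  have "1 / real (card S) = \<theta> powr s"
    using dim by (metis mult_eq_0_iff nonzero_eq_divide_eq mult.commute zero_neq_one)
  then show ?thesis
    using \<theta> by (simp add: powr_powr mult.commute flip: powr_realpow)
qed

lemma measure_cyl:
  assumes "\<omega> \<in> codes" shows "measure M (cyl k \<omega>) = (\<theta> ^ k) powr s"
proof -
  have "measure M (cyl k \<omega>) = (\<Prod>i<k. measure (uniform_count_measure S) {\<omega> i})"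
    unfolding M_def cyl_emb[OF assms]
    by (rule measure_PiM_emb) (use assms in \<open>auto simp: codes_def sets_uniform_count_measure\<close>)
  also have "\<dots> = (\<Prod>i<k. 1 / real (card S))"
    using assms S by (intro prod.cong refl, subst measure_uniform_count_measure) (auto simp: codes_def)
  finally show ?thesis by (simp add: power_dim[symmetric])
qed

lemma measure_mono_M: "A \<subseteq> B \<Longrightarrow> B \<in> sets M \<Longrightarrow> measure M A \<le> measure M B"
proof -
  interpret prob_space M by (rule prob_space_M)
  show "A \<subseteq> B \<Longrightarrow> B \<in> sets M \<Longrightarrow> measure M A \<le> measure M B"
    by (rule finite_measure_mono)
qed

lemma small_scale:
  assumes "0 < e" obtains k where "c2 * \<theta> ^ k < e"
proof -
  obtain k where "\<theta> ^ k < e / c2"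
    using real_arch_pow_inv[of "e / c2" \<theta>] assms c2 \<theta> by auto
  then show thesis using that c2 by (simp add: field_simps)
qed

definition \<B> :: "'b measure" where
  "\<B> = sigma (mspace m) {U. openin (mtopology_of m) U}"

lemma open_subset: "{U. openin (mtopology_of m) U} \<subseteq> Pow (mspace m)"
  using openin_subset[of "mtopology_of m"] by auto

lemma space_\<B>: "space \<B> = mspace m"
  and sets_\<B>: "sets \<B> = sigma_sets (mspace m) {U. openin (mtopology_of m) U}"
  using open_subset by (simp_all add: \<B>_def)

lemma open_sets: "openin (mtopology_of m) U \<Longrightarrow> U \<in> sets \<B>"
  by (simp add: sets_\<B> sigma_sets.Basic)

lemma mball_in_open:
  assumes "openin (mtopology_of m) U" "z \<in> U"
  obtains e where "0 < e" "mball_of m z e \<subseteq> U"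
  using assms Metric_space.openin_mtopology[OF Metric_space_mspace_mdist, of m U]
  by (auto simp: mtopology_of_def mball_of_def)

text \<open>The preimage of an open set is a union of cylinders. The union is countable, since a
  cylinder is determined by a finite word over the finite alphabet.\<close>

lemma \<phi>_measurable: "\<phi> \<in> measurable M \<B>"
  unfolding \<B>_def
proof (rule measurable_measure_of[OF open_subset])
  show "\<phi> \<in> space M \<rightarrow> mspace m"
    using \<phi> by (auto simp: space_M codes_def)
  fix U assume "U \<in> {U. openin (mtopology_of m) U}"
  then have U: "openin (mtopology_of m) U" by simp
  define K where "K = {(k, \<omega>). \<omega> \<in> codes \<and> cyl k \<omega> \<subseteq> \<phi> -` U}"
  have "\<phi> -` U \<inter> space M = \<Union>((\<lambda>(k, \<omega>). cyl k \<omega>) ` K)"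
  proof
    show "\<phi> -` U \<inter> space M \<subseteq> \<Union>((\<lambda>(k, \<omega>). cyl k \<omega>) ` K)"
    proof
      fix \<omega> assume "\<omega> \<in> \<phi> -` U \<inter> space M"
      then have \<omega>: "\<omega> \<in> codes" "\<phi> \<omega> \<in> U" by (auto simp: space_M)
      obtain e where e: "0 < e" "mball_of m (\<phi> \<omega>) e \<subseteq> U"
        using mball_in_open[OF U \<omega>(2)] by blast
      obtain k where k: "c2 * \<theta> ^ k < e" using small_scale[OF e(1)] by blast
      have "cyl k \<omega> \<subseteq> \<phi> -` U"
      proof
        fix \<omega>' assume \<omega>': "\<omega>' \<in> cyl k \<omega>"
        then have "\<phi> \<omega>' \<in> mball_of m (\<phi> \<omega>) e"
          using upper'[OF \<omega>(1) \<omega>'] k \<omega>(1) \<phi>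
          by (auto simp: codes_def cyl_def)
        then show "\<omega>' \<in> \<phi> -` U" using e by blast
      qed
      then have "(k, \<omega>) \<in> K" using \<omega> by (simp add: K_def)
      moreover have "\<omega> \<in> cyl k \<omega>" using \<omega> by (simp add: cyl_def)
      ultimately show "\<omega> \<in> \<Union>((\<lambda>(k, \<omega>). cyl k \<omega>) ` K)" by blast
    qed
    show "\<Union>((\<lambda>(k, \<omega>). cyl k \<omega>) ` K) \<subseteq> \<phi> -` U \<inter> space M"
      by (auto simp: K_def space_M cyl_def)
  qed
  moreover have "countable ((\<lambda>(k, \<omega>). cyl k \<omega>) ` K)"
  proof (rule countable_subset)
    let ?f = "\<lambda>xs. {\<omega>' \<in> codes. \<forall>i<length xs. xs ! i = \<omega>' i}"
    show "(\<lambda>(k, \<omega>). cyl k \<omega>) ` K \<subseteq> ?f ` lists S"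
    proof (clarsimp simp: K_def)
      fix k \<omega> assume "\<omega> \<in> codes"
      then have "\<omega> i \<in> S" for i by (auto simp: codes_def)
      then have "map \<omega> [0..<k] \<in> lists S" by auto
      moreover have "cyl k \<omega> = ?f (map \<omega> [0..<k])" by (simp add: cyl_def)
      ultimately show "cyl k \<omega> \<in> ?f ` lists S" by blast
    qed
    show "countable (?f ` lists S)"
      using S by (intro countable_image countable_lists countable_finite)
  qed
  ultimately show "\<phi> -` U \<inter> space M \<in> sets M"
    by (auto intro!: sets.countable_Union simp: K_def cyl_sets)
qed

definition \<mu> :: "'b measure" where
  "\<mu> = distr M \<B> \<phi>"

lemma measure_\<mu>: "A \<in> sets \<B> \<Longrightarrow> measure \<mu> A = measure M (\<phi> -` A \<inter> codes)"
  unfolding \<mu>_def using measure_distr[OF \<phi>_measurable] by (simp add: space_M)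

lemma finite_borel_\<mu>: "finite_borel_measure_on m \<mu>"
proof -
  interpret prob_space M by (rule prob_space_M)
  have "prob_space \<mu>" unfolding \<mu>_def by (rule prob_space_distr[OF \<phi>_measurable])
  then show ?thesis
    by (simp add: finite_borel_measure_on_def prob_space.finite_measure \<mu>_def space_\<B> sets_\<B>)
qed

lemma preimage_sets: "A \<in> sets \<B> \<Longrightarrow> \<phi> -` A \<inter> codes \<in> sets M"
  using measurable_sets[OF \<phi>_measurable] by (simp add: space_M)

text \<open>Allowing any measurable \<open>A\<close> around the point serves both the closed balls
  of the regularity estimate and the open neighbourhoods in the support.\<close>

lemma measure_\<mu>_ge:
  assumes "\<omega> \<in> codes" "A \<in> sets \<B>" "\<And>x. x \<in> mspace m \<Longrightarrow> mdist m (\<phi> \<omega>) x \<le> r \<Longrightarrow> x \<in> A" "c2 * \<theta> ^ k \<le> r"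
  shows "(\<theta> ^ k) powr s \<le> measure \<mu> A"
proof -
  have "cyl k \<omega> \<subseteq> \<phi> -` A \<inter> codes"
  proof
    fix \<omega>' assume \<omega>': "\<omega>' \<in> cyl k \<omega>"
    then have "\<omega>' \<in> codes" by (simp add: cyl_def)
    moreover have "\<phi> \<omega>' \<in> A"
      using upper'[OF assms(1) \<omega>'] assms(4) \<phi> \<open>\<omega>' \<in> codes\<close> by (intro assms(3)) (auto simp: codes_def)
    ultimately show "\<omega>' \<in> \<phi> -` A \<inter> codes" by simp
  qed
  then show ?thesis
    using measure_mono_M[OF _ preimage_sets[OF assms(2)]] measure_cyl[OF assms(1)] measure_\<mu>[OF assms(2)] by metis
qed

text \<open>A point approximated by the image is the image of the diagonal of the approximating codes, whose
  initial segments stabilise.\<close>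

lemma image_closed:
  assumes z: "z \<in> mspace m" "z \<notin> \<phi> ` codes"
  obtains e where "0 < e" "mball_of m z e \<inter> \<phi> ` codes = {}"
proof (rule ccontr)
  assume no: "\<not> thesis"
  \<comment> \<open>With half of \<open>c1 * \<theta> ^ k\<close>, two approximating points are
    closer than \<open>c1 * \<theta> ^ k\<close> to each other, and \<open>lower'\<close> makes
    their codes agree.\<close>
  have "\<exists>\<omega>\<in>codes. mdist m z (\<phi> \<omega>) < c1 * \<theta> ^ k / 2" for k
  proof -
    have "0 < c1 * \<theta> ^ k / 2" using c1 \<theta> by simp
    then have "mball_of m z (c1 * \<theta> ^ k / 2) \<inter> \<phi> ` codes \<noteq> {}"
      using no that by blast
    then show ?thesis
      by auto
  qed
  then obtain w where w: "\<And>k. w k \<in> codes" "\<And>k. mdist m z (\<phi> (w k)) < c1 * \<theta> ^ k / 2"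
    by metis
  have wm: "\<phi> (w k) \<in> mspace m" for k using w(1)[of k] \<phi> by (simp add: codes_def)
  have agree: "w k i = w j i" if "i \<le> k" "k \<le> j" for i j k
  proof -
    have "mdist m (\<phi> (w k)) (\<phi> (w j)) \<le> mdist m z (\<phi> (w k)) + mdist m z (\<phi> (w j))"
      using mdist_triangle[OF wm[of k] z(1) wm[of j]] by (simp add: mdist_commute)
    also have "\<dots> < c1 * \<theta> ^ k / 2 + c1 * \<theta> ^ j / 2"
      using w(2)[of k] w(2)[of j] by linarith
    also have "\<dots> \<le> c1 * \<theta> ^ k"
      using mult_left_mono[OF power_decreasing[OF that(2)], of \<theta> c1] \<theta> c1 by linarith
    finally show ?thesis
      using lower'[OF w(1) w(1)] that(1) by (auto simp: cyl_def)
  qed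
  define \<omega> where "\<omega> i = w i i" for i
  have \<omega>: "\<omega> \<in> codes"
    using w(1) by (fastforce simp: \<omega>_def codes_def)
  have "mdist m z (\<phi> \<omega>) \<le> (c1 + c2) * \<theta> ^ k" for k
  proof -
    have "\<omega> i = w k i" if "i < k" for i
      using agree[of i i k] that by (simp add: \<omega>_def)
    then have "w k \<in> cyl k \<omega>"
      using w(1)[of k] by (simp add: cyl_def)
    from upper'[OF \<omega> this] have "mdist m (\<phi> (w k)) (\<phi> \<omega>) \<le> c2 * \<theta> ^ k"
      by (simp add: mdist_commute)
    moreover have "mdist m z (\<phi> (w k)) \<le> c1 * \<theta> ^ k"
      using w(2)[of k] mdist_nonneg[of m z "\<phi> (w k)"] by linarith
    moreover have "\<phi> \<omega> \<in> mspace m" using \<omega> \<phi> by (simp add: codes_def)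
    ultimately show ?thesis
      using mdist_triangle[OF z(1) wm[of k], of "\<phi> \<omega>"] by (simp add: algebra_simps)
  qed
  moreover have "(\<lambda>k. (c1 + c2) * \<theta> ^ k) \<longlonglongrightarrow> 0"
    using \<theta> by (intro tendsto_mult_right_zero LIMSEQ_power_zero) auto
  ultimately have "mdist m z (\<phi> \<omega>) \<le> 0"
    by (intro LIMSEQ_le_const) auto
  then have "z = \<phi> \<omega>"
    using z(1) \<omega> \<phi> mdist_zero[of z m "\<phi> \<omega>"] mdist_nonneg[of m z "\<phi> \<omega>"] by (auto simp: codes_def)
  then show False using z(2) \<omega> by blast
qed

lemma image_sets: "\<phi> ` codes \<in> sets \<B>"
unfolding sets_\<B>
proof (rule closedin_sigma_sets)
  have sub: "\<phi> ` codes \<subseteq> mspace m" using \<phi> by (auto simp: codes_def)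
  have "openin (mtopology_of m) (mspace m - \<phi> ` codes)"
    unfolding mtopology_of_def Metric_space.openin_mtopology[OF Metric_space_mspace_mdist]
  proof (intro conjI allI impI)
    fix z assume "z \<in> mspace m - \<phi> ` codes"
    then obtain e where "0 < e" "mball_of m z e \<inter> \<phi> ` codes = {}"
      using image_closed by auto
    then show "\<exists>r>0. Metric_space.mball (mspace m) (mdist m) z r \<subseteq> mspace m - \<phi> ` codes"
      using Metric_space.mball_subset_mspace[OF Metric_space_mspace_mdist, of m z e]
      by (auto simp: mball_of_def)
  qed simp
  then show "closedin (mtopology_of m) (\<phi> ` codes)"
    using sub by (simp add: closedin_def)
qed

text \<open>Points outside the image have null neighbourhoods because the image is closed; a
  neighbourhood of an image point contains the image of a cylinder, which has positive mass.\<close>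

lemma support_\<mu>: "measure_support m \<mu> = \<phi> ` codes"
proof
  show "measure_support m \<mu> \<subseteq> \<phi> ` codes"
  proof (rule ccontr)
    assume "\<not> ?thesis"
    then obtain z where z: "z \<in> measure_support m \<mu>" "z \<notin> \<phi> ` codes" by blast
    have zm: "z \<in> mspace m" using z by (simp add: measure_support_def)
    obtain e where e: "0 < e" "mball_of m z e \<inter> \<phi> ` codes = {}"
      using image_closed[OF zm z(2)] by blast
    have "openin (mtopology_of m) (mball_of m z e)"
      using Metric_space.openin_mball[OF Metric_space_mspace_mdist, of m z e]
      by (simp add: mtopology_of_def mball_of_def)
    moreover have "mdist m z z < e" using e(1) zm by (metis mdist_zero)
    then have "z \<in> mball_of m z e"
      using zm by simp
    ultimately have op: "openin (mtopology_of m) (mball_of m z e)" "z \<in> mball_of m z e" .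
    have "\<phi> -` mball_of m z e \<inter> codes = {}" using e(2) by auto
    then have "measure \<mu> (mball_of m z e) = 0"
      using measure_\<mu>[OF open_sets[OF op(1)]] by simp
    then show False
      using z(1) op unfolding measure_support_def by fastforce
  qed
  show "\<phi> ` codes \<subseteq> measure_support m \<mu>"
  proof
    fix z assume "z \<in> \<phi> ` codes"
    then obtain \<omega> where \<omega>: "\<omega> \<in> codes" "z = \<phi> \<omega>" by blast
    have zm: "\<phi> \<omega> \<in> mspace m" using \<omega> \<phi> by (simp add: codes_def)
    have "0 < measure \<mu> U" if U: "openin (mtopology_of m) U" "\<phi> \<omega> \<in> U" for U
    proof -
      obtain e where e: "0 < e" "mball_of m (\<phi> \<omega>) e \<subseteq> U" using mball_in_open[OF U] by blast
      obtain k where k: "c2 * \<theta> ^ k < e" using small_scale[OF e(1)] by blast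
      have "x \<in> U" if "x \<in> mspace m" "mdist m (\<phi> \<omega>) x \<le> c2 * \<theta> ^ k" for x
        using e(2) that k zm
        by (auto simp: subset_iff)
      then have "(\<theta> ^ k) powr s \<le> measure \<mu> U"
        using measure_\<mu>_ge[OF \<omega>(1) open_sets[OF U(1)]] by blast
      moreover have "0 < (\<theta> ^ k) powr s" using \<theta> by simp
      ultimately show ?thesis by linarith
    qed
    then show "z \<in> measure_support m \<mu>"
      using zm \<omega>(2) by (simp add: measure_support_def)
  qed
qed

lemma measure_support_\<mu>: "measure \<mu> (measure_support m \<mu>) = 1"
proof -
  interpret prob_space M by (rule prob_space_M)
  have "\<phi> -` \<phi> ` codes \<inter> codes = space M" by (auto simp: space_M)
  then show ?thesis
    using measure_\<mu>[OF image_sets] prob_space by (simp add: support_\<mu>)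
qed

lemma mcball_sets: "mcball_of m z r \<in> sets \<B>"
  by (simp add: sets_\<B> mcball_of_sigma_sets)

text \<open>Each estimate takes the least depth whose scale fits \<open>r\<close>: for the lower
  bound a cylinder of that depth is mapped into the ball, for the upper bound the preimage of the
  ball lies in such a cylinder.\<close>

lemma ahlfors_regular_\<mu>: "ahlfors_regular_measure m s \<mu>"
proof -
  \<comment> \<open>\<open>\<theta> / c2\<close> handles a positive depth \<open>k\<close>, where
    depth \<open>k - 1\<close> is still too coarse; the 1 handles \<open>k = 0\<close>, where
    \<open>r < 1\<close> is used.\<close>
  define a where "a = min (\<theta> / c2) 1"
  define C where "C = max 1 (max (a powr (- s)) ((1 / c1) powr s))"
  have a: "0 < a" using \<theta> c2 by (simp add: a_def)
  have lo: "r powr s / C \<le> measure \<mu> (mcball_of m z r)" if z: "z \<in> \<phi> ` codes" and r: "0 < r" "r < 1" for z r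
  proof -
    obtain \<omega> where \<omega>: "\<omega> \<in> codes" "z = \<phi> \<omega>" using z by blast
    have zm: "\<phi> \<omega> \<in> mspace m" using \<omega> \<phi> by (simp add: codes_def)
    obtain k0 where "c2 * \<theta> ^ k0 < r" using small_scale[OF r(1)] by blast
    then have ex: "c2 * \<theta> ^ k0 \<le> r" by simp
    define k where "k = (LEAST k. c2 * \<theta> ^ k \<le> r)"
    have k: "c2 * \<theta> ^ k \<le> r" unfolding k_def by (rule LeastI[of _ k0]) (rule ex)
    have "a * r \<le> \<theta> ^ k"
    proof (cases k)
      case 0
      have "a * r \<le> 1 * 1" using a r by (intro mult_mono) (auto simp: a_def)
      then show ?thesis using 0 by simp
    next
      case (Suc j)
      then have "\<not> c2 * \<theta> ^ j \<le> r" unfolding k_def using not_less_Least[of j] by (metis lessI)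
      then have "\<theta> / c2 * r \<le> \<theta> / c2 * (c2 * \<theta> ^ j)"
        using \<theta> c2 by (intro mult_left_mono) auto
      also have "\<dots> = \<theta> ^ k" using c2 Suc by simp
      finally show ?thesis
        using r mult_right_mono[of a "\<theta> / c2" r] by (simp add: a_def)
    qed
    then have "(a * r) powr s \<le> (\<theta> ^ k) powr s"
      using a r s_pos by (intro powr_mono2) auto
    also have "\<dots> \<le> measure \<mu> (mcball_of m z r)"
      using zm \<omega>(2) by (intro measure_\<mu>_ge[OF \<omega>(1) mcball_sets _ k]) (simp add: in_mcball_of)
    finally have "(a * r) powr s \<le> measure \<mu> (mcball_of m z r)" .
    moreover have "r powr s / C \<le> (a * r) powr s"
    proof -
      have "a powr (- s) \<le> C" "0 < C" by (auto simp: C_def)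
      then have "r powr s \<le> C * (a powr s * r powr s)"
        using mult_right_mono[of "a powr (- s)" C "a powr s * r powr s"] a by (simp add: powr_minus field_simps)
      then show ?thesis
        using \<open>0 < C\<close> a r by (simp add: powr_mult field_simps)
    qed
    ultimately show ?thesis by linarith
  qed
  have up: "measure \<mu> (mcball_of m z r) \<le> C * r powr s" if z: "z \<in> \<phi> ` codes" and r: "0 < r" "r < 1" for z r
  proof -
    obtain \<omega> where \<omega>: "\<omega> \<in> codes" "z = \<phi> \<omega>" using z by blast
    have zm: "\<phi> \<omega> \<in> mspace m" using \<omega> \<phi> by (simp add: codes_def)
    obtain k0 where k0: "\<theta> ^ k0 < r / c1"
      using real_arch_pow_inv[of "r / c1" \<theta>] r c1 \<theta> by auto
    then have ex: "c1 * \<theta> ^ k0 \<le> r" using c1 by (simp add: field_simps)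
    define k where "k = (LEAST k. c1 * \<theta> ^ k \<le> r)"
    have k: "c1 * \<theta> ^ k \<le> r" unfolding k_def by (rule LeastI[of _ k0]) (rule ex)
    have "\<phi> -` mcball_of m z r \<inter> codes \<subseteq> cyl k \<omega>"
    proof
      fix \<omega>' assume "\<omega>' \<in> \<phi> -` mcball_of m z r \<inter> codes"
      then have \<omega>': "\<omega>' \<in> codes" "mdist m (\<phi> \<omega>) (\<phi> \<omega>') \<le> r" by (auto simp: \<omega>(2) in_mcball_of)
      show "\<omega>' \<in> cyl k \<omega>"
      proof (cases k)
        case 0
        then show ?thesis using \<omega>' by (simp add: cyl_def)
      next
        case (Suc j)
        then have "\<not> c1 * \<theta> ^ j \<le> r" unfolding k_def using not_less_Least[of j] by (metis lessI)
        \<comment> \<open>Minimality only excludes depth \<open>j\<close>; the extra coordinate in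
          \<open>lower'\<close> brings the cylinder to depth \<open>k\<close>.\<close>
        then show ?thesis
          using lower'[OF \<omega>(1) \<omega>'(1), of j] \<omega>'(2) Suc by simp
      qed
    qed
    then have "measure \<mu> (mcball_of m z r) \<le> (\<theta> ^ k) powr s"
      using measure_mono_M[OF _ cyl_sets[OF \<omega>(1)]] measure_cyl[OF \<omega>(1)] measure_\<mu>[OF mcball_sets] by metis
    also have "\<dots> \<le> (1 / c1 * r) powr s"
      using k c1 \<theta> s_pos by (intro powr_mono2) (auto simp: field_simps)
    also have "\<dots> = (1 / c1) powr s * r powr s"
      by (rule powr_mult)
    also have "\<dots> \<le> C * r powr s"
      by (intro mult_right_mono) (auto simp: C_def)
    finally show ?thesis .
  qed
  have "1 \<le> C" by (simp add: C_def)
  with lo up show ?thesis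
    unfolding ahlfors_regular_measure_def support_\<mu> using finite_borel_\<mu> by blast
qed

end

section \<open>Hausdorff dimension of the limit sets\<close>

lemma mdist_le_mdiam:
  assumes "x \<in> U" "y \<in> U" "mdiam m U \<noteq> \<infinity>"
  shows "mdist m x y \<le> enn2real (mdiam m U)"
proof -
  have "ennreal (mdist m x y) \<le> mdiam m U"
    unfolding mdiam_def using assms(1,2) by (auto intro: SUP_upper2)
  \<comment> \<open>Finiteness matters because \<open>enn2real \<infinity> = 0\<close>.\<close>
  then show ?thesis
    using enn2real_mono[of "ennreal (mdist m x y)" "mdiam m U"] assms(3) by (simp add: top.not_eq_extremum)
qed

lemma mdiam_le:
  assumes "\<And>x y. x \<in> U \<Longrightarrow> y \<in> U \<Longrightarrow> mdist m x y \<le> d"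
  shows "mdiam m U \<le> ennreal d"
  unfolding mdiam_def using assms by (intro SUP_least ennreal_leI)

text \<open>Radius 0 is included, which excludes atoms: a covering set may be a single point and
  then contributes 0 to the Hausdorff sum.\<close>

lemma ahlfors_ball_upper_bound:
  assumes reg: "ahlfors_regular_measure m s \<mu>" and s: "0 < s"
  obtains C where "1 \<le> C"
    "\<And>z r. z \<in> measure_support m \<mu> \<Longrightarrow> 0 \<le> r \<Longrightarrow> r < 1 \<Longrightarrow> measure \<mu> (mcball_of m z r) \<le> C * r powr s"
proof -
  obtain C where C: "1 \<le> C" and bound: "\<And>z r. z \<in> measure_support m \<mu> \<Longrightarrow> 0 < r \<Longrightarrow> r < 1 \<Longrightarrow>
      measure \<mu> (mcball_of m z r) \<le> C * r powr s"
    using reg unfolding ahlfors_regular_measure_def by blast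
  have fb: "finite_borel_measure_on m \<mu>" using reg by (simp add: ahlfors_regular_measure_def)
  interpret finite_measure \<mu> using fb by (simp add: finite_borel_measure_on_def)
  have "measure \<mu> (mcball_of m z r) \<le> C * r powr s"
    if z: "z \<in> measure_support m \<mu>" and r: "0 \<le> r" "r < 1" for z r
  proof (cases "r = 0")
    case False
    then show ?thesis using bound[OF z] r by simp
  next
    case True
    have "measure \<mu> (mcball_of m z 0) \<le> 0"
    proof (rule ccontr)
      assume "\<not> ?thesis"
      then have v: "0 < measure \<mu> (mcball_of m z 0)" by simp
      define v where "v = measure \<mu> (mcball_of m z 0)"
      \<comment> \<open>Chosen so that \<open>C * t powr s \<le> v / 2\<close>, and capped to stay
        below 1.\<close>
      define t where "t = min (1 / 2) ((v / (2 * C)) powr (1 / s))"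
      have t: "0 < t" "t < 1" using v C by (auto simp: t_def v_def)
      have "mcball_of m z t \<in> sets \<mu>"
        using fb mcball_of_sigma_sets by (auto simp: finite_borel_measure_on_def)
      then have "v \<le> measure \<mu> (mcball_of m z t)"
        unfolding v_def using t by (intro finite_measure_mono) (auto simp: subset_iff)
      also have "\<dots> \<le> C * t powr s" using bound[OF z t] .
      also have "t powr s \<le> ((v / (2 * C)) powr (1 / s)) powr s"
        using t s by (intro powr_mono2) (auto simp: t_def)
      also have "\<dots> = v / (2 * C)" using s v C by (simp add: powr_powr v_def)
      finally show False using v C by (simp add: v_def)
    qed
    then show ?thesis using True by simp
  qed
  then show thesis using that C by blast
qed

text \<open>This is the mass distribution principle: the part of the support in a covering set lies
  in a ball centred in the support, with the diameter of the set as radius. Its mass is at most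
  \<open>C\<close> times the corresponding term, so the terms cannot add up to less than
  \<open>v / C\<close>.\<close>

lemma ahlfors_hausdorff_measure_pos:
  assumes reg: "ahlfors_regular_measure m s \<mu>" and s: "0 < s"
    and pos: "0 < measure \<mu> (measure_support m \<mu>)" and sub: "measure_support m \<mu> \<subseteq> A"
  shows "hausdorff_measure m s A \<noteq> 0"
proof
  define J where "J = measure_support m \<mu>"
  define v where "v = measure \<mu> J"
  have v: "0 < v" using pos by (simp add: v_def J_def)
  have fb: "finite_borel_measure_on m \<mu>" using reg by (simp add: ahlfors_regular_measure_def)
  interpret finite_measure \<mu> using fb by (simp add: finite_borel_measure_on_def)
  have ball_sets: "mcball_of m z r \<in> sets \<mu>" for z r
    using fb mcball_of_sigma_sets by (auto simp: finite_borel_measure_on_def)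
  obtain C where C: "1 \<le> C" and bound: "\<And>z r. z \<in> J \<Longrightarrow> 0 \<le> r \<Longrightarrow> r < 1 \<Longrightarrow>
      measure \<mu> (mcball_of m z r) \<le> C * r powr s"
    using ahlfors_ball_upper_bound[OF reg s] unfolding J_def by metis
  assume "hausdorff_measure m s A = 0"
  \<comment> \<open>A mesh below 1 keeps the radii within the range of the regularity
    estimate.\<close>
  then have "hausdorff_premeasure m s (1 / 2) A = 0"
    unfolding hausdorff_measure_def by (metis SUP_upper greaterThan_iff half_gt_zero le_zero_eq zero_less_one)
  then have "hausdorff_premeasure m s (1 / 2) A < ennreal (v / (2 * C))"
    using v C by simp
  then obtain U where U: "\<And>i. U i \<subseteq> mspace m" "\<And>i. mdiam m (U i) \<le> ennreal (1 / 2)" "A \<subseteq> (\<Union>i. U i)"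
    and sum: "(\<Sum>i. ennreal (enn2real (mdiam m (U i)) powr s)) < ennreal (v / (2 * C))"
    unfolding hausdorff_premeasure_def Inf_less_iff by auto
  define d where "d i = enn2real (mdiam m (U i))" for i
  have d: "0 \<le> d i" "d i < 1" for i
  proof -
    show "0 \<le> d i" by (simp add: d_def)
    have "d i \<le> enn2real (ennreal (1 / 2))"
      unfolding d_def by (rule enn2real_mono[OF U(2) ennreal_less_top])
    also have "enn2real (ennreal (1 / 2)) = 1 / 2" by (rule enn2real_ennreal) simp
    finally show "d i < 1" by simp
  qed
  define z where "z i = (SOME x. x \<in> U i \<inter> J)" for i
  define B where "B i = (if U i \<inter> J = {} then {} else mcball_of m (z i) (d i))" for i
  have zJ: "z i \<in> U i \<inter> J" if "U i \<inter> J \<noteq> {}" for i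
    unfolding z_def using that by (metis some_in_eq)
  have "J \<subseteq> (\<Union>i. B i)"
  proof
    fix x assume x: "x \<in> J"
    then obtain i where i: "x \<in> U i" using sub U(3) by (auto simp: J_def)
    then have z: "z i \<in> U i \<inter> J" using zJ x by blast
    have "mdiam m (U i) \<noteq> \<infinity>" using U(2)[of i] by (auto simp: top_unique)
    then have "mdist m (z i) x \<le> d i"
      unfolding d_def using z i by (intro mdist_le_mdiam) auto
    then have "x \<in> B i"
      using x i z U(1)[of i] by (auto simp: B_def)
    then show "x \<in> (\<Union>i. B i)" by blast
  qed
  have B_sets: "range B \<subseteq> sets \<mu>"
    using ball_sets by (auto simp: B_def)
  have B_le: "emeasure \<mu> (B i) \<le> ennreal C * ennreal (d i powr s)" for i
  proof -
    have "measure \<mu> (B i) \<le> C * d i powr s"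
      using bound[of "z i" "d i"] zJ[of i] d[of i] C by (auto simp: B_def)
    then show ?thesis
      using C by (simp add: emeasure_eq_measure ennreal_mult[symmetric])
  qed
  have "ennreal v \<le> emeasure \<mu> (\<Union>i. B i)"
    unfolding v_def emeasure_eq_measure[symmetric] using \<open>J \<subseteq> (\<Union>i. B i)\<close> B_sets
    by (intro emeasure_mono) auto
  also have "\<dots> \<le> (\<Sum>i. emeasure \<mu> (B i))"
    by (rule emeasure_subadditive_countably[OF B_sets])
  also have "\<dots> \<le> (\<Sum>i. ennreal C * ennreal (d i powr s))"
    using B_le by (intro suminf_le) auto
  also have "\<dots> = ennreal C * (\<Sum>i. ennreal (d i powr s))" by simp
  also have "\<dots> \<le> ennreal C * ennreal (v / (2 * C))"
    using sum unfolding d_def by (intro mult_left_mono) auto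
  also have "\<dots> = ennreal (v / 2)"
    using C v by (simp add: ennreal_mult[symmetric])
  finally show False using v by (simp add: ennreal_le_iff)
qed

text \<open>The \<open>k\<close>-th piece gets the share \<open>\<eta> * (1 / 2) ^ Suc k\<close>,
  and the covers are merged into one sequence by \<open>prod_decode\<close>.\<close>

lemma hausdorff_premeasure_countable_null:
  assumes cover: "\<And>(k::nat) \<eta>. 0 < \<eta> \<Longrightarrow> \<exists>U::nat \<Rightarrow> 'b set. (\<forall>i. U i \<subseteq> mspace m \<and> mdiam m (U i) \<le> ennreal \<epsilon>) \<and>
      A k \<subseteq> (\<Union>i. U i) \<and> (\<Sum>i. ennreal (enn2real (mdiam m (U i)) powr s)) \<le> ennreal \<eta>"
    and sub: "B \<subseteq> (\<Union>k. A k)"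
  shows "hausdorff_premeasure m s \<epsilon> B = 0"
proof -
  have le: "hausdorff_premeasure m s \<epsilon> B \<le> ennreal \<eta>" if \<eta>: "0 < \<eta>" for \<eta>
  proof -
    have "\<exists>U. (\<forall>i. U i \<subseteq> mspace m \<and> mdiam m (U i) \<le> ennreal \<epsilon>) \<and>
      A k \<subseteq> (\<Union>i. U i) \<and> (\<Sum>i. ennreal (enn2real (mdiam m (U i)) powr s)) \<le> ennreal (\<eta> * (1 / 2) ^ Suc k)"
      for k using \<eta> by (intro cover) simp
    then obtain U where U: "\<And>k i::nat. U k i \<subseteq> mspace m" "\<And>k i. mdiam m (U k i) \<le> ennreal \<epsilon>"
      "\<And>k. A k \<subseteq> (\<Union>i. U k i)"
      "\<And>k. (\<Sum>i. ennreal (enn2real (mdiam m (U k i)) powr s)) \<le> ennreal (\<eta> * (1 / 2) ^ Suc k)"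
      by metis
    define W where "W = (\<lambda>(k, i). U k i)"
    define w where "w q = ennreal (enn2real (mdiam m (W q)) powr s)" for q
    have "(\<Sum>j. w (prod_decode j)) = (\<Sum>k. \<Sum>i. w (k, i))"
      by (rule suminf_ennreal_2dimen) simp
    also have "\<dots> \<le> (\<Sum>k. ennreal (\<eta> * (1 / 2) ^ Suc k))"
      using U(4) by (intro suminf_le) (auto simp: w_def W_def)
    also have "\<dots> = ennreal (\<Sum>k. \<eta> * (1 / 2) ^ Suc k)"
      using \<eta> sums_mult[OF power_half_series, of \<eta>]
      by (intro suminf_ennreal2) (auto simp: sums_iff)
    also have "(\<Sum>k. \<eta> * (1 / 2) ^ Suc k) = \<eta>"
      using sums_mult[OF power_half_series, of \<eta>] by (simp add: sums_iff)
    finally have sum: "(\<Sum>j. w (prod_decode j)) \<le> ennreal \<eta>" .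
    have "B \<subseteq> (\<Union>j. W (prod_decode j))"
    proof
      fix x assume "x \<in> B"
      then obtain k i where "x \<in> U k i" using sub U(3) by blast
      then have "x \<in> W (prod_decode (prod_encode (k, i)))" by (simp add: W_def)
      then show "x \<in> (\<Union>j. W (prod_decode j))" by blast
    qed
    then have "hausdorff_premeasure m s \<epsilon> B \<le> (\<Sum>j. w (prod_decode j))"
      unfolding hausdorff_premeasure_def w_def
    proof (intro Inf_lower CollectI exI[of _ "\<lambda>j. W (prod_decode j)"] conjI allI refl)
      fix j
      obtain k i where "prod_decode j = (k, i)" by (cases "prod_decode j")
      then show "W (prod_decode j) \<subseteq> mspace m" "mdiam m (W (prod_decode j)) \<le> ennreal \<epsilon>"
        using U(1,2) by (simp_all add: W_def)
    qed
    then show ?thesis using sum by simp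
  qed
  show ?thesis
  proof (rule ccontr)
    assume "hausdorff_premeasure m s \<epsilon> B \<noteq> 0"
    then have "0 < hausdorff_premeasure m s \<epsilon> B"
      using not_gr_zero by blast
    then obtain q where q: "0 < q" "q < hausdorff_premeasure m s \<epsilon> B"
      using dense by blast
    then obtain r where "q = ennreal r" "0 \<le> r" by (cases q) auto
    then have "0 < r" using q(1) by simp
    from le[OF this] show False using q(2) \<open>q = ennreal r\<close> by (simp add: not_le[symmetric])
  qed
qed

section \<open>Covers by shadows and the two bounds for the dimension\<close>

context hyperbolic_group_visual
begin

definition shadow :: "real \<Rightarrow> ('a \<Rightarrow> 'a) \<Rightarrow> (nat \<Rightarrow> 'a) set set" where
  "shadow \<kappa> g = {\<eta> \<in> gromov_boundary p. gromov_product_bd_pt (g p) \<eta> p \<le> ereal \<kappa>}"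

text \<open>Seen from \<open>p\<close>, representatives of both points follow \<open>g p\<close> for
  almost its whole displacement. The losses are 1 to get a strict inequality, one \<open>c\<close>
  for the choice of representatives, one for the triangle through \<open>g p\<close>, and
  \<open>2 * c\<close> for the return to the boundary.\<close>

lemma shadow_product:
  assumes "\<xi> \<in> shadow \<kappa> g" "\<eta> \<in> shadow \<kappa> g"
  shows "ereal (dist p (g p) - \<kappa> - 1 - 4 * c) \<le> gromov_product_bd p \<xi> \<eta>"
proof -
  have near: "\<exists>N. \<forall>n\<ge>N. dist p (g p) - \<kappa> - 1 - c \<le> gp p (x n) (g p)"
    if \<zeta>: "\<zeta> \<in> shadow \<kappa> g" and x: "x \<in> \<zeta>" for \<zeta> x
  proof -
    have "gromov_product_bd_pt (g p) \<zeta> p \<le> ereal \<kappa>"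
      using \<zeta> by (simp add: shadow_def)
    also have "ereal \<kappa> < ereal (\<kappa> + 1)" by simp
    finally obtain N where N: "\<And>n. n \<ge> N \<Longrightarrow> gp (g p) (x n) p < \<kappa> + 1 + c"
      using gromov_product_bd_pt_lessD[of \<zeta> x] \<zeta> x unfolding shadow_def by blast
    have "dist p (g p) - \<kappa> - 1 - c \<le> gp p (x n) (g p)" if "n \<ge> N" for n
      using N[OF that] gp_flip[of p "g p" "x n"] by (simp add: gp_commute)
    then show ?thesis by blast
  qed
  have bd: "\<xi> \<in> gromov_boundary p" "\<eta> \<in> gromov_boundary p" using assms by (auto simp: shadow_def)
  obtain x where x: "x \<in> \<xi>" using boundary_ne bd(1) by blast
  obtain y where y: "y \<in> \<eta>" using boundary_ne bd(2) by blast
  obtain N1 where N1: "\<forall>n\<ge>N1. dist p (g p) - \<kappa> - 1 - c \<le> gp p (x n) (g p)" using near[OF assms(1) x] by blast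
  obtain N2 where N2: "\<forall>n\<ge>N2. dist p (g p) - \<kappa> - 1 - c \<le> gp p (y n) (g p)" using near[OF assms(2) y] by blast
  define N where "N = max N1 N2"
  have "dist p (g p) - \<kappa> - 1 - 2 * c \<le> gp p (x i) (y j)" if "N \<le> i" "N \<le> j" for i j
  proof -
    have "dist p (g p) - \<kappa> - 1 - c \<le> gp p (x i) (g p)" "dist p (g p) - \<kappa> - 1 - c \<le> gp p (y j) (g p)"
      using N1 N2 that by (auto simp: N_def)
    then show ?thesis
      using hyp[of p "x i" "g p" "y j"] gp_commute[of p "g p" "y j"] by linarith
  qed
  from gromov_product_bd_ge[OF bd(1) x bd(2) y this] show ?thesis by (simp add: algebra_simps)
qed

lemma shadow_diameter:
  obtains W where "0 < W" "\<And>g. mdiam D (shadow \<kappa> g) \<le> ennreal (W * b powr (- dist p (g p)))"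
proof -
  obtain V where V: "1 \<le> V"
    "\<And>\<xi> \<eta>. \<xi> \<in> gromov_boundary p \<Longrightarrow> \<eta> \<in> gromov_boundary p \<Longrightarrow>
      mdist D \<xi> \<eta> \<le> V * powr_minus b (gromov_product_bd p \<xi> \<eta>)"
    using visual_bounds by metis
  show thesis
  proof (rule that[of "V * b powr (\<kappa> + 1 + 4 * c)"])
    show "0 < V * b powr (\<kappa> + 1 + 4 * c)" using V b by simp
    show "mdiam D (shadow \<kappa> g) \<le> ennreal (V * b powr (\<kappa> + 1 + 4 * c) * b powr (- dist p (g p)))" for g
    proof (rule mdiam_le)
      fix \<xi> \<eta> assume sh: "\<xi> \<in> shadow \<kappa> g" "\<eta> \<in> shadow \<kappa> g"
      have "mdist D \<xi> \<eta> \<le> V * powr_minus b (gromov_product_bd p \<xi> \<eta>)"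
        using sh by (intro V(2)) (auto simp: shadow_def)
      also have "\<dots> \<le> V * b powr (- (dist p (g p) - \<kappa> - 1 - 4 * c))"
        using V(1) powr_minus_le[OF b shadow_product[OF sh]] by (intro mult_left_mono) auto
      also have "b powr (- (dist p (g p) - \<kappa> - 1 - 4 * c)) = b powr (\<kappa> + 1 + 4 * c) * b powr (- dist p (g p))"
        unfolding powr_add[symmetric] by (simp add: algebra_simps)
      finally show "mdist D \<xi> \<eta> \<le> V * b powr (\<kappa> + 1 + 4 * c) * b powr (- dist p (g p))"
        by (simp add: mult.assoc)
    qed
  qed
qed

lemma converges_to_boundary_escapes:
  assumes "\<eta> \<in> gromov_boundary p" "converges_to_boundary p (\<lambda>n. g n p) \<eta>"
  shows "\<exists>n. t < dist p (g n p)"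
proof -
  obtain x where x: "x \<in> \<eta>" using boundary_ne assms(1) by blast
  have "eventually (\<lambda>n. ereal t < gromov_product_bd_pt p \<eta> (g n p)) sequentially"
    using assms(2) unfolding converges_to_boundary_def tendsto_PInfty by blast
  then obtain n where n: "ereal t < gromov_product_bd_pt p \<eta> (g n p)"
    by (meson eventually_sequentially order_refl)
  have "gromov_product_bd_pt p \<eta> (g n p) \<le> ereal (dist p (g n p))"
    by (rule gromov_product_bd_pt_le[OF x, of 0]) (rule gp_le_right)
  then have "ereal t < ereal (dist p (g n p))" using n by (rule less_le_trans[rotated])
  then show ?thesis by auto
qed

lemma countable_G: "countable G"
proof -
  have "G \<subseteq> (\<Union>n::nat. {g \<in> G. dist p (g p) \<le> real n})"
    using real_arch_simple by blast
  moreover have "countable (\<Union>n::nat. {g \<in> G. dist p (g p) \<le> real n})"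
    using finite_G_ball by (intro countable_UN) (auto intro: countable_finite)
  ultimately show ?thesis by (rule countable_subset)
qed

text \<open>The width of the shadows depends on the radial constant, so the radial limit set is
  exhausted by countably many integer constants. For each of them every tail of one enumeration of
  \<open>G\<close> yields a cover.\<close>

lemma hausdorff_measure_radial:
  assumes inf: "infinite G" and s: "0 < s" and sum: "(\<lambda>g. b powr (- s * dist p (g p))) summable_on G"
    and A: "A \<subseteq> radial_limit_set p G"
  shows "hausdorff_measure D s A = 0"
proof -
  define e where "e = from_nat_into G"
  have e: "bij_betw e UNIV G"
    unfolding e_def using countable_G inf by (rule bij_betw_from_nat_into)
  define f where "f i = b powr (- s * dist p (e i p))" for i
  have "summable f"
    using sum summable_on_reindex_bij_betw[OF e, of "\<lambda>g. b powr (- s * dist p (g p))"]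
      summable_on_UNIV_nonneg_real_iff[of f] by (simp add: f_def[abs_def])
  have "hausdorff_premeasure D s \<epsilon> A = 0" if \<epsilon>: "0 < \<epsilon>" for \<epsilon>
  proof (rule hausdorff_premeasure_countable_null)
    show "A \<subseteq> (\<Union>k. radial_limit_set_at p G (real (Suc k)))"
    proof
      fix \<eta> assume "\<eta> \<in> A"
      then obtain \<sigma> where \<sigma>: "\<eta> \<in> radial_limit_set_at p G \<sigma>"
        using A by (auto simp: radial_limit_set_def)
      obtain k :: nat where "\<sigma> \<le> real k" using real_arch_simple by blast
      then have "ereal \<sigma> \<le> ereal (real (Suc k))" by simp
      then have "\<eta> \<in> radial_limit_set_at p G (real (Suc k))"
        using \<sigma> unfolding radial_limit_set_at_def by (blast intro: order_trans)
      then show "\<eta> \<in> (\<Union>k. radial_limit_set_at p G (real (Suc k)))" by blast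
    qed
  next
    fix k :: nat and \<eta> :: real assume \<eta>: "0 < \<eta>"
    define \<kappa> where "\<kappa> = real (Suc k)"
    obtain W where W: "0 < W" "\<And>g. mdiam D (shadow \<kappa> g) \<le> ennreal (W * b powr (- dist p (g p)))"
      using shadow_diameter by blast
    \<comment> \<open>The term \<open>\<epsilon> powr s\<close> lets the small tail control the mesh
      as well, since a single summand is at most the whole tail.\<close>
    define \<eta>' where "\<eta>' = min \<eta> (\<epsilon> powr s)"
    have "0 < \<eta>' / W powr s" using \<eta> \<epsilon> W(1) by (simp add: \<eta>'_def)
    then obtain K where "\<forall>n\<ge>K. norm (\<Sum>i. f (i + n)) < \<eta>' / W powr s"
      using suminf_exist_split[OF _ \<open>summable f\<close>] by blast
    then have tail: "(\<Sum>i. f (i + K)) < \<eta>' / W powr s"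
      by (metis abs_ge_self le_less_trans order_refl real_norm_def)
    have sum_tail: "summable (\<lambda>i. f (i + K))"
      using \<open>summable f\<close> by (rule summable_ignore_initial_segment)
    have f_nonneg: "0 \<le> f i" for i by (simp add: f_def)
    have diam_powr: "(W * b powr (- dist p (e i p))) powr s = W powr s * f i" for i
      using W(1) b by (simp add: f_def powr_mult powr_powr mult.commute)
    have W_tail: "W powr s * (\<Sum>i. f (i + K)) \<le> \<eta>'"
      using tail W(1) by (simp add: field_simps)
    define U where "U i = shadow \<kappa> (e (i + K))" for i
    have diam: "mdiam D (U i) \<le> ennreal (W * b powr (- dist p (e (i + K) p)))" for i
      unfolding U_def by (rule W(2))
    have small: "W * b powr (- dist p (e (i + K) p)) \<le> \<epsilon>" for i
    proof (rule ccontr)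
      assume "\<not> ?thesis"
      then have "\<epsilon> powr s < (W * b powr (- dist p (e (i + K) p))) powr s"
        using \<epsilon> s by (intro powr_less_mono2) auto
      also have "\<dots> \<le> W powr s * (\<Sum>i. f (i + K))"
        unfolding diam_powr using sum_le_suminf[OF sum_tail, of "{i}"] f_nonneg W(1) by (intro mult_left_mono) auto
      finally show False using W_tail by (simp add: \<eta>'_def)
    qed
    have "(\<Sum>i. ennreal (enn2real (mdiam D (U i)) powr s)) \<le> (\<Sum>i. ennreal (W powr s * f (i + K)))"
    proof (intro suminf_le ennreal_leI)
      fix i
      have "enn2real (mdiam D (U i)) \<le> enn2real (ennreal (W * b powr (- dist p (e (i + K) p))))"
        using diam by (rule enn2real_mono) simp
      also have "\<dots> = W * b powr (- dist p (e (i + K) p))" using W(1) by simp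
      finally show "enn2real (mdiam D (U i)) powr s \<le> W powr s * f (i + K)"
        unfolding diam_powr[symmetric] using s by (intro powr_mono2) auto
    qed auto
    also have "\<dots> = ennreal (W powr s * (\<Sum>i. f (i + K)))"
      using f_nonneg sum_tail by (subst suminf_ennreal2) (auto simp: suminf_mult summable_mult)
    also have "\<dots> \<le> ennreal \<eta>"
      using W_tail by (intro ennreal_leI) (simp add: \<eta>'_def)
    finally have sum_U: "(\<Sum>i. ennreal (enn2real (mdiam D (U i)) powr s)) \<le> ennreal \<eta>" .
    have cover: "radial_limit_set_at p G \<kappa> \<subseteq> (\<Union>i. U i)"
    proof
      fix \<xi> assume "\<xi> \<in> radial_limit_set_at p G \<kappa>"
      then obtain g where \<xi>: "\<xi> \<in> gromov_boundary p" and g: "\<And>n. g n \<in> G"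
        "converges_to_boundary p (\<lambda>n. g n p) \<xi>" "\<And>n. gromov_product_bd_pt (g n p) \<xi> p \<le> ereal \<kappa>"
        unfolding radial_limit_set_at_def by blast
      \<comment> \<open>A displacement above the sum of the first \<open>K\<close> displacements
        rules out each of these elements.\<close>
      obtain n where n: "(\<Sum>i<K. dist p (e i p)) < dist p (g n p)"
        using converges_to_boundary_escapes[where g = g, OF \<xi> g(2)] by blast
      obtain i where i: "g n = e i" using g(1) e by (metis bij_betw_imp_surj_on imageE)
      have "K \<le> i"
      proof (rule ccontr)
        assume "\<not> K \<le> i"
        then have "dist p (e i p) \<le> (\<Sum>i<K. dist p (e i p))"
          by (intro member_le_sum) auto
        then show False using n i by simp
      qed
      then have "\<xi> \<in> U (i - K)"
        using \<xi> g(3)[of n] i by (simp add: U_def shadow_def)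
      then show "\<xi> \<in> (\<Union>i. U i)" by blast
    qed
    show "\<exists>U::nat \<Rightarrow> _. (\<forall>i. U i \<subseteq> mspace D \<and> mdiam D (U i) \<le> ennreal \<epsilon>) \<and>
        radial_limit_set_at p G (real (Suc k)) \<subseteq> (\<Union>i. U i) \<and>
        (\<Sum>i. ennreal (enn2real (mdiam D (U i)) powr s)) \<le> ennreal \<eta>"
    proof (intro exI[of _ U] conjI allI)
      show "U i \<subseteq> mspace D" for i by (auto simp: U_def shadow_def mspace_D)
      show "mdiam D (U i) \<le> ennreal \<epsilon>" for i
        using diam[of i] ennreal_leI[OF small[of i]] by (rule order_trans)
    qed (use cover sum_U in \<open>simp_all add: \<kappa>_def\<close>)
  qed
  then show ?thesis
    unfolding hausdorff_measure_def by simp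
qed

lemma infinite_G:
  assumes "general_type p D G" shows "infinite G"
proof
  assume fin: "finite G"
  obtain \<sigma> where "\<And>t. \<exists>g\<in>G. t \<le> dist p (g p)"
    using general_type_schottky[OF assms] by metis
  then obtain g where "g \<in> G" "(\<Sum>h\<in>G. dist p (h p)) + 1 \<le> dist p (g p)" by blast
  moreover from this have "dist p (g p) \<le> (\<Sum>h\<in>G. dist p (h p))"
    using fin by (intro member_le_sum) auto
  ultimately show False by linarith
qed

lemma hausdorff_dim_le_poincare:
  assumes gt: "general_type p D G" and A: "A \<subseteq> radial_limit_set p G"
  shows "hausdorff_dim D A \<le> poincare_exponent b p G"
  unfolding poincare_exponent_def
proof (rule Inf_greatest)
  fix u assume "u \<in> {ereal s |s. 0 \<le> s \<and> (\<lambda>g. b powr (- s * dist p (g p))) summable_on G}"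
  then obtain t where t: "u = ereal t" "0 \<le> t" and sum: "(\<lambda>g. b powr (- t * dist p (g p))) summable_on G"
    by blast
  show "hausdorff_dim D A \<le> u"
  \<comment> \<open>\<open>t\<close> may be 0, whereas \<open>hausdorff_dim\<close> is an infimum
    over positive exponents.\<close>
  proof (rule ereal_le_epsilon2)
    fix \<epsilon> :: real assume \<epsilon>: "0 < \<epsilon>"
    have "(\<lambda>g. b powr (- (t + \<epsilon>) * dist p (g p))) summable_on G"
    proof (rule summable_on_comparison_test[OF sum])
      show "b powr (- (t + \<epsilon>) * dist p (g p)) \<le> b powr (- t * dist p (g p))" for g
        using b \<epsilon> by (intro powr_mono mult_right_mono) auto
    qed simp
    then have "hausdorff_measure D (t + \<epsilon>) A = 0"
      using t \<epsilon> by (intro hausdorff_measure_radial[OF infinite_G[OF gt] _ _ A]) auto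
    then show "hausdorff_dim D A \<le> u + ereal \<epsilon>"
      unfolding hausdorff_dim_def t(1) using t \<epsilon> by (intro Inf_lower) auto
  qed
qed

lemma ahlfors_regular_radial:
  assumes gt: "general_type p D G" and s: "0 < s" "ereal s < poincare_exponent b p G"
  obtains \<mu> where "ahlfors_regular_measure D s \<mu>" "measure_support D \<mu> \<noteq> {}"
    "0 < measure \<mu> (measure_support D \<mu>)" "measure_support D \<mu> \<subseteq> unif_radial_limit_set p G"
proof -
  obtain S :: "('a \<Rightarrow> 'a) set" and \<phi> :: "(nat \<Rightarrow> 'a \<Rightarrow> 'a) \<Rightarrow> (nat \<Rightarrow> 'a) set" and \<theta> c1 c2 :: real
  where cantor: "finite S" "S \<noteq> {}" "0 < \<theta>" "\<theta> < 1" "real (card S) * \<theta> powr s = 1" "0 < c1" "0 < c2"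
    and radial: "\<And>\<omega>. range \<omega> \<subseteq> S \<Longrightarrow> \<phi> \<omega> \<in> unif_radial_limit_set p G"
    and metric: "\<And>\<omega>. range \<omega> \<subseteq> S \<Longrightarrow> \<phi> \<omega> \<in> mspace D"
    "\<And>\<omega> \<omega>' k. range \<omega> \<subseteq> S \<Longrightarrow> range \<omega>' \<subseteq> S \<Longrightarrow> (\<And>i. i < k \<Longrightarrow> \<omega> i = \<omega>' i) \<Longrightarrow>
       mdist D (\<phi> \<omega>) (\<phi> \<omega>') \<le> c2 * \<theta> ^ k"
    "\<And>\<omega> \<omega>' k. range \<omega> \<subseteq> S \<Longrightarrow> range \<omega>' \<subseteq> S \<Longrightarrow> (\<And>i. i < k \<Longrightarrow> \<omega> i = \<omega>' i) \<Longrightarrow> \<omega> k \<noteq> \<omega>' k \<Longrightarrow>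
       c1 * \<theta> ^ k \<le> mdist D (\<phi> \<omega>) (\<phi> \<omega>')"
    by (rule cantor_coding[OF gt s]) blast
  interpret cantor: coded_cantor_set D S \<phi> \<theta> s c1 c2
    by unfold_locales (fact s cantor metric)+
  show thesis
  proof (rule that[OF cantor.ahlfors_regular_\<mu>])
    obtain a where "a \<in> S" using cantor(2) by blast
    then have "(\<lambda>_. a) \<in> cantor.codes" by (auto simp: cantor.codes_def)
    then show "measure_support D cantor.\<mu> \<noteq> {}"
      by (auto simp: cantor.support_\<mu>)
    show "0 < measure cantor.\<mu> (measure_support D cantor.\<mu>)"
      by (simp add: cantor.measure_support_\<mu>)
    show "measure_support D cantor.\<mu> \<subseteq> unif_radial_limit_set p G"
      using radial by (auto simp: cantor.support_\<mu> cantor.codes_def)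
  qed
qed

lemma poincare_le_hausdorff_dim:
  assumes gt: "general_type p D G" and A: "unif_radial_limit_set p G \<subseteq> A"
  shows "poincare_exponent b p G \<le> hausdorff_dim D A"
  unfolding hausdorff_dim_def
proof (rule Inf_greatest)
  fix u assume "u \<in> {ereal s |s. 0 < s \<and> hausdorff_measure D s A = 0}"
  then obtain s where s: "u = ereal s" "0 < s" "hausdorff_measure D s A = 0" by blast
  show "poincare_exponent b p G \<le> u"
  proof (rule ccontr)
    assume "\<not> ?thesis"
    then have "ereal s < poincare_exponent b p G" using s(1) by simp
    then obtain \<mu> where "ahlfors_regular_measure D s \<mu>"
      "0 < measure \<mu> (measure_support D \<mu>)" "measure_support D \<mu> \<subseteq> unif_radial_limit_set p G"
      using ahlfors_regular_radial[OF gt s(2)] by metis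
    then show False
      using ahlfors_hausdorff_measure_pos s(2,3) A by (metis order_trans)
  qed
qed

end

lemma unif_radial_subset_radial: "unif_radial_limit_set p G \<subseteq> radial_limit_set p G"
  unfolding unif_radial_limit_set_def radial_limit_set_def unif_radial_limit_set_at_def radial_limit_set_at_def
  by blast

theorem theorem5p9:
  fixes p :: "'a::metric_space" and b :: real
    and D :: "(nat \<Rightarrow> 'a) set metric" and G :: "('a \<Rightarrow> 'a) set"
  assumes "gromov_hyperbolic TYPE('a)"
    and "b > 1" and "visual_metric b p D"
    and "subgroup G isom_group"
    and "strongly_discrete p G" and "general_type p D G"
  shows "hausdorff_dim D (radial_limit_set p G) = hausdorff_dim D (unif_radial_limit_set p G) \<and>
         hausdorff_dim D (unif_radial_limit_set p G) = poincare_exponent b p G \<and>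
         (\<forall>s::real. 0 < s \<and> ereal s < poincare_exponent b p G \<longrightarrow>
           (\<exists>J. J \<noteq> {} \<and> ahlfors_regular_set D s J \<and> J \<subseteq> unif_radial_limit_set p G))"
proof -
  obtain c where "0 \<le> c"
    "\<And>w x y z :: 'a. min (gp w x y) (gp w y z) - c \<le> gp w x z"
    using assms(1) unfolding gromov_hyperbolic_def by blast
  then interpret hyperbolic_group_visual p c G b D
    by (intro hyperbolic_group_visual.intro hyperbolic_group.intro hyperbolic_space.intro
        hyperbolic_group_axioms.intro hyperbolic_group_visual_axioms.intro) (use assms in auto)
  \<comment> \<open>Both bounds hold for every set between the two limit sets, so each equality is
    an instance.\<close>
  have dim: "hausdorff_dim D A = poincare_exponent b p G"
    if "unif_radial_limit_set p G \<subseteq> A" "A \<subseteq> radial_limit_set p G" for A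
    using hausdorff_dim_le_poincare[OF assms(6) that(2)] poincare_le_hausdorff_dim[OF assms(6) that(1)]
    by (rule antisym)
  have "\<exists>J. J \<noteq> {} \<and> ahlfors_regular_set D s J \<and> J \<subseteq> unif_radial_limit_set p G"
    if "0 < s" "ereal s < poincare_exponent b p G" for s
    using ahlfors_regular_radial[OF assms(6) that] unfolding ahlfors_regular_set_def by metis
  then show ?thesis
    using dim[OF unif_radial_subset_radial order_refl] dim[OF order_refl unif_radial_subset_radial] by simp
qed

end
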